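(* Isospectral sets are compact: for every $a\in\mathcal{M}_g$ the set $I(a)$ is compact. If the $2g$ roots of the polynomial $a(\lambda)=-\lambda\det\xi_\lambda$, for $\xi_\lambda\in\mathcal{P}_g$, are pairwise distinct, then $I(a)\cong(\mathbb{S}^1)^g$ is a connected smooth $g$-dimensional manifold diffeomorphic to a $g$-dimensional real torus.
   Context: For $g\in\mathbb{N}_0$ the set of potentials is $$\mathcal{P}_g=\Bigl\{\xi_\lambda=\sum_{d=-1}^{g}\hat\xi_d\lambda^d\ \Big|\ \hat\xi_{-1}\in\begin{pmatrix}0&i\mathbb{R}^+\\0&0\end{pmatrix},\ \mathrm{tr}(\hat\xi_{-1}\hat\xi_0)\neq0,\ \hat\xi_d=-\overline{\hat\xi_{g-1-d}}^{\,t}\in\mathfrak{sl}_2(\mathbb{C})\text{ for }d=-1,\dots,g\Bigr\},$$ an open subset of a $(3g+1)$-dimensional real vector space. $\mathcal{M}_g=\{-\lambda\det\xi_\lambda\mid\xi_\lambda\in\mathcal{P}_g\}$, a set of polynomials of degree $2g$. The isospectral set of $a\in\mathcal{M}_g$ is $I(a)=\{\xi_\lambda\in\mathcal{P}_g\mid-\lambda\det\xi_\lambda=a(\lambda)\}$. *)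

theory Defs
  imports "HOL-Analysis.Analysis" "HOL-Computational_Algebra.Polynomial"
begin

(* A Laurent polynomial with matrix coefficients is the family of its coefficients,
   indexed by the exponent; topology on families is the product topology. On families
   supported in {-1..g} this is the standard topology of a finite-dimensional real
   vector space. *)

definition laurent_eval :: "nat \<Rightarrow> (int \<Rightarrow> complex^2^2) \<Rightarrow> complex \<Rightarrow> complex^2^2" where
  "laurent_eval g \<xi> l = (\<chi> i j. \<Sum>d = -1..int g. \<xi> d $ i $ j * l powi d)"

definition conj_transpose :: "complex^2^2 \<Rightarrow> complex^2^2" where
  "conj_transpose A = transpose (map_matrix cnj A)"

definition sl2 :: "(complex^2^2) set" where
  "sl2 = {A. trace A = 0}"

definition potentials :: "nat \<Rightarrow> (int \<Rightarrow> complex^2^2) set" where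
  "potentials g = {\<xi>.
     (\<forall>d. d \<notin> {-1..int g} \<longrightarrow> \<xi> d = 0) \<and>
     (\<exists>t::real. t > 0 \<and> \<xi> (-1) = vector [vector [0, \<i> * complex_of_real t], vector [0, 0]]) \<and>
     trace (\<xi> (-1) ** \<xi> 0) \<noteq> 0 \<and>
     (\<forall>d \<in> {-1..int g}. \<xi> d \<in> sl2 \<and> \<xi> d = - conj_transpose (\<xi> (int g - 1 - d)))}"

(* The right-hand side is a priori a Laurent polynomial in l, hence l = 0 is left out;
   at most one polynomial a satisfies this. *)
definition spectral_poly :: "nat \<Rightarrow> (int \<Rightarrow> complex^2^2) \<Rightarrow> complex poly \<Rightarrow> bool" where
  "spectral_poly g \<xi> a \<longleftrightarrow> (\<forall>l. l \<noteq> 0 \<longrightarrow> poly a l = - l * det (laurent_eval g \<xi> l))"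

definition spectral_polys :: "nat \<Rightarrow> complex poly set" where
  "spectral_polys g = {a. \<exists>\<xi> \<in> potentials g. spectral_poly g \<xi> a}"

definition isospectral_set :: "nat \<Rightarrow> complex poly \<Rightarrow> (int \<Rightarrow> complex^2^2) set" where
  "isospectral_set g a = {\<xi> \<in> potentials g. spectral_poly g \<xi> a}"

(* Smoothness is defined for maps between products of normed spaces, so that the dimension
   can be a natural number. C_k k U f (for open U): the iterated directional derivatives of f
   up to order k, each in a direction v of a single factor i, exist and are continuous on U.
   For functions that depend on finitely many coordinates, in finite-dimensional factors,
   this is the usual class C^k. *)
fun C_k :: "nat \<Rightarrow> ('i \<Rightarrow> 'v::real_normed_vector) set \<Rightarrow>
    (('i \<Rightarrow> 'v) \<Rightarrow> 'w::real_normed_vector) \<Rightarrow> bool" where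
  "C_k 0 U f \<longleftrightarrow> continuous_on U f"
| "C_k (Suc k) U f \<longleftrightarrow> continuous_on U f \<and>
     (\<forall>i v. \<exists>f'. C_k k U f' \<and>
        (\<forall>x \<in> U. ((\<lambda>t. f (x(i := x i + t *\<^sub>R v))) has_vector_derivative f' x) (at 0)))"

(* A map on an arbitrary subset X is smooth if it extends to a smooth map on an open
   neighbourhood of each point of X. If X lies in a finite-dimensional coordinate subspace
   E of the product, it makes no difference whether the neighbourhoods are taken in E or in
   the whole product: restrict to E, or compose with the coordinate projection onto E. *)
definition smooth_map :: "('i \<Rightarrow> 'v::real_normed_vector) set \<Rightarrow>
    (('i \<Rightarrow> 'v) \<Rightarrow> ('j \<Rightarrow> 'w::real_normed_vector)) \<Rightarrow> bool" where
  "smooth_map X f \<longleftrightarrow>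
     (\<forall>x \<in> X. \<exists>U F. open U \<and> x \<in> U \<and> (\<forall>y \<in> X \<inter> U. F y = f y) \<and>
        (\<forall>j k. C_k k U (\<lambda>y. F y j)))"

definition diffeomorphic :: "('i \<Rightarrow> 'v::real_normed_vector) set \<Rightarrow>
    ('j \<Rightarrow> 'w::real_normed_vector) set \<Rightarrow> bool" where
  "diffeomorphic X Y \<longleftrightarrow>
     (\<exists>f h. homeomorphism X Y f h \<and> smooth_map X f \<and> smooth_map Y h)"

(* Embedded smooth manifolds: subsets locally diffeomorphic to open subsets of R^k. *)
definition smooth_manifold :: "nat \<Rightarrow> ('i \<Rightarrow> 'v::real_normed_vector) set \<Rightarrow> bool" where
  "smooth_manifold k S \<longleftrightarrow>
     (\<forall>p \<in> S. \<exists>W V. openin (top_of_set S) W \<and> p \<in> W \<and>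
        openin (Euclidean_space k) V \<and> diffeomorphic W V)"

(* (S^1)^g; a single point for g = 0. *)
definition torus :: "nat \<Rightarrow> (nat \<Rightarrow> complex) set" where
  "torus g = (\<Pi>\<^sub>E i\<in>{..<g}. sphere 0 1)"

end

theory Submission
  imports Defs "HOL-Computational_Algebra.Polynomial_Factorial" "HOL-Computational_Algebra.Field_as_Ring"
    "HOL-Computational_Algebra.Fundamental_Theorem_Algebra"
begin

text \<open>A potential is a pair of polynomials \<open>(\<alpha>, b)\<close> with spectral polynomial \<open>a = \<lambda> \<alpha>\<^sup>2 + b c\<close>, where \<open>c\<close> is
  minus the reversed conjugate of \<open>b\<close> and \<open>\<alpha>\<close> is, up to sign, its own reversed conjugate. The coefficient of
  \<open>\<lambda>\<close> of degree \<open>g\<close> in \<open>a\<close> is minus the sum of the squared norms of all coefficients, so the isospectral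
  set is compact. The Lax equations provide \<open>g\<close> commuting quadratic vector fields on it. If \<open>a\<close>
  has simple roots then \<open>\<lambda> \<alpha>\<close>, \<open>b\<close> and \<open>c\<close> have no common root, and therefore these fields are linearly
  independent and span the kernel of the linearised equation. The joint flow is then a locally free action of a
  \<open>g\<close>-dimensional vector space with open orbits, and each orbit is the quotient by a lattice.
  There is only one orbit: on each orbit \<open>Im b(0)\<close> attains its maximum; at a critical point \<open>\<alpha> = 0\<close>, the
  Hessian there is the Bezoutian form of \<open>b\<close> and \<open>c\<close>, and by the Schur-Cohn argument its sign forces all
  roots of \<open>b\<close> out of the closed unit disc; the factorisation \<open>a = b c\<close> then determines the point.\<close>

section \<open>Smooth functions\<close>

text \<open>The joint flow is constructed on the isospectral set only, whereas smoothness is tested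
  on ambient neighbourhoods. A linear left inverse of the tangent map at each point supplies the
  extension: its composite with the flow is inverted near the identity. Connectedness comes from a
  Morse-type argument instead of the Jacobian of the spectral curve. In the chosen gauge the
  logarithmic derivative of b(0) along a flow is a real linear form in \<alpha>, and these forms
  together determine \<alpha>; hence the critical points of Im b(0) are those with a = b c. The
  roots of a then form pairs reflected in the unit circle, one of each pair belonging to b. This
  leaves 2^g distributions, and the second variation singles out one of them. A root on the circle
  would be shared by b and c, hence double for a. The phase of b is fixed by the positivity of the
  residue. The condition tr \<noteq> 0 says a(0) \<noteq> 0. It keeps b(0) away from 0, so that the
  open condition on the residue survives limits and flows.\<close>

lemma C_k_continuous: "C_k k U f \<Longrightarrow> continuous_on U f"
  by (cases k) auto

lemma C_k_SucD: "C_k (Suc k) U f \<Longrightarrow> C_k k U f"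
proof (induction k arbitrary: f)
  case (Suc k)
  then show ?case
    by (metis C_k.simps(2))
qed simp

lemma C_k_bounded_linear:
  assumes "bounded_linear T" "C_k k U f"
  shows "C_k k U (\<lambda>x. T (f x))"
  using assms(2)
proof (induction k arbitrary: f)
  case 0
  then show ?case using bounded_linear.continuous_on[OF assms(1)] by auto
next
  case (Suc k)
  show ?case unfolding C_k.simps
  proof (intro conjI allI)
    show "continuous_on U (\<lambda>x. T (f x))"
      using Suc.prems bounded_linear.continuous_on[OF assms(1)] by auto
    fix i v
    obtain f' where f': "C_k k U f'"
      "\<And>x. x \<in> U \<Longrightarrow> ((\<lambda>t. f (x(i := x i + t *\<^sub>R v))) has_vector_derivative f' x) (at 0)"
      using Suc.prems by (metis C_k.simps(2))
    show "\<exists>f'. C_k k U f' \<and>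
        (\<forall>x\<in>U. ((\<lambda>t. T (f (x(i := x i + t *\<^sub>R v)))) has_vector_derivative f' x) (at 0))"
      using Suc.IH[OF f'(1)] bounded_linear.has_vector_derivative[OF assms(1) f'(2)] by blast
  qed
qed

lemma C_k_const: "C_k k U (\<lambda>x. c)"
proof (induction k arbitrary: c)
  case (Suc k)
  have "\<forall>x\<in>U. ((\<lambda>t::real. c) has_vector_derivative 0) (at 0)" by auto
  then show ?case using Suc[of 0] by (auto intro!: exI[of _ "\<lambda>x. 0"])
qed auto

lemma C_k_add: "C_k k U f \<Longrightarrow> C_k k U h \<Longrightarrow> C_k k U (\<lambda>x. f x + h x)"
proof (induction k arbitrary: f h)
  case (Suc k)
  show ?case unfolding C_k.simps
  proof (intro conjI allI)
    show "continuous_on U (\<lambda>x. f x + h x)"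
      using Suc.prems by (auto intro: continuous_intros)
    fix i v
    obtain f' where f': "C_k k U f'"
      "\<And>x. x \<in> U \<Longrightarrow> ((\<lambda>t. f (x(i := x i + t *\<^sub>R v))) has_vector_derivative f' x) (at 0)"
      using Suc.prems by (metis C_k.simps(2))
    obtain h' where h': "C_k k U h'"
      "\<And>x. x \<in> U \<Longrightarrow> ((\<lambda>t. h (x(i := x i + t *\<^sub>R v))) has_vector_derivative h' x) (at 0)"
      using Suc.prems by (metis C_k.simps(2))
    show "\<exists>f'. C_k k U f' \<and>
        (\<forall>x\<in>U. ((\<lambda>t. f (x(i := x i + t *\<^sub>R v)) + h (x(i := x i + t *\<^sub>R v))) has_vector_derivative f' x) (at 0))"
      using Suc.IH[OF f'(1) h'(1)] has_vector_derivative_add[OF f'(2) h'(2)] by blast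
  qed
qed (auto intro: continuous_intros)

lemma C_k_bilinear:
  assumes "bounded_bilinear B" "C_k k U f" "C_k k U h"
  shows "C_k k U (\<lambda>x. B (f x) (h x))"
  using assms(2,3)
proof (induction k arbitrary: f h)
  case 0
  then show ?case using bounded_bilinear.continuous_on[OF assms(1)] by auto
next
  case (Suc k)
  show ?case unfolding C_k.simps
  proof (intro conjI allI)
    show "continuous_on U (\<lambda>x. B (f x) (h x))"
      using Suc.prems bounded_bilinear.continuous_on[OF assms(1)] by auto
    fix i v
    obtain f' where f': "C_k k U f'"
      "\<And>x. x \<in> U \<Longrightarrow> ((\<lambda>t. f (x(i := x i + t *\<^sub>R v))) has_vector_derivative f' x) (at 0)"
      using Suc.prems by (metis C_k.simps(2))
    obtain h' where h': "C_k k U h'"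
      "\<And>x. x \<in> U \<Longrightarrow> ((\<lambda>t. h (x(i := x i + t *\<^sub>R v))) has_vector_derivative h' x) (at 0)"
      using Suc.prems by (metis C_k.simps(2))
    have "C_k k U (\<lambda>x. B (f x) (h' x) + B (f' x) (h x))"
      using Suc.prems[THEN C_k_SucD] f' h' Suc.IH by (intro C_k_add) auto
    moreover have "((\<lambda>t. B (f (x(i := x i + t *\<^sub>R v))) (h (x(i := x i + t *\<^sub>R v))))
        has_vector_derivative (B (f x) (h' x) + B (f' x) (h x))) (at 0)" if "x \<in> U" for x
      using bounded_bilinear.has_vector_derivative[OF assms(1) f'(2)[OF that] h'(2)[OF that]] by simp
    ultimately show "\<exists>f'. C_k k U f' \<and>
        (\<forall>x\<in>U. ((\<lambda>t. B (f (x(i := x i + t *\<^sub>R v))) (h (x(i := x i + t *\<^sub>R v)))) has_vector_derivative f' x) (at 0))"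
      by blast
  qed
qed

lemma C_k_subset: "C_k k U f \<Longrightarrow> V \<subseteq> U \<Longrightarrow> C_k k V f"
proof (induction k arbitrary: f)
  case 0
  then show ?case by (auto intro: continuous_on_subset)
next
  case (Suc k)
  then show ?case
    by (simp, metis continuous_on_subset subset_iff)
qed

text \<open>The bootstrap rule: when the directional derivatives are expressions in functions
  already known to be \<open>C_k\<close>, regularity rises by one step. Flows, charts and inverses
  below are treated by induction on \<open>k\<close> in this form.\<close>

lemma C_k_SucI:
  assumes "continuous_on U f" "\<And>i v. C_k k U (f' i v)"
    and "\<And>i v x. x \<in> U \<Longrightarrow> ((\<lambda>t. f (x(i := x i + t *\<^sub>R v))) has_vector_derivative f' i v x) (at 0)"
  shows "C_k (Suc k) U f"
  using assms unfolding C_k.simps by blast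

section \<open>Ordinary differential equations on the unit interval\<close>

lemma picard:
  fixes G :: "'e::banach \<Rightarrow> 'e"
  assumes L: "\<And>x y. norm (G x - G y) \<le> L * norm (x - y)" and "L \<ge> 0"
  shows "\<exists>c. c 0 = x0 \<and> (\<forall>s\<in>{0..1}. (c has_vector_derivative G (c s)) (at s within {0..1}))"
proof -
  have contG: "continuous_on UNIV G"
    unfolding continuous_on_iff
  proof (intro ballI allI impI)
    fix x and e :: real assume "e > 0"
    then have "norm (G y - G x) < e" if "norm (y - x) < e / (L + 1)" for y
      using that L[of y x] \<open>L \<ge> 0\<close>
      by (smt (verit, ccfv_threshold) mult_less_cancel_left_pos mult_right_mono norm_ge_zero pos_less_divide_eq mult.commute)
    then show "\<exists>d>0. \<forall>y\<in>UNIV. dist y x < d \<longrightarrow> dist (G y) (G x) < e"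
      using \<open>e > 0\<close> \<open>L \<ge> 0\<close> by (intro exI[of _ "e / (L + 1)"]) (auto simp: dist_norm)
  qed
  \<comment> \<open>With the weight \<open>exp (- K s)\<close> the Picard operator contracts on the whole interval.\<close>
  define K where "K = 2 * L + 1"
  have K: "K > 0" "L / K \<le> 1/2" using \<open>L \<ge> 0\<close> by (auto simp: K_def divide_simps)
  \<comment> \<open>Time is clamped to the unit interval, so that the operator acts on bounded
    continuous functions on the whole line, a complete space.\<close>
  define cl where "cl s = max 0 (min 1 s)" for s :: real
  have cl: "0 \<le> cl s" "cl s \<le> 1" for s by (auto simp: cl_def)
  have cl_id: "cl s = s" if "s \<in> {0..1}" for s using that by (auto simp: cl_def)
  define g where "g y \<sigma> = G (exp (K * \<sigma>) *\<^sub>R apply_bcontfun y \<sigma>)" for y :: "real \<Rightarrow>\<^sub>C 'e" and \<sigma> :: real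
  have contg: "continuous_on A (g y)" for y A
    unfolding g_def
    by (rule continuous_on_compose2[OF contG]) (auto intro!: continuous_intros)
  have intg: "g y integrable_on {0..s}" for y s
    by (rule integrable_continuous_real[OF contg])
  define I where "I y s = x0 + integral {0..s} (g y)" for y s
  have I': "(I y has_vector_derivative g y s) (at s within {0..1})" if "s \<in> {0..1}" for y s
    unfolding I_def
    using has_vector_derivative_add[OF has_vector_derivative_const
       integral_has_vector_derivative[OF contg that], of x0 y] by simp
  have contI: "continuous_on {0..1} (I y)" for y
    using I' by (meson has_vector_derivative_continuous continuous_on_eq_continuous_within)
  define F where "F y s = exp (- K * cl s) *\<^sub>R I y (cl s)" for y s
  have contF: "F y \<in> bcontfun" for y
  proof -
    have c: "continuous_on {0..1} (\<lambda>s. exp (- K * s) *\<^sub>R I y s)"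
      using contI by (auto intro!: continuous_intros)
    have "continuous_on UNIV cl" unfolding cl_def by (intro continuous_intros)
    then have "continuous_on UNIV (F y)"
      unfolding F_def by (rule continuous_on_compose2[OF c]) (use cl in auto)
    moreover have "range (F y) \<subseteq> (\<lambda>s. exp (- K * s) *\<^sub>R I y s) ` {0..1}"
      using cl by (auto simp: F_def)
    ultimately show ?thesis
      unfolding bcontfun_def using compact_imp_bounded[OF compact_continuous_image[OF c]]
      by (auto intro: bounded_subset)
  qed
  define T where "T y = Bcontfun (F y)" for y
  have T: "apply_bcontfun (T y) s = exp (- K * cl s) *\<^sub>R I y (cl s)" for y s
    unfolding T_def using contF by (simp add: Bcontfun_inverse F_def)
  have "\<exists>!y. T y = y"
  proof (rule banach_fix_type[of "1/2"]; (intro allI)?)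
    fix y z :: "real \<Rightarrow>\<^sub>C 'e"
    have "dist (apply_bcontfun (T y) s) (apply_bcontfun (T z) s) \<le> 1/2 * dist y z" for s
    proof -
      let ?s = "cl s"
      have "norm (integral {0..?s} (g y) - integral {0..?s} (g z))
          = norm (integral {0..?s} (\<lambda>\<sigma>. g y \<sigma> - g z \<sigma>))"
        using intg by (simp add: integral_diff)
      also have "\<dots> \<le> integral {0..?s} (\<lambda>\<sigma>. (L * dist y z) * exp (K * \<sigma>))"
      proof (rule integral_norm_bound_integral)
        show "(\<lambda>\<sigma>. g y \<sigma> - g z \<sigma>) integrable_on {0..?s}" using intg by (intro integrable_diff)
        show "(\<lambda>\<sigma>. (L * dist y z) * exp (K * \<sigma>)) integrable_on {0..?s}"
          by (intro integrable_continuous_real continuous_intros)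
        fix \<sigma>
        have "norm (g y \<sigma> - g z \<sigma>) \<le> L * norm (exp (K * \<sigma>) *\<^sub>R apply_bcontfun y \<sigma> - exp (K * \<sigma>) *\<^sub>R apply_bcontfun z \<sigma>)"
          unfolding g_def by (rule L)
        also have "\<dots> = L * (exp (K * \<sigma>) * dist (apply_bcontfun y \<sigma>) (apply_bcontfun z \<sigma>))"
          by (simp add: scaleR_diff_right[symmetric] dist_norm)
        also have "\<dots> \<le> L * (exp (K * \<sigma>) * dist y z)"
          using dist_bounded[of y \<sigma> z] \<open>L \<ge> 0\<close> by (intro mult_left_mono) auto
        finally show "norm (g y \<sigma> - g z \<sigma>) \<le> L * dist y z * exp (K * \<sigma>)" by (simp add: algebra_simps)
      qed
      also have "\<dots> = (L * dist y z) * ((exp (K * ?s) - 1) / K)"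
      proof -
        have "((\<lambda>\<sigma>. exp (K * \<sigma>)) has_integral (exp (K * ?s) / K - exp (K * 0) / K)) {0..?s}"
          using K cl by (intro fundamental_theorem_of_calculus)
            (auto intro!: derivative_eq_intros simp: has_real_derivative_iff_has_vector_derivative[symmetric])
        then show ?thesis
          using integral_unique[OF has_integral_mult_right] by (auto simp: diff_divide_distrib)
      qed
      also have "\<dots> \<le> (L * dist y z) * (exp (K * ?s) / K)"
        using K \<open>L \<ge> 0\<close> by (intro mult_left_mono divide_right_mono) auto
      finally have *: "norm (integral {0..?s} (g y) - integral {0..?s} (g z)) \<le> (L / K) * (exp (K * ?s) * dist y z)"
        by (simp add: algebra_simps)
      have "dist (apply_bcontfun (T y) s) (apply_bcontfun (T z) s)
         = exp (- K * ?s) * norm (integral {0..?s} (g y) - integral {0..?s} (g z))"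
        by (simp add: T dist_norm I_def scaleR_diff_right[symmetric])
      also have "\<dots> \<le> exp (- K * ?s) * ((L / K) * (exp (K * ?s) * dist y z))"
        using * by (intro mult_left_mono) auto
      also have "\<dots> = (L / K) * dist y z" by (simp add: exp_minus field_simps)
      also have "\<dots> \<le> 1/2 * dist y z" using K by (intro mult_right_mono) auto
      finally show ?thesis .
    qed
    then show "dist (T y) (T z) \<le> 1/2 * dist y z" by (rule dist_bound)
  qed auto
  then obtain y where y: "T y = y" by blast
  have "I y s = exp (K * s) *\<^sub>R apply_bcontfun y s" if "s \<in> {0..1}" for s
    using T[of y s] that by (simp add: y cl_id exp_minus)
  then have "(I y has_vector_derivative G (I y s)) (at s within {0..1})" if "s \<in> {0..1}" for s
    using I'[OF that, of y] that by (simp add: g_def)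
  moreover have "I y 0 = x0" by (simp add: I_def)
  ultimately show ?thesis by blast
qed

text \<open>By the mean value inequality |u| is at most its majorant \<open>I\<close>, whose
  derivative is at most L I + \<epsilon>. With \<epsilon> = 0 this yields uniqueness and
  conservation laws; an \<epsilon> quadratic in the increment yields the first-order expansion of
  the flow.\<close>

lemma gronwall:
  fixes u :: "real \<Rightarrow> 'e::banach"
  assumes u': "\<And>s. s \<in> {0..1} \<Longrightarrow> (u has_vector_derivative u' s) (at s within {0..1})"
    and bnd: "\<And>s. s \<in> {0..1} \<Longrightarrow> norm (u' s) \<le> L * norm (u s) + \<epsilon>"
    and "u 0 = 0" "L \<ge> 0" "\<epsilon> \<ge> 0" and s: "s \<in> {0..1}"
  shows "norm (u s) \<le> \<epsilon> * exp L"
proof -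
  have contu: "continuous_on {0..1} u"
    using u' by (meson has_vector_derivative_continuous continuous_on_eq_continuous_within)
  define f where "f \<sigma> = L * norm (u \<sigma>) + \<epsilon>" for \<sigma>
  have contf: "continuous_on {0..1} f" unfolding f_def using contu by (auto intro!: continuous_intros)
  define I where "I \<sigma> = integral {0..\<sigma>} f" for \<sigma>
  have I': "(I has_vector_derivative f \<sigma>) (at \<sigma> within {0..1})" if "\<sigma> \<in> {0..1}" for \<sigma>
    unfolding I_def by (rule integral_has_vector_derivative[OF contf that])
  have contI: "continuous_on {0..1} I"
    using I' by (meson has_vector_derivative_continuous continuous_on_eq_continuous_within)
  have at: "at \<sigma> within {0..1} = at \<sigma>" if "0 < \<sigma>" "\<sigma> < 1" for \<sigma> :: real
    using that by (simp add: at_within_Icc_at)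
  have NI: "norm (u t) \<le> I t" if t: "t \<in> {0..1}" for t
  proof (cases "t = 0")
    case False
    then have "norm (u t - u 0) \<le> I t - I 0"
      using t contu contI u' I' bnd at
      by (intro differentiable_bound_general[where f' = u' and \<phi>' = f])
        (auto simp: f_def intro: continuous_on_subset, (metis at atLeastAtMost_iff less_eq_real_def less_trans order.strict_trans2)+)
    then show ?thesis using \<open>u 0 = 0\<close> by (simp add: I_def)
  qed (use \<open>u 0 = 0\<close> in \<open>simp add: I_def\<close>)
  \<comment> \<open>Integrating factor; the subtracted term \<epsilon> t absorbs the inhomogeneity
    because exp (- L t) \<le> 1.\<close>
  define w where "w t = exp (- L * t) * I t - \<epsilon> * t" for t
  have w': "(w has_real_derivative (exp (- L * t) * f t - L * exp (- L * t) * I t - \<epsilon>)) (at t within {0..1})"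
    if "t \<in> {0..1}" for t
    unfolding w_def using I'[OF that, folded has_real_derivative_iff_has_vector_derivative]
    by (auto intro!: derivative_eq_intros)
  have w'le: "exp (- L * t) * f t - L * exp (- L * t) * I t - \<epsilon> \<le> 0" if "t \<in> {0..1}" for t
  proof -
    have "exp (- L * t) * f t - L * exp (- L * t) * I t = exp (- L * t) * (L * (norm (u t) - I t) + \<epsilon>)"
      by (simp add: f_def algebra_simps)
    also have "\<dots> \<le> exp (- L * t) * \<epsilon>"
      using NI[OF that] \<open>L \<ge> 0\<close> by (intro mult_left_mono) (auto simp: mult_nonneg_nonpos)
    also have "\<dots> \<le> 1 * \<epsilon>" using that \<open>L \<ge> 0\<close> \<open>\<epsilon> \<ge> 0\<close> by (intro mult_right_mono) auto
    finally show ?thesis by simp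
  qed
  have "w s \<le> w 0"
  proof (rule DERIV_nonpos_imp_decreasing_open[of 0 s w])
    show "\<exists>y. (w has_real_derivative y) (at x) \<and> y \<le> 0" if "0 < x" "x < s" for x
      using w'[of x] w'le[of x] at[of x] that s by auto
    have "continuous_on {0..1} w"
      using w' by (meson DERIV_continuous continuous_on_eq_continuous_within)
    then show "continuous_on {0..s} w" using s by (auto intro: continuous_on_subset)
  qed (use s in auto)
  then have "exp (- L * s) * I s \<le> \<epsilon> * s" by (simp add: w_def I_def)
  also have "\<dots> \<le> \<epsilon>" using s \<open>\<epsilon> \<ge> 0\<close> by (simp add: mult_left_le)
  finally have "I s \<le> \<epsilon> * exp (L * s)"
    by (simp add: exp_minus field_simps)
  also have "\<dots> \<le> \<epsilon> * exp L" using s \<open>\<epsilon> \<ge> 0\<close> \<open>L \<ge> 0\<close> by (intro mult_left_mono) (auto simp: mult_left_le)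
  finally show ?thesis using NI[OF s] by simp
qed

section \<open>Flows of commuting quadratic vector fields\<close>

text \<open>The field with parameter \<open>v\<close> is \<open>x \<mapsto> Q x x v\<close>. Invariance of \<open>M\<close> is also required for rescaled
  fields, so that a cut-off preserves it; \<open>commute\<close> says that the Lie brackets vanish on \<open>M\<close>.\<close>

locale commuting_fields =
  fixes Q :: "'e::banach \<Rightarrow> 'e \<Rightarrow> ('p::banach \<Rightarrow>\<^sub>L 'e)" and M :: "'e set"
  assumes bilinear: "bounded_bilinear Q"
    and bounded: "bounded M"
    and invariant: "\<And>v \<kappa> c s. c 0 \<in> M \<Longrightarrow> (\<And>s. \<bar>\<kappa> s\<bar> \<le> 1) \<Longrightarrow>
      (\<And>s. s \<in> {0..1} \<Longrightarrow> (c has_vector_derivative (\<kappa> s :: real) *\<^sub>R blinfun_apply (Q (c s) (c s)) v) (at s within {0..1}))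
      \<Longrightarrow> s \<in> {0..1} \<Longrightarrow> c s \<in> M"
    and commute: "\<And>x v w. x \<in> M \<Longrightarrow>
      Q (Q x x v) x w + Q x (Q x x v) w = Q (Q x x w) x v + Q x (Q x x w) v"
begin

definition V :: "'p \<Rightarrow> 'e \<Rightarrow> 'e" where "V v x = blinfun_apply (Q x x) v"

definition is_sol :: "'p \<Rightarrow> 'e \<Rightarrow> (real \<Rightarrow> 'e) \<Rightarrow> bool" where
  "is_sol v p c \<longleftrightarrow> c 0 = p \<and> (\<forall>s\<in>{0..1}. c s \<in> M \<and> (c has_vector_derivative V v (c s)) (at s within {0..1}))"

text \<open>The time-one map, in which direction and time are merged into one parameter. This turns
  the commuting family into a single action of the vector space of parameters; trajectories return
  through \<open>sol_rescale\<close>.\<close>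

definition flow :: "'p \<Rightarrow> 'e \<Rightarrow> 'e" where
  "flow v p = (SOME c. is_sol v p c) 1"

lemma V_add: "V (v + w) x = V v x + V w x"
  and V_scaleR: "V (r *\<^sub>R v) x = r *\<^sub>R V v x"
  by (simp_all add: V_def blinfun.add_right blinfun.scaleR_right)

lemma V_scaleR_point: "V v (r *\<^sub>R x) = (r * r) *\<^sub>R V v x"
  by (simp add: V_def bounded_bilinear.scaleR_left[OF bilinear] bounded_bilinear.scaleR_right[OF bilinear]
      scaleR_blinfun.rep_eq)

lemma Q_bound: "\<exists>B>0. \<forall>x y v. norm (Q x y v) \<le> B * norm x * norm y * norm v"
proof -
  obtain B where B: "B > 0" "\<And>x y. norm (Q x y) \<le> norm x * norm y * B"
    using bounded_bilinear.pos_bounded[OF bilinear] by blast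
  have "norm (Q x y v) \<le> B * norm x * norm y * norm v" for x y v
    using norm_blinfun[of "Q x y" v] mult_right_mono[OF B(2)[of x y], of "norm v"]
    by (simp add: algebra_simps)
  then show ?thesis using B by blast
qed

lemma V_lipschitz:
  assumes B: "B > 0" "\<And>x y v. norm (Q x y v) \<le> B * norm x * norm y * norm v"
    and "norm x \<le> \<rho>" "norm y \<le> \<rho>"
  shows "norm (V v x - V v y) \<le> 2 * B * \<rho> * norm v * norm (x - y)"
proof -
  have "V v x - V v y = Q (x - y) x v + Q y (x - y) v"
    by (simp add: V_def bounded_bilinear.diff_left[OF bilinear] bounded_bilinear.diff_right[OF bilinear]
        minus_blinfun.rep_eq)
  also have "norm \<dots> \<le> B * norm (x - y) * norm x * norm v + B * norm y * norm (x - y) * norm v"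
    by (intro norm_triangle_mono B)
  also have "\<dots> = B * norm v * norm (x - y) * (norm x + norm y)" by (simp add: algebra_simps)
  also have "\<dots> \<le> B * norm v * norm (x - y) * (2 * \<rho>)"
    using assms by (intro mult_left_mono) auto
  finally show ?thesis by (simp add: algebra_simps)
qed

lemma V_bound:
  assumes "\<And>x y v. norm (Q x y v) \<le> B * norm x * norm y * norm v" "B > 0" "norm x \<le> R"
  shows "norm (V v x) \<le> B * R^2 * norm v"
proof -
  have "norm (V v x) \<le> B * norm x * norm x * norm v" unfolding V_def by (rule assms)
  also have "\<dots> \<le> B * R * R * norm v"
  proof -
    have "0 \<le> R" using assms(3) norm_ge_zero order_trans by blast
    then show ?thesis using assms by (intro mult_right_mono mult_mono mult_left_mono) auto
  qed
  finally show ?thesis by (simp add: power2_eq_square algebra_simps)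
qed

lemma M_bound: "\<exists>R>0. \<forall>x\<in>M. norm x \<le> R"
  using bounded bounded_pos by blast

lemma ex_sol:
  assumes "p \<in> M"
  shows "\<exists>c. is_sol v p c"
proof -
  obtain B where B: "B > 0" "\<And>x y v. norm (Q x y v) \<le> B * norm x * norm y * norm v"
    using Q_bound by blast
  obtain R where R: "R > 0" "\<And>x. x \<in> M \<Longrightarrow> norm x \<le> R" using M_bound by blast
  \<comment> \<open>Cut-off: the field is replaced by \<open>V v (x / m x)\<close>, a nonnegative multiple of itself by homogeneity, which is
    globally Lipschitz and unchanged on \<open>M\<close>.\<close>
  define m where "m x = max 1 (norm x / R)" for x :: 'e
  define \<pi> where "\<pi> x = (1 / m x) *\<^sub>R x" for x
  have m1: "m x \<ge> 1" for x by (simp add: m_def)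
  then have m0: "m x > 0" for x by (meson less_le_trans zero_less_one)
  have mx: "norm x / m x \<le> R" for x
  proof -
    have "norm x / R \<le> m x" by (simp add: m_def)
    then show ?thesis using R(1) m0[of x] by (simp add: divide_simps mult.commute)
  qed
  have \<pi>R: "norm (\<pi> x) \<le> R" for x using mx[of x] m0[of x] by (simp add: \<pi>_def)
  have ml: "\<bar>m x - m y\<bar> \<le> norm (x - y) / R" for x y
  proof -
    have "\<bar>m x - m y\<bar> \<le> \<bar>norm x / R - norm y / R\<bar>" by (auto simp: m_def)
    also have "\<dots> = \<bar>norm x - norm y\<bar> / R" using R(1) by (simp add: diff_divide_distrib[symmetric])
    also have "\<dots> \<le> norm (x - y) / R" using R(1) by (intro divide_right_mono norm_triangle_ineq3) auto
    finally show ?thesis .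
  qed
  \<comment> \<open>The radial retraction onto the ball of radius R is 2-Lipschitz: rescaling the
    difference by a common factor costs |x - y|, changing the factor costs (|x - y| / R) R.\<close>
  have \<pi>l: "norm (\<pi> x - \<pi> y) \<le> 2 * norm (x - y)" for x y
  proof -
    have "\<pi> x - \<pi> y = (1 / m x) *\<^sub>R (x - y) + ((m y - m x) / (m x * m y)) *\<^sub>R y"
      using m0[of x] m0[of y] by (simp add: \<pi>_def algebra_simps scaleR_left_diff_distrib diff_divide_distrib)
    also have "norm \<dots> \<le> norm ((1 / m x) *\<^sub>R (x - y)) + norm (((m y - m x) / (m x * m y)) *\<^sub>R y)"
      by (rule norm_triangle_ineq)
    also have "\<dots> = norm (x - y) / m x + \<bar>m x - m y\<bar> * (norm y / m y) / m x"
      using m0[of x] m0[of y] by (simp add: abs_minus_commute abs_mult)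
    also have "\<dots> \<le> norm (x - y) / 1 + (norm (x - y) / R) * R / 1"
      using m1 m0 ml mx R(1) by (intro add_mono frac_le mult_mono) (auto intro!: divide_nonneg_pos)
    finally show ?thesis using R(1) by simp
  qed
  define G where "G x = V v (\<pi> x)" for x
  define K where "K = 2 * B * R * norm v"
  have K: "K \<ge> 0" using B R by (auto simp: K_def)
  have "norm (G x - G y) \<le> (K * 2) * norm (x - y)" for x y
  proof -
    have "norm (G x - G y) \<le> K * norm (\<pi> x - \<pi> y)"
      unfolding G_def K_def by (rule V_lipschitz[OF B \<pi>R \<pi>R])
    also have "\<dots> \<le> K * (2 * norm (x - y))" using \<pi>l K by (intro mult_left_mono)
    finally show ?thesis by simp
  qed
  then obtain c where c: "c 0 = p" "\<And>s. s \<in> {0..1} \<Longrightarrow> (c has_vector_derivative G (c s)) (at s within {0..1})"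
    using picard[of G "K * 2" p] K by auto
  \<comment> \<open>The cut-off solution runs along \<open>V v\<close> with a speed factor 1/m^2
    between 0 and 1, so \<open>invariant\<close> confines it to \<open>M\<close>; there m = 1 and it
    solves the original equation.\<close>
  have "(c has_vector_derivative (1 / m (c s) * (1 / m (c s))) *\<^sub>R Q (c s) (c s) v) (at s within {0..1})"
    if "s \<in> {0..1}" for s
    using c(2)[OF that] unfolding G_def \<pi>_def V_scaleR_point by (simp add: V_def)
  moreover have "\<bar>1 / m x * (1 / m x)\<bar> \<le> 1" for x
    using mult_le_one[of "1 / m x" "1 / m x"] m0[of x] m1[of x] by simp
  ultimately have cM: "c s \<in> M" if "s \<in> {0..1}" for s
    using invariant[of c "\<lambda>s. 1 / m (c s) * (1 / m (c s))" v s] c(1) assms that by blast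
  then have "m (c s) = 1" if "s \<in> {0..1}" for s
    using R(2)[OF cM[OF that]] R(1) by (simp add: m_def max_def)
  then have "G (c s) = V v (c s)" if "s \<in> {0..1}" for s
    using that by (simp add: G_def \<pi>_def)
  then have "is_sol v p c" unfolding is_sol_def using c cM by auto
  then show ?thesis by blast
qed

lemma sol_unique:
  assumes c: "is_sol v p c" and d: "is_sol v p d" and s: "s \<in> {0..1}"
  shows "c s = d s"
proof -
  obtain B where B: "B > 0" "\<And>x y v. norm (Q x y v) \<le> B * norm x * norm y * norm v"
    using Q_bound by blast
  obtain R where R: "R > 0" "\<And>x. x \<in> M \<Longrightarrow> norm x \<le> R" using M_bound by blast
  have "norm (c s - d s) \<le> 0 * exp (2 * B * R * norm v)"
  proof (rule gronwall[where u = "\<lambda>s. c s - d s" and u' = "\<lambda>s. V v (c s) - V v (d s)"])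
    fix s :: real assume s: "s \<in> {0..1}"
    show "((\<lambda>s. c s - d s) has_vector_derivative V v (c s) - V v (d s)) (at s within {0..1})"
      using c d s by (auto simp: is_sol_def intro: has_vector_derivative_diff)
    show "norm (V v (c s) - V v (d s)) \<le> 2 * B * R * norm v * norm (c s - d s) + 0"
      using V_lipschitz[OF B] R(2) c d s by (auto simp: is_sol_def)
  qed (use B R c d s in \<open>auto simp: is_sol_def\<close>)
  then show ?thesis by simp
qed

lemma flow_eq: assumes "is_sol v p c" shows "flow v p = c 1"
  unfolding flow_def using sol_unique[OF someI[of "is_sol v p" c, OF assms] assms, of 1] by simp

lemma sol_rescale:
  assumes c: "is_sol v p c" and s: "s \<in> {0..1}"
  shows "is_sol (s *\<^sub>R v) p (\<lambda>\<sigma>. c (s * \<sigma>))"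
  unfolding is_sol_def
proof (intro conjI ballI)
  fix \<sigma> :: real assume \<sigma>: "\<sigma> \<in> {0..1}"
  have s\<sigma>: "s * \<sigma> \<in> {0..1}" if "\<sigma> \<in> {0..1}" for \<sigma> using s that by (auto intro: mult_le_one)
  show "c (s * \<sigma>) \<in> M" using c s\<sigma> \<sigma> by (auto simp: is_sol_def)
  have sub: "(*) s ` {0..1} \<subseteq> {0..1}" using s\<sigma> by auto
  have "(c has_vector_derivative V v (c (s * \<sigma>))) (at (s * \<sigma>) within (*) s ` {0..1})"
    using c s\<sigma>[OF \<sigma>] has_vector_derivative_within_subset[OF _ sub] unfolding is_sol_def by blast
  from vector_diff_chain_within[OF _ this, of s]
  have "((c \<circ> (*) s) has_vector_derivative s *\<^sub>R V v (c (s * \<sigma>))) (at \<sigma> within {0..1})"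
    by (auto intro!: derivative_eq_intros simp: has_real_derivative_iff_has_vector_derivative[symmetric])
  then show "((\<lambda>\<sigma>. c (s * \<sigma>)) has_vector_derivative V (s *\<^sub>R v) (c (s * \<sigma>))) (at \<sigma> within {0..1})"
    by (simp add: o_def V_scaleR)
qed (use c in \<open>simp add: is_sol_def\<close>)

lemma flow_sol: assumes "p \<in> M" shows "is_sol v p (\<lambda>s. flow (s *\<^sub>R v) p)"
proof -
  obtain c where c: "is_sol v p c" using ex_sol[OF assms] by blast
  have "flow (s *\<^sub>R v) p = c s" if "s \<in> {0..1}" for s
    using flow_eq[OF sol_rescale[OF c that]] by simp
  then show ?thesis using c unfolding is_sol_def
    by (smt (verit, ccfv_SIG) atLeastAtMost_iff has_vector_derivative_transform)
qed

lemma flow_in_M: "p \<in> M \<Longrightarrow> flow v p \<in> M"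
  using flow_sol[of p v] unfolding is_sol_def by (metis atLeastAtMost_iff order_refl scaleR_one zero_le_one)

lemma flow_0: "p \<in> M \<Longrightarrow> flow 0 p = p"
  using flow_sol[of p 0] unfolding is_sol_def by simp

lemma flow_estimate:
  "\<exists>C\<ge>0. \<forall>v w p. p \<in> M \<longrightarrow> norm v \<le> \<rho> \<longrightarrow> norm w \<le> \<rho> \<longrightarrow>
     norm (flow (v + w) p - flow v p - V w (flow v p)) \<le> C * (norm w)\<^sup>2"
proof -
  obtain B where B: "B > 0" "\<And>x y v. norm (Q x y v) \<le> B * norm x * norm y * norm v"
    using Q_bound by blast
  obtain R where R: "R > 0" "\<And>x. x \<in> M \<Longrightarrow> norm x \<le> R" using M_bound by blast
  \<comment> \<open>With |h| \<le> B R^2 |w| for h = V w x, the terms Q x h w and Q h x w give 2 B^2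
    R^3 |w|^2, and Q h h (v + w) gives the rest of D. R1 bounds \<open>e\<close>, which may leave
    \<open>M\<close>, and L is a Lipschitz constant of the field on the ball of radius R1.\<close>
  define D where "D = 2 * B^2 * R^3 + B^3 * R^4 * (2 * \<bar>\<rho>\<bar>)"
  define R1 where "R1 = R + B * R^2 * \<bar>\<rho>\<bar>"
  define L where "L = 2 * B * R1 * (2 * \<bar>\<rho>\<bar>)"
  have pos: "D \<ge> 0" "R1 \<ge> 0" "L \<ge> 0" "R1 \<ge> R" using B R by (auto simp: D_def R1_def L_def)
  have "norm (flow (v + w) p - flow v p - V w (flow v p)) \<le> D * exp L * (norm w)\<^sup>2"
    if p: "p \<in> M" and v: "norm v \<le> \<rho>" and w: "norm w \<le> \<rho>" for v w p
  proof -
    have \<rho>: "\<rho> \<ge> 0" using v norm_ge_zero order_trans by blast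
    have vw: "norm (v + w) \<le> 2 * \<bar>\<rho>\<bar>" using norm_triangle_mono[OF v w] \<rho> by simp
    define c where "c s = flow (s *\<^sub>R v) p" for s
    define d where "d s = flow (s *\<^sub>R (v + w)) p" for s
    have c: "is_sol v p c" and d: "is_sol (v + w) p d"
      unfolding c_def d_def using flow_sol[OF p] by auto
    have cM: "c s \<in> M" and dM: "d s \<in> M" if "s \<in> {0..1}" for s
      using c d that by (auto simp: is_sol_def)
    \<comment> \<open>Since the fields commute, \<open>e\<close> solves the equation with parameter \<open>v + w\<close> up to \<open>O(|w|\<^sup>2)\<close>.\<close>
    define e where "e s = c s + s *\<^sub>R V w (c s)" for s
    define e' where "e' s = V v (c s) + (V w (c s) + s *\<^sub>R (Q (V v (c s)) (c s) w + Q (c s) (V v (c s)) w))" for s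
    have e: "(e has_vector_derivative e' s) (at s within {0..1})" if s: "s \<in> {0..1}" for s
    proof -
      have c': "(c has_vector_derivative V v (c s)) (at s within {0..1})"
        using c s by (auto simp: is_sol_def)
      have "((\<lambda>s. V w (c s)) has_vector_derivative (Q (V v (c s)) (c s) w + Q (c s) (V v (c s)) w)) (at s within {0..1})"
      proof -
        have "((\<lambda>s. Q (c s) (c s)) has_vector_derivative (Q (c s) (V v (c s)) + Q (V v (c s)) (c s))) (at s within {0..1})"
          by (rule bounded_bilinear.has_vector_derivative[OF bilinear c' c'])
        from bounded_linear.has_vector_derivative[OF blinfun.bounded_linear_left this, of w]
        show ?thesis by (simp add: V_def blinfun.add_left add.commute)
      qed
      then have "((\<lambda>s. s *\<^sub>R V w (c s)) has_vector_derivative (s *\<^sub>R (Q (V v (c s)) (c s) w + Q (c s) (V v (c s)) w) + 1 *\<^sub>R V w (c s)))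
          (at s within {0..1})"
        by (intro has_vector_derivative_scaleR) auto
      from has_vector_derivative_add[OF c' this] show ?thesis
        unfolding e_def e'_def by (simp add: add_ac)
    qed
    have main: "norm (d 1 - e 1) \<le> (D * (norm w)\<^sup>2) * exp L"
    proof (rule gronwall[where u = "\<lambda>s. d s - e s" and u' = "\<lambda>s. V (v + w) (d s) - e' s"])
      fix s :: real assume s: "s \<in> {0..1}"
      show "((\<lambda>s. d s - e s) has_vector_derivative V (v + w) (d s) - e' s) (at s within {0..1})"
        using d e s by (auto simp: is_sol_def intro: has_vector_derivative_diff)
      define x where "x = c s"
      define h where "h = V w x"
      have xM: "x \<in> M" unfolding x_def using cM s by blast
      have xR: "norm x \<le> R" using R xM by blast
      have hb: "norm h \<le> B * R^2 * norm w" unfolding h_def by (rule V_bound[OF B(2,1) xR])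
      have hb2: "norm h \<le> B * R^2 * \<bar>\<rho>\<bar>"
        by (rule order_trans[OF hb mult_left_mono]) (use w \<rho> B(1) in auto)
      have eR: "norm (e s) \<le> R1"
      proof -
        have "norm (e s) \<le> norm x + norm (s *\<^sub>R h)" unfolding e_def x_def h_def by (rule norm_triangle_ineq)
        also have "norm (s *\<^sub>R h) \<le> norm h" using s by (simp add: mult_left_le_one_le)
        finally show ?thesis using xR hb2 by (simp add: R1_def)
      qed
      have dR: "norm (d s) \<le> R1" using dM[OF s] R(2) pos by (meson order_trans)
      have exp: "V (v + w) (e s) = V (v + w) x + s *\<^sub>R (Q x h (v + w) + Q h x (v + w)) + (s * s) *\<^sub>R Q h h (v + w)"
        unfolding V_def e_def x_def[symmetric] h_def[symmetric, unfolded V_def]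
        by (simp add: h_def V_def bounded_bilinear.add_left[OF bilinear] bounded_bilinear.add_right[OF bilinear]
          bounded_bilinear.scaleR_left[OF bilinear] bounded_bilinear.scaleR_right[OF bilinear]
          plus_blinfun.rep_eq scaleR_blinfun.rep_eq algebra_simps)
      \<comment> \<open>The brackets vanish here: the derivative of V w along v is exchanged for
        that of V v along w, which the expansion \<open>exp\<close> contains. Every term left is at
        least quadratic in w, since h is linear in w.\<close>
      have com: "Q (V v x) x w + Q x (V v x) w = Q h x v + Q x h v"
        unfolding h_def V_def by (rule commute[OF xM])
      have "V (v + w) (e s) - e' s = s *\<^sub>R (Q x h w + Q h x w) + (s * s) *\<^sub>R Q h h (v + w)"
        unfolding exp e'_def x_def[symmetric] com
        by (simp add: V_add blinfun.add_right h_def algebra_simps)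
      also have "norm \<dots> \<le> (norm (Q x h w) + norm (Q h x w)) + norm (Q h h (v + w))"
      proof (rule norm_triangle_mono)
        show "norm (s *\<^sub>R (Q x h w + Q h x w)) \<le> norm (Q x h w) + norm (Q h x w)"
          using s norm_triangle_ineq[of "Q x h w" "Q h x w"]
          by (smt (verit) atLeastAtMost_iff mult_left_le_one_le norm_ge_zero norm_scaleR)
        show "norm ((s * s) *\<^sub>R Q h h (v + w)) \<le> norm (Q h h (v + w))"
          using s mult_le_one[of s s] by (simp add: mult_left_le_one_le)
      qed
      also have "\<dots> \<le> (B * norm x * norm h * norm w + B * norm h * norm x * norm w) + B * norm h * norm h * norm (v + w)"
        by (intro add_mono B)
      also have "\<dots> \<le> (B * R * (B * R^2 * norm w) * norm w + B * (B * R^2 * norm w) * R * norm w)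
           + B * (B * R^2 * norm w) * (B * R^2 * norm w) * (2 * \<bar>\<rho>\<bar>)"
        using xR hb B(1) R(1) vw by (intro add_mono mult_mono) auto
      also have "\<dots> = D * (norm w)\<^sup>2" by (simp add: D_def algebra_simps power2_eq_square power3_eq_cube power4_eq_xxxx)
      finally have 1: "norm (V (v + w) (e s) - e' s) \<le> D * (norm w)\<^sup>2" .
      have "norm (V (v + w) (d s) - V (v + w) (e s)) \<le> 2 * B * R1 * norm (v + w) * norm (d s - e s)"
        by (rule V_lipschitz[OF B dR eR])
      also have "\<dots> \<le> L * norm (d s - e s)"
        unfolding L_def using B(1) pos vw by (intro mult_right_mono mult_left_mono) auto
      finally have 2: "norm (V (v + w) (d s) - V (v + w) (e s)) \<le> L * norm (d s - e s)" .
      have "V (v + w) (d s) - e' s = (V (v + w) (d s) - V (v + w) (e s)) + (V (v + w) (e s) - e' s)" by simp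
      then show "norm (V (v + w) (d s) - e' s) \<le> L * norm (d s - e s) + D * (norm w)\<^sup>2"
        using norm_triangle_mono[OF 2 1] by simp
    qed (use pos c d in \<open>auto simp: e_def is_sol_def\<close>)
    have "d 1 - e 1 = flow (v + w) p - flow v p - V w (flow v p)"
      by (simp add: d_def e_def c_def)
    then show ?thesis using main by (simp only: ac_simps)
  qed
  then show ?thesis using pos by (intro exI[of _ "D * exp L"]) auto
qed

text \<open>By the estimate the flow satisfies all equations \<open>\<partial>\<^sub>w \<phi> = V w \<phi>\<close> at once; smoothness in \<open>v\<close>
  is then bootstrapped from these equations (\<open>flow_C_k\<close>).\<close>

lemma flow_has_derivative:
  assumes p: "p \<in> M"
  shows "((\<lambda>v. flow v p) has_derivative (\<lambda>w. V w (flow v p))) (at v)"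
proof -
  obtain C where C: "C \<ge> 0" "\<And>w. norm w \<le> norm v + 1 \<Longrightarrow>
      norm (flow (v + w) p - flow v p - V w (flow v p)) \<le> C * (norm w)\<^sup>2"
    using flow_estimate[of "norm v + 1"] p by (metis add_increasing2 order_refl zero_le_one)
  show ?thesis
    unfolding has_derivative_at
  proof (intro conjI)
    show "bounded_linear (\<lambda>w. V w (flow v p))"
      unfolding V_def by (rule blinfun.bounded_linear_right)
    show "(\<lambda>h. norm (flow (v + h) p - flow v p - V h (flow v p)) / norm h) \<midarrow>0\<rightarrow> 0"
    proof (rule Lim_null_comparison)
      show "\<forall>\<^sub>F h in at 0. norm (norm (flow (v + h) p - flow v p - V h (flow v p)) / norm h) \<le> C * norm h"
        unfolding eventually_at
      proof (intro exI[of _ "1::real"] conjI ballI impI)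
        fix h :: 'p assume "h \<noteq> 0 \<and> dist h 0 < 1"
        then have "norm (flow (v + h) p - flow v p - V h (flow v p)) \<le> C * (norm h)\<^sup>2" "norm h > 0"
          using C(2)[of h] by (auto simp: add_increasing)
        then show "norm (norm (flow (v + h) p - flow v p - V h (flow v p)) / norm h) \<le> C * norm h"
          by (simp add: divide_simps power2_eq_square algebra_simps)
      qed auto
      show "(\<lambda>h. C * norm h) \<midarrow>0\<rightarrow> 0"
        by (auto intro!: tendsto_eq_intros)
    qed
  qed
qed

lemma continuous_flow: "p \<in> M \<Longrightarrow> continuous_on A (\<lambda>v. flow v p)"
  using flow_has_derivative by (meson has_derivative_continuous continuous_at_imp_continuous_on)

text \<open>By the derivative formula the curve s \<mapsto> flow (v + s w) p solves the equation
  with parameter w and starts at flow v p, so uniqueness identifies its value at s = 1.\<close>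

lemma flow_add:
  assumes p: "p \<in> M"
  shows "flow (v + w) p = flow w (flow v p)"
proof -
  have "is_sol w (flow v p) (\<lambda>s. flow (v + s *\<^sub>R w) p)"
    unfolding is_sol_def
  proof (intro conjI ballI)
    fix s :: real
    have d: "((\<lambda>s. v + s *\<^sub>R w) has_vector_derivative w) (at s within {0..1})"
      by (auto intro!: derivative_eq_intros)
    have "((\<lambda>v. flow v p) \<circ> (\<lambda>s. v + s *\<^sub>R w) has_vector_derivative V w (flow (v + s *\<^sub>R w) p)) (at s within {0..1})"
      using vector_derivative_diff_chain_within[OF d, of "\<lambda>v. flow v p" "\<lambda>w'. V w' (flow (v + s *\<^sub>R w) p)"]
        flow_has_derivative[OF p] has_derivative_at_withinI by blast
    then show "((\<lambda>s. flow (v + s *\<^sub>R w) p) has_vector_derivative V w (flow (v + s *\<^sub>R w) p)) (at s within {0..1})"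
      by (simp add: o_def)
  qed (use flow_in_M[OF p] in auto)
  from flow_eq[OF this] show ?thesis by simp
qed

text \<open>The parameter passes through a map \<open>u\<close> on a product space because
  \<open>C_k\<close> speaks of coordinate directions. The chain rule expresses the derivative by the
  flow itself, the bilinear \<open>Q\<close> and \<open>u'\<close>.\<close>

lemma flow_C_k:
  fixes u :: "('i \<Rightarrow> 'v::real_normed_vector) \<Rightarrow> 'p"
  assumes p: "p \<in> M" and "continuous_on U u"
    and u': "\<And>i v k. C_k k U (u' i v)"
      "\<And>i v x. x \<in> U \<Longrightarrow> ((\<lambda>t. u (x(i := x i + t *\<^sub>R v))) has_vector_derivative u' i v x) (at 0)"
  shows "C_k k U (\<lambda>x. flow (u x) p)"
proof (induction k)
  case 0
  show ?case using continuous_on_compose2[OF continuous_flow[OF p, of UNIV] assms(2)] by auto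
next
  case (Suc k)
  show ?case
  proof (rule C_k_SucI)
    show "continuous_on U (\<lambda>x. flow (u x) p)" using Suc C_k_continuous by blast
    fix i v
    show "C_k k U (\<lambda>x. blinfun_apply (Q (flow (u x) p) (flow (u x) p)) (u' i v x))"
      by (intro C_k_bilinear[OF bounded_bilinear_blinfun_apply] C_k_bilinear[OF bilinear] Suc u')
    fix x assume "x \<in> U"
    from vector_derivative_diff_chain_within[OF u'(2)[OF this], of "\<lambda>v. flow v p" "\<lambda>w. V w (flow (u x) p)" i v]
    show "((\<lambda>t. flow (u (x(i := x i + t *\<^sub>R v))) p) has_vector_derivative blinfun_apply (Q (flow (u x) p) (flow (u x) p)) (u' i v x)) (at 0)"
      using flow_has_derivative[OF p, of "u x"] has_derivative_at_withinI
      by (fastforce simp: o_def V_def)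
  qed
qed

end

section \<open>Inversion of operators near the identity\<close>

text \<open>A x = y is the fixed point equation x = x - A x + y of a contraction with factor 1/2;
  the same factor gives the bound 2 for the inverse.\<close>

lemma blinfun_near_id_invertible:
  fixes A :: "'p::banach \<Rightarrow>\<^sub>L 'p"
  assumes A: "norm (id_blinfun - A) \<le> 1/2"
  shows "\<exists>J. A o\<^sub>L J = id_blinfun \<and> J o\<^sub>L A = id_blinfun \<and> norm J \<le> 2"
proof -
  have d: "norm ((x - A x) - (y - A y)) \<le> 1/2 * norm (x - y)" for x y
  proof -
    have "(x - A x) - (y - A y) = (id_blinfun - A) (x - y)"
      by (simp add: minus_blinfun.rep_eq blinfun.diff_right)
    also have "norm \<dots> \<le> norm (id_blinfun - A) * norm (x - y)" by (rule norm_blinfun)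
    also have "\<dots> \<le> 1/2 * norm (x - y)" using A by (intro mult_right_mono) auto
    finally show ?thesis .
  qed
  have "\<exists>!x. x - A x + y = x" for y
    by (rule banach_fix_type[of "1/2"]) (use d in \<open>auto simp: dist_norm\<close>)
  then have ex1: "\<exists>!x. A x = y" for y
    by (metis add.commute add_diff_cancel_left' diff_add_cancel diff_diff_eq2)
  define j where "j y = (THE x. A x = y)" for y
  have Aj: "A (j y) = y" for y unfolding j_def by (rule theI'[OF ex1])
  have jA: "j (A x) = x" for x using ex1 Aj by metis
  have nj: "norm (j y) \<le> 2 * norm y" for y
  proof -
    have "norm (j y) = norm ((j y - A (j y)) - (0 - A 0) + A (j y))" by simp
    also have "\<dots> \<le> 1/2 * norm (j y - 0) + norm (A (j y))"
      by (intro norm_triangle_mono d) auto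
    finally show ?thesis by (simp add: Aj)
  qed
  have bl: "bounded_linear j"
  proof (rule bounded_linear_intro)
    show "j (x + y) = j x + j y" for x y by (metis Aj jA blinfun.add_right)
    show "j (r *\<^sub>R x) = r *\<^sub>R j x" for r x by (metis Aj jA blinfun.scaleR_right)
    show "norm (j x) \<le> norm x * 2" for x using nj[of x] by simp
  qed
  have [simp]: "blinfun_apply (Blinfun j) = j" by (rule bounded_linear_Blinfun_apply[OF bl])
  show ?thesis
    by (intro exI[of _ "Blinfun j"] conjI blinfun_eqI norm_blinfun_bound) (use Aj jA nj in auto)
qed

definition blinfun_inv :: "('p::banach \<Rightarrow>\<^sub>L 'p) \<Rightarrow> 'p \<Rightarrow>\<^sub>L 'p" where
  "blinfun_inv A = (SOME J. A o\<^sub>L J = id_blinfun \<and> J o\<^sub>L A = id_blinfun \<and> norm J \<le> 2)"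

lemma blinfun_inv:
  assumes "norm (id_blinfun - A) \<le> 1/2"
  shows "A o\<^sub>L blinfun_inv A = id_blinfun" "blinfun_inv A o\<^sub>L A = id_blinfun" "norm (blinfun_inv A) \<le> 2"
  using someI_ex[OF blinfun_near_id_invertible[OF assms]] unfolding blinfun_inv_def by auto

text \<open>The resolvent identity. It turns continuity and differentiability of inversion into norm
  estimates.\<close>

lemma blinfun_inv_diff:
  assumes "norm (id_blinfun - A) \<le> 1/2" "norm (id_blinfun - B) \<le> 1/2"
  shows "blinfun_inv B - blinfun_inv A = - (blinfun_inv A o\<^sub>L (B - A) o\<^sub>L blinfun_inv B)"
proof -
  have "blinfun_inv A (A x) = x" "B (blinfun_inv B x) = x" for x
    using blinfun_inv(2)[OF assms(1)] blinfun_inv(1)[OF assms(2)]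
    by (metis blinfun_apply_blinfun_compose blinfun_apply_id_blinfun id_apply)+
  then show ?thesis
    by (intro blinfun_eqI) (simp add: minus_blinfun.rep_eq uminus_blinfun.rep_eq blinfun.diff_right)
qed

text \<open>Applying the resolvent identity twice leaves the error - J(A) H (J(A + H) - J(A)), of
  size at most 2 |H| 4 |H|; hence the constant 8.\<close>

lemma blinfun_inv_has_derivative:
  assumes A: "norm (id_blinfun - A) < 1/2"
  shows "(blinfun_inv has_derivative (\<lambda>H. - (blinfun_inv A o\<^sub>L H o\<^sub>L blinfun_inv A))) (at A)"
  unfolding has_derivative_at
proof (intro conjI)
  let ?J = blinfun_inv
  show "bounded_linear (\<lambda>H. - (?J A o\<^sub>L H o\<^sub>L ?J A))"
    by (rule bounded_linear_minus[OF bounded_linear_compose[OF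
          bounded_bilinear.bounded_linear_left[OF bounded_bilinear_blinfun_compose]
          bounded_bilinear.bounded_linear_right[OF bounded_bilinear_blinfun_compose]]])
  have A': "norm (id_blinfun - A) \<le> 1/2" using A by simp
  have comp: "norm (X o\<^sub>L Y o\<^sub>L Z) \<le> a * b * c"
    if "norm X \<le> a" "norm Y \<le> b" "norm Z \<le> c" for X Y Z :: "'a \<Rightarrow>\<^sub>L 'a" and a b c
  proof -
    have "norm (X o\<^sub>L Y o\<^sub>L Z) \<le> norm X * norm Y * norm Z"
      by (meson mult_right_mono norm_blinfun_compose norm_ge_zero order_trans)
    also have "\<dots> \<le> a * b * c"
      using that by (intro mult_mono) (auto intro: order_trans[OF norm_ge_zero] mult_nonneg_nonneg)
    finally show ?thesis .
  qed
  show "(\<lambda>H. norm (?J (A + H) - ?J A - - (?J A o\<^sub>L H o\<^sub>L ?J A)) / norm H) \<midarrow>0\<rightarrow> 0"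
  proof (rule Lim_null_comparison)
    show "\<forall>\<^sub>F H in at 0. norm (norm (?J (A + H) - ?J A - - (?J A o\<^sub>L H o\<^sub>L ?J A)) / norm H) \<le> 8 * norm H"
      unfolding eventually_at
    proof (intro exI[of _ "1/2 - norm (id_blinfun - A)"] conjI ballI impI)
      fix H :: "'a \<Rightarrow>\<^sub>L 'a" assume H: "H \<noteq> 0 \<and> dist H 0 < 1/2 - norm (id_blinfun - A)"
      have "norm (id_blinfun - (A + H)) \<le> norm (id_blinfun - A) + norm H"
        by (metis diff_diff_eq norm_triangle_ineq4)
      then have B: "norm (id_blinfun - (A + H)) \<le> 1/2" using H by simp
      have 1: "?J (A + H) - ?J A = - (?J A o\<^sub>L H o\<^sub>L ?J (A + H))"
        using blinfun_inv_diff[OF A' B] by simp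
      have n1: "norm (?J (A + H) - ?J A) \<le> 4 * norm H"
        using comp[OF blinfun_inv(3)[OF A'] order_refl[of "norm H"] blinfun_inv(3)[OF B]] by (simp add: 1)
      have "?J (A + H) - ?J A - - (?J A o\<^sub>L H o\<^sub>L ?J A) = - (?J A o\<^sub>L H o\<^sub>L (?J (A + H) - ?J A))"
      proof -
        have "- (X o\<^sub>L H o\<^sub>L B) - - (X o\<^sub>L H o\<^sub>L C) = - (X o\<^sub>L H o\<^sub>L (B - C))" for X B C :: "'a \<Rightarrow>\<^sub>L 'a"
          by (intro blinfun_eqI) (simp add: minus_blinfun.rep_eq uminus_blinfun.rep_eq blinfun.diff_right)
        then show ?thesis by (subst 1)
      qed
      also have "norm \<dots> \<le> 2 * norm H * (4 * norm H)"
        using comp[OF blinfun_inv(3)[OF A'] order_refl[of "norm H"] n1] by simp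
      finally show "norm (norm (?J (A + H) - ?J A - - (?J A o\<^sub>L H o\<^sub>L ?J A)) / norm H) \<le> 8 * norm H"
        using H by (simp add: divide_simps)
    qed (use A in auto)
    show "(\<lambda>H::'a \<Rightarrow>\<^sub>L 'a. 8 * norm H) \<midarrow>0\<rightarrow> 0" by (auto intro!: tendsto_eq_intros)
  qed
qed

context commuting_fields
begin

text \<open>The chart is the local inverse \<open>H\<close> of \<open>v \<mapsto> L (flow v p)\<close>, hence defined on a neighbourhood in the
  ambient space; \<open>rigid\<close> says that \<open>L\<close> separates the points of \<open>M\<close> near \<open>p\<close>. The map \<open>l\<close> is a coordinate
  change from a product space, in which smoothness is defined.\<close>

lemma local_chart:
  fixes L :: "'e \<Rightarrow>\<^sub>L 'p" and \<pi> :: "'p \<Rightarrow>\<^sub>L 'p" and p :: 'e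
  assumes p: "p \<in> M" and LV: "\<And>v. L (V v p) = \<pi> v" and \<pi>L: "\<And>x. \<pi> (L x) = L x"
    and \<pi>\<pi>: "\<And>v. \<pi> (\<pi> v) = \<pi> v"
    and rigid: "\<epsilon>0 > 0" "\<And>x y. x \<in> M \<Longrightarrow> y \<in> M \<Longrightarrow> dist x p < \<epsilon>0 \<Longrightarrow> dist y p < \<epsilon>0 \<Longrightarrow> L x = L y \<Longrightarrow> x = y"
  shows "\<exists>\<delta>>0. \<exists>\<epsilon>>0. \<exists>H. (\<forall>w. \<pi> w = w \<longrightarrow> norm w < \<delta> \<longrightarrow> H (flow w p) = w) \<and>
     (\<forall>x\<in>M. dist x p < \<epsilon> \<longrightarrow> \<pi> (H x) = H x \<and> norm (H x) < \<delta> \<and> flow (H x) p = x) \<and>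
     (\<forall>(l :: ('i \<Rightarrow> 'v::real_normed_vector) \<Rightarrow> 'e) l'. continuous_on UNIV l \<longrightarrow>
        (\<forall>i v x t. l (x(i := x i + t *\<^sub>R v)) = l x + t *\<^sub>R l' i v) \<longrightarrow>
        (\<forall>k. C_k k {y. dist (l y) p < \<epsilon>} (\<lambda>y. H (l y))))"
proof -
  \<comment> \<open>At p the composite of L with the tangent map is only the projection \<pi>;
    adding id - \<pi> makes \<open>K p\<close> the identity, so that \<open>K\<close> stays
    invertible near p.\<close>
  define K where "K x = (L o\<^sub>L Q x x) + (id_blinfun - \<pi>)" for x
  have Kp: "K p = id_blinfun"
    by (intro blinfun_eqI) (simp add: K_def plus_blinfun.rep_eq minus_blinfun.rep_eq LV[unfolded V_def])
  have contK: "continuous_on A K" for A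
    unfolding K_def
    by (intro continuous_intros bounded_bilinear.continuous_on[OF bounded_bilinear_blinfun_compose]
       bounded_bilinear.continuous_on[OF bilinear])
  have contf: "continuous_on A (\<lambda>v. flow v p)" for A by (rule continuous_flow[OF p])
  have contKf: "continuous_on A (\<lambda>v. K (flow v p))" for A
    by (rule continuous_on_compose2[OF contK contf subset_UNIV])
  obtain \<delta>0 where \<delta>0: "\<delta>0 > 0" "\<And>v. dist v 0 < \<delta>0 \<Longrightarrow> dist (K (flow v p)) (K (flow 0 p)) < 1/2"
    using contKf[of UNIV] unfolding continuous_on_iff by (metis UNIV_I half_gt_zero_iff zero_less_one)
  define \<delta> where "\<delta> = \<delta>0 / 2"
  have \<delta>: "\<delta> > 0" using \<delta>0 by (simp add: \<delta>_def)
  have nK: "norm (id_blinfun - K (flow v p)) < 1/2" if "norm v \<le> \<delta>" for v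
    using \<delta>0(2)[of v] \<delta>0(1) that by (simp add: dist_norm flow_0[OF p] Kp \<delta>_def norm_minus_commute)
  \<comment> \<open>The matching completion of v \<mapsto> L (flow v p) to a local diffeomorphism of
    the whole parameter space; its derivative is \<open>K (flow v p)\<close>.\<close>
  define k where "k v = L (flow v p) - L p + (v - \<pi> v)" for v
  have k0: "k 0 = 0" by (simp add: k_def flow_0[OF p])
  have k': "(k has_derivative K (flow v p)) (at v)" for v
  proof -
    have "((\<lambda>v. L (flow v p) - L p + (v - \<pi> v)) has_derivative (\<lambda>w. L (V w (flow v p)) - 0 + (w - \<pi> w))) (at v)"
      by (intro has_derivative_add has_derivative_diff has_derivative_const has_derivative_ident
         bounded_linear.has_derivative[OF blinfun.bounded_linear_right] flow_has_derivative[OF p])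
    moreover have "(\<lambda>w. L (V w (flow v p)) - 0 + (w - \<pi> w)) = K (flow v p)"
      by (auto simp: K_def plus_blinfun.rep_eq minus_blinfun.rep_eq V_def)
    ultimately show ?thesis unfolding k_def by simp
  qed
  have contr: "norm ((v - k v) - (w - k w)) \<le> 1/2 * norm (v - w)" if "norm v \<le> \<delta>" "norm w \<le> \<delta>" for v w
  proof (rule differentiable_bound[where f = "\<lambda>v. v - k v" and S = "cball 0 \<delta>" and f' = "\<lambda>v. blinfun_apply (id_blinfun - K (flow v p))"])
    fix v :: 'p assume "v \<in> cball 0 \<delta>"
    show "((\<lambda>v. v - k v) has_derivative blinfun_apply (id_blinfun - K (flow v p))) (at v within cball 0 \<delta>)"
      using has_derivative_diff[OF has_derivative_ident k', THEN has_derivative_at_withinI]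
      by (simp add: minus_blinfun.rep_eq)
    show "onorm (blinfun_apply (id_blinfun - K (flow v p))) \<le> 1/2"
      using nK[of v] \<open>v \<in> cball 0 \<delta>\<close> by (simp add: norm_blinfun.rep_eq)
  qed (use that in auto)
  \<comment> \<open>The fixed points of v \<mapsto> y + (v - k v) are the solutions of k v = y; half
    of the radius is left for y, the contraction uses the other half.\<close>
  have exv: "\<exists>!v. v \<in> cball 0 \<delta> \<and> y + (v - k v) = v" if y: "norm y \<le> \<delta> / 2" for y
  proof (rule Banach_fix[of "cball 0 \<delta>" "1/2" "\<lambda>v. y + (v - k v)"])
    show "(\<lambda>v. y + (v - k v)) ` cball 0 \<delta> \<subseteq> cball 0 \<delta>"
    proof clarsimp
      fix v :: 'p assume v: "norm v \<le> \<delta>"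
      have "norm (y + (v - k v)) \<le> norm y + norm ((v - k v) - (0 - k 0))"
        using norm_triangle_ineq[of y "v - k v"] by (simp add: k0)
      also have "\<dots> \<le> \<delta> / 2 + 1/2 * norm (v - 0)" using y \<delta> v by (intro add_mono contr) auto
      finally show "norm (y + (v - k v)) \<le> \<delta>" using v by simp
    qed
  qed (use \<delta> contr in \<open>auto simp: dist_norm complete_eq_closed\<close>)
  define h where "h y = (THE v. v \<in> cball 0 \<delta> \<and> y + (v - k v) = v)" for y
  have h: "norm (h y) \<le> \<delta>" "k (h y) = y" if "norm y \<le> \<delta> / 2" for y
    using theI'[OF exv[OF that]] unfolding h_def[symmetric] by (auto simp: algebra_simps)
  have h_unique: "h y = v" if "norm y \<le> \<delta> / 2" "norm v \<le> \<delta>" "k v = y" for y v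
    using exv[OF that(1)] h[OF that(1)] that by (metis add_diff_cancel_left' diff_add_cancel dist_0_norm mem_cball add.commute)
  have h_lip: "norm (h y - h z) \<le> 2 * norm (y - z)" if "norm y \<le> \<delta> / 2" "norm z \<le> \<delta> / 2" for y z
  proof -
    have "norm (h y - h z) = norm (((h y - k (h y)) - (h z - k (h z))) + (y - z))"
      using h that by simp
    also have "\<dots> \<le> 1/2 * norm (h y - h z) + norm (y - z)"
      using h that by (intro norm_triangle_mono contr) auto
    finally show ?thesis by simp
  qed
  have h0: "h 0 = 0" using h_unique[of 0 0] \<delta> k0 by simp
  have h_cont: "continuous_on (ball 0 (\<delta>/2)) h"
    unfolding continuous_on_iff
  proof (intro ballI allI impI)
    fix x :: 'p and e :: real assume "x \<in> ball 0 (\<delta>/2)" "0 < e"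
    then show "\<exists>d>0. \<forall>x'\<in>ball 0 (\<delta> / 2). dist x' x < d \<longrightarrow> dist (h x') (h x) < e"
      using h_lip by (intro exI[of _ "e/2"]) (auto simp: dist_norm, smt (verit))
  qed
  have h': "(h has_derivative blinfun_inv (K (flow (h y) p))) (at y)" if y: "norm y < \<delta> / 2" for y
  proof (rule has_derivative_inverse_basic[where f = k and T = "ball 0 (\<delta>/2)" and f' = "K (flow (h y) p)"])
    show "(k has_derivative blinfun_apply (K (flow (h y) p))) (at (h y))" by (rule k')
    have "norm (h y) \<le> \<delta>" using h y by simp
    from blinfun_inv(2)[OF less_imp_le[OF nK[OF this]]]
    show "blinfun_apply (blinfun_inv (K (flow (h y) p))) \<circ> blinfun_apply (K (flow (h y) p)) = id"
      by (metis blinfun_compose.rep_eq id_blinfun.rep_eq eq_id_iff)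
    show "continuous (at y) h"
      using h_cont y by (simp add: continuous_on_eq_continuous_at)
  qed (use y h in \<open>auto simp: blinfun.bounded_linear_right\<close>)
  obtain \<delta>1 where \<delta>1: "\<delta>1 > 0" "\<And>v. dist v 0 < \<delta>1 \<Longrightarrow> dist (L (flow v p)) (L (flow 0 p)) < \<delta> / 2"
  proof -
    have "continuous_on UNIV (\<lambda>v. L (flow v p))" using contf by (intro continuous_intros)
    then show ?thesis using that \<delta> unfolding continuous_on_iff by (metis UNIV_I half_gt_zero)
  qed
  obtain \<delta>2 where \<delta>2: "\<delta>2 > 0" "\<And>v. dist v 0 < \<delta>2 \<Longrightarrow> dist (flow v p) (flow 0 p) < \<epsilon>0"
    using contf[of UNIV] rigid(1) unfolding continuous_on_iff by (metis UNIV_I)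
  \<comment> \<open>\<open>\<delta>1\<close> keeps L (flow v p) - L p in the domain of
    \<open>h\<close>, and \<open>\<delta>2\<close> keeps flow v p where L separates the points of
    \<open>M\<close>. The factor 2 in \<open>\<epsilon>\<close> below is the Lipschitz constant of
    \<open>h\<close>.\<close>
  define \<delta>' where "\<delta>' = min \<delta> (min \<delta>1 \<delta>2)"
  have \<delta>': "\<delta>' > 0" "\<delta>' \<le> \<delta>" "\<delta>' \<le> \<delta>1" "\<delta>' \<le> \<delta>2" using \<delta> \<delta>1 \<delta>2 by (auto simp: \<delta>'_def)
  define \<epsilon> where "\<epsilon> = min \<epsilon>0 (\<delta>' / (2 * (norm L + 1)))"
  have nL: "norm L + 1 > 0" by (smt (verit) norm_ge_zero)
  have \<epsilon>: "\<epsilon> > 0" "\<epsilon> \<le> \<epsilon>0" using \<delta>' rigid nL by (auto simp: \<epsilon>_def)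
  have L\<epsilon>: "norm (L x - L p) < \<delta>' / 2" if "dist x p < \<epsilon>" for x
  proof -
    have "norm (L x - L p) \<le> norm L * norm (x - p)"
      by (simp add: blinfun.diff_right[symmetric] norm_blinfun)
    also have "\<dots> \<le> (norm L + 1) * norm (x - p)" by (intro mult_right_mono) auto
    also have "\<dots> < (norm L + 1) * (\<delta>' / (2 * (norm L + 1)))"
      using that nL by (intro mult_strict_left_mono) (auto simp: \<epsilon>_def dist_norm)
    also have "\<dots> = \<delta>' / 2" using nL by (simp add: field_simps)
    finally show ?thesis .
  qed
  define H where "H x = h (L x - L p)" for x
  have nH: "norm (H x) < \<delta>'" if "dist x p < \<epsilon>" for x
  proof -
    have "norm (H x) \<le> 2 * norm (L x - L p)"
      using h_lip[of "L x - L p" 0] L\<epsilon>[OF that] \<delta>' \<delta> by (simp add: H_def h0)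
    then show ?thesis using L\<epsilon>[OF that] by simp
  qed
  show ?thesis
  proof (rule exI[of _ \<delta>'], rule conjI[OF \<delta>'(1)], rule exI[of _ \<epsilon>], rule conjI[OF \<epsilon>(1)],
      rule exI[of _ H], intro conjI allI impI ballI)
    fix w assume w: "\<pi> w = w" "norm w < \<delta>'"
    then have "norm (L (flow w p) - L p) < \<delta> / 2"
      using \<delta>1(2)[of w] \<delta>' by (simp add: dist_norm flow_0[OF p])
    then show "H (flow w p) = w"
      using w \<delta>' by (auto simp: H_def k_def intro!: h_unique)
  next
    fix x assume x: "x \<in> M" "dist x p < \<epsilon>"
    let ?y = "L x - L p" let ?v = "h ?y"
    have y: "norm ?y < \<delta> / 2" using L\<epsilon>[OF x(2)] \<delta>' by simp
    have kv: "L (flow ?v p) - L p + (?v - \<pi> ?v) = ?y" using h(2)[of ?y] y by (simp add: k_def)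
    \<comment> \<open>id - \<pi> is idempotent and annihilates every value of L, so of the equation
      only \<open>?v - \<pi> ?v = 0\<close> survives.\<close>
    from arg_cong[OF this, of "\<lambda>z. z - \<pi> z"] have "?v - \<pi> ?v = 0"
      by (simp add: blinfun.add_right blinfun.diff_right \<pi>L \<pi>\<pi>)
    then show 1: "\<pi> (H x) = H x" by (simp add: H_def)
    show 2: "norm (H x) < \<delta>'" by (rule nH[OF x(2)])
    have "L (flow (H x) p) = L x" using kv 1 by (simp add: H_def)
    moreover have "dist (flow (H x) p) p < \<epsilon>0"
      using \<delta>2(2)[of "H x"] 2 \<delta>' by (simp add: flow_0[OF p])
    ultimately show "flow (H x) p = x"
      using rigid(2) x \<epsilon> flow_in_M[OF p] by (meson less_le_trans)
  next
    fix l :: "('i \<Rightarrow> 'v) \<Rightarrow> 'e" and l' k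
    assume contl: "continuous_on UNIV l" and l': "\<forall>i v x t. l (x(i := x i + t *\<^sub>R v)) = l x + t *\<^sub>R l' i v"
    define U where "U = {y. dist (l y) p < \<epsilon>}"
    define u where "u y = H (l y)" for y
    define \<Phi> where "\<Phi> y = flow (u y) p" for y
    define J where "J y = blinfun_inv (K (\<Phi> y))" for y
    have Ub: "norm (L (l y) - L p) < \<delta> / 2" if "y \<in> U" for y
      using L\<epsilon>[of "l y"] that \<delta>' by (simp add: U_def)
    have nKU: "norm (id_blinfun - K (\<Phi> y)) < 1/2" if "y \<in> U" for y
      using nK[of "u y"] nH[of "l y"] that \<delta>' by (simp add: U_def \<Phi>_def u_def)
    have contu: "continuous_on U u"
      unfolding u_def H_def
    proof (rule continuous_on_compose2[OF h_cont])
      show "continuous_on U (\<lambda>x. L (l x) - L p)"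
        using continuous_on_subset[OF contl] by (intro continuous_intros) auto
    qed (use Ub in auto)
    have cont\<Phi>: "continuous_on U \<Phi>"
      unfolding \<Phi>_def by (rule continuous_on_compose2[OF contf contu subset_UNIV])
    have contJ: "continuous_on U J"
      unfolding J_def
    proof (rule continuous_on_compose2[of "{A. norm (id_blinfun - A) < 1/2}" blinfun_inv U "\<lambda>y. K (\<Phi> y)"])
      show "continuous_on {A :: 'p \<Rightarrow>\<^sub>L 'p. norm (id_blinfun - A) < 1/2} blinfun_inv"
        using blinfun_inv_has_derivative has_derivative_continuous by (blast intro: continuous_at_imp_continuous_on)
      show "continuous_on U (\<lambda>y. K (\<Phi> y))" by (rule continuous_on_compose2[OF contK cont\<Phi> subset_UNIV])
    qed (use nKU in auto)
    define u' where "u' i v y = J y (L (l' i v))" for i v y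
    define \<Phi>' where "\<Phi>' i v y = Q (\<Phi> y) (\<Phi> y) (u' i v y)" for i v y
    define K' where "K' i v y = L o\<^sub>L (Q (\<Phi> y) (\<Phi>' i v y) + Q (\<Phi>' i v y) (\<Phi> y))" for i v y
    define J' where "J' i v y = - (J y o\<^sub>L K' i v y o\<^sub>L J y)" for i v y
    have du: "((\<lambda>t. u (x(i := x i + t *\<^sub>R v))) has_vector_derivative u' i v x) (at 0)" if x: "x \<in> U" for i v x
    proof -
      have 1: "((\<lambda>t. L (l x) - L p + t *\<^sub>R L (l' i v)) has_vector_derivative L (l' i v)) (at 0)"
        by (auto intro!: derivative_eq_intros)
      have 2: "(h has_derivative (\<lambda>w. J x w)) (at (L (l x) - L p + 0 *\<^sub>R L (l' i v)) within range (\<lambda>t. L (l x) - L p + t *\<^sub>R L (l' i v)))"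
        using h'[of "L (l x) - L p"] Ub[OF x] unfolding J_def \<Phi>_def u_def H_def
        by (auto intro: has_derivative_at_withinI)
      have "u (x(i := x i + t *\<^sub>R v)) = h (L (l x) - L p + t *\<^sub>R L (l' i v))" for t
        by (simp add: u_def H_def l' blinfun.add_right blinfun.scaleR_right algebra_simps)
      then show ?thesis
        using vector_derivative_diff_chain_within[OF 1 2] by (simp add: o_def u'_def)
    qed
    have d\<Phi>: "((\<lambda>t. \<Phi> (x(i := x i + t *\<^sub>R v))) has_vector_derivative \<Phi>' i v x) (at 0)" if x: "x \<in> U" for i v x
      using vector_derivative_diff_chain_within[OF du[OF x], of "\<lambda>v. flow v p" "\<lambda>w. V w (\<Phi> x)" i v]
        has_derivative_at_withinI[OF flow_has_derivative[OF p, of "u x"]]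
      by (simp add: o_def \<Phi>'_def \<Phi>_def V_def)
    have dJ: "((\<lambda>t. J (x(i := x i + t *\<^sub>R v))) has_vector_derivative J' i v x) (at 0)" if x: "x \<in> U" for i v x
    proof -
      have "((\<lambda>t. K (\<Phi> (x(i := x i + t *\<^sub>R v)))) has_vector_derivative (K' i v x + 0)) (at 0)"
      proof -
        have "((\<lambda>t. Q (\<Phi> (x(i := x i + t *\<^sub>R v))) (\<Phi> (x(i := x i + t *\<^sub>R v))))
            has_vector_derivative (Q (\<Phi> x) (\<Phi>' i v x) + Q (\<Phi>' i v x) (\<Phi> x))) (at 0)"
          using bounded_bilinear.has_vector_derivative[OF bilinear d\<Phi>[OF x] d\<Phi>[OF x]] by simp
        from bounded_linear.has_vector_derivative[OF bounded_bilinear.bounded_linear_right[OF bounded_bilinear_blinfun_compose] this]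
        show ?thesis unfolding K_def K'_def
          by (intro has_vector_derivative_add has_vector_derivative_const) auto
      qed
      then have 1: "((\<lambda>t. K (\<Phi> (x(i := x i + t *\<^sub>R v)))) has_vector_derivative K' i v x) (at 0)" by simp
      show ?thesis
        using vector_derivative_diff_chain_within[OF 1, of blinfun_inv "\<lambda>H. - (J x o\<^sub>L H o\<^sub>L J x)"]
          has_derivative_at_withinI[OF blinfun_inv_has_derivative[OF nKU[OF x]]]
        by (simp add: o_def J_def J'_def)
    qed
    \<comment> \<open>The system is closed: the derivatives of u, \<Phi> and J are polynomial in
      \<Phi> and J, with L (l' i v) constant. Hence all three gain regularity together.\<close>
    have "C_k k U u \<and> C_k k U \<Phi> \<and> C_k k U J"
    proof (induction k)
      case (Suc k)
      note bb = C_k_bilinear[OF bounded_bilinear_blinfun_apply] C_k_bilinear[OF bounded_bilinear_blinfun_compose]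
        C_k_bilinear[OF bilinear]
      have u'k: "C_k k U (u' i v)" for i v unfolding u'_def using Suc by (intro bb C_k_const) auto
      have \<Phi>'k: "C_k k U (\<Phi>' i v)" for i v unfolding \<Phi>'_def using Suc u'k by (intro bb) auto
      have K'k: "C_k k U (K' i v)" for i v unfolding K'_def using Suc \<Phi>'k by (intro bb C_k_add C_k_const) auto
      have J'k: "C_k k U (J' i v)" for i v
        unfolding J'_def using Suc K'k
        by (intro C_k_bounded_linear[OF bounded_linear_minus[OF bounded_linear_ident]] bb) auto
      show ?case
        using C_k_SucI[OF contu u'k du] C_k_SucI[OF cont\<Phi> \<Phi>'k d\<Phi>] C_k_SucI[OF contJ J'k dJ] by blast
    qed (use contu cont\<Phi> contJ in simp)
    then show "C_k k {y. dist (l y) p < \<epsilon>} (\<lambda>y. H (l y))"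
      by (simp add: U_def u_def[abs_def])
  qed
qed

end

section \<open>Lattices\<close>

text \<open>Stated for indexed families: bases are built and extended index by index, and the
  integer coordinates of a lattice vector refer to these indices.\<close>

definition lin_indep :: "nat \<Rightarrow> (nat \<Rightarrow> 'a::real_vector) \<Rightarrow> bool" where
  "lin_indep n b \<longleftrightarrow> (\<forall>t. (\<Sum>j<n. t j *\<^sub>R b j) = 0 \<longrightarrow> (\<forall>j<n. t j = 0))"

lemma lin_indep_unique:
  assumes "lin_indep n b" "(\<Sum>j<n. t j *\<^sub>R b j) = (\<Sum>j<n. s j *\<^sub>R b j)" "j < n"
  shows "t j = s j"
proof -
  have "(\<Sum>j<n. (t j - s j) *\<^sub>R b j) = 0"
    using assms(2) by (simp add: scaleR_left_diff_distrib sum_subtractf)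
  from assms(1)[unfolded lin_indep_def, rule_format, OF this assms(3)] have "t j - s j = 0" .
  then show ?thesis by simp
qed

lemma lin_indep_independent:
  assumes "lin_indep n b"
  shows "inj_on b {..<n}" "independent (b ` {..<n})"
proof -
  show inj: "inj_on b {..<n}"
  proof (rule inj_onI, rule ccontr)
    fix i j assume ij: "i \<in> {..<n}" "j \<in> {..<n}" "b i = b j" "i \<noteq> j"
    have "(\<Sum>k<n. (if k = i then 1 else 0) *\<^sub>R b k) = (\<Sum>k<n. (if k = j then 1 else 0) *\<^sub>R b k)"
      using ij by (simp add: if_distrib[of "\<lambda>r. r *\<^sub>R _"] cong: if_cong)
    from lin_indep_unique[OF assms this, of i] show False using ij by auto
  qed
  show "independent (b ` {..<n})"
  proof (rule independent_if_scalars_zero)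
    fix f x assume f: "(\<Sum>x\<in>b ` {..<n}. f x *\<^sub>R x) = 0" and x: "x \<in> b ` {..<n}"
    have "(\<Sum>j<n. f (b j) *\<^sub>R b j) = 0" using f by (simp add: sum.reindex[OF inj])
    then show "f x = 0" using assms x unfolding lin_indep_def by fastforce
  qed simp
qed

lemma compact_fun:
  fixes S :: "'i \<Rightarrow> 'b::topological_space set"
  assumes "\<And>i. compact (S i)"
  shows "compact {f. \<forall>i. f i \<in> S i}"
proof -
  have "compactin (product_topology (\<lambda>i. euclidean) UNIV) (PiE UNIV S)"
    using assms by (subst compactin_PiE) auto
  then show ?thesis
    by (simp add: euclidean_product_topology PiE_UNIV_domain Pi_def)
qed

lemma finite_separated:
  fixes S :: "'a::metric_space set"
  assumes "compact K" "S \<subseteq> K" "\<delta> > 0" "\<And>x y. x \<in> S \<Longrightarrow> y \<in> S \<Longrightarrow> x \<noteq> y \<Longrightarrow> \<delta> \<le> dist x y"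
  shows "finite S"
proof (rule ccontr)
  assume "infinite S"
  then obtain x where "x islimpt S"
    using assms(1,2) compact_eq_Bolzano_Weierstrass by metis
  then have inf: "infinite (S \<inter> ball x (\<delta>/2))"
    using assms(3) by (simp add: islimpt_eq_infinite_ball)
  then have "S \<inter> ball x (\<delta>/2) \<noteq> {}" by (metis finite.emptyI)
  then obtain y where y: "y \<in> S \<inter> ball x (\<delta>/2)" by blast
  have "infinite (S \<inter> ball x (\<delta>/2) - {y})" using inf by simp
  then have "S \<inter> ball x (\<delta>/2) - {y} \<noteq> {}" by (metis finite.emptyI)
  then obtain z where z: "z \<in> S \<inter> ball x (\<delta>/2)" "z \<noteq> y" by blast
  have "dist y z < \<delta>" using y z dist_triangle3[of y z x] by auto
  then show False using assms(4)[of y z] y z by auto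
qed

text \<open>Induction on the rank. The lattice vectors spanned by the first n vectors get a basis by
  hypothesis; it is completed by a lattice vector whose coefficient at \<open>b n\<close> is
  positive and minimal. Discreteness enters as finiteness of the lattice points in a compact
  box.\<close>

lemma lattice_basis:
  fixes \<Lambda> :: "'a::real_normed_vector set"
  assumes zero: "0 \<in> \<Lambda>" and diff: "\<And>x y. x \<in> \<Lambda> \<Longrightarrow> y \<in> \<Lambda> \<Longrightarrow> x - y \<in> \<Lambda>"
    and \<delta>: "\<delta> > 0" "\<And>x. x \<in> \<Lambda> \<Longrightarrow> x \<noteq> 0 \<Longrightarrow> \<delta> \<le> norm x"
    and "lin_indep n b" "\<And>j. j < n \<Longrightarrow> b j \<in> \<Lambda>"
    and "\<And>x. x \<in> \<Lambda> \<Longrightarrow> \<exists>t. x = (\<Sum>j<n. t j *\<^sub>R b j)"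
  shows "\<exists>b'. lin_indep n b' \<and> (\<forall>j<n. b' j \<in> \<Lambda>) \<and>
    (\<forall>x\<in>\<Lambda>. \<exists>m::nat \<Rightarrow> int. x = (\<Sum>j<n. of_int (m j) *\<^sub>R b' j))"
  using assms
proof (induction n arbitrary: \<Lambda>)
  case 0
  then show ?case by (intro exI[of _ b]) auto
next
  case (Suc n)
  note zero = Suc.prems(1) and diff = Suc.prems(2) and \<delta> = Suc.prems(3,4)
    and ind = Suc.prems(5) and b = Suc.prems(6) and rep = Suc.prems(7)
  have minus: "- x \<in> \<Lambda>" if "x \<in> \<Lambda>" for x using diff[OF zero that] by simp
  have add: "x + y \<in> \<Lambda>" if "x \<in> \<Lambda>" "y \<in> \<Lambda>" for x y using diff[OF that(1) minus[OF that(2)]] by simp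
  have nmult: "of_nat k *\<^sub>R x \<in> \<Lambda>" if "x \<in> \<Lambda>" for x and k :: nat
    by (induction k) (auto simp: zero algebra_simps intro: add that)
  have zmult: "of_int k *\<^sub>R x \<in> \<Lambda>" if "x \<in> \<Lambda>" for x and k :: int
  proof (cases "k \<ge> 0")
    case True
    then show ?thesis using nmult[OF that, of "nat k"] by simp
  next
    case False
    then show ?thesis using minus[OF nmult[OF that, of "nat (- k)"]] by simp
  qed
  have sums: "(\<Sum>j\<in>A. f j) \<in> \<Lambda>" if "\<And>j. j \<in> A \<Longrightarrow> f j \<in> \<Lambda>" for A :: "nat set" and f
    using that by (induction A rule: infinite_finite_induct) (auto simp: zero intro: add)
  define \<Lambda>' where "\<Lambda>' = {x \<in> \<Lambda>. \<exists>t. x = (\<Sum>j<n. t j *\<^sub>R b j)}"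
  have ind': "lin_indep n b"
    unfolding lin_indep_def
  proof (intro allI impI)
    fix t j assume t: "(\<Sum>j<n. t j *\<^sub>R b j) = 0" "j < n"
    have "(\<Sum>j<Suc n. (if j < n then t j else 0) *\<^sub>R b j) = 0" using t by simp
    from ind[unfolded lin_indep_def, rule_format, OF this, of j] show "t j = 0" using t(2) by simp
  qed
  have "\<exists>b'. lin_indep n b' \<and> (\<forall>j<n. b' j \<in> \<Lambda>') \<and>
    (\<forall>x\<in>\<Lambda>'. \<exists>m::nat \<Rightarrow> int. x = (\<Sum>j<n. of_int (m j) *\<^sub>R b' j))"
  proof (rule Suc.IH)
    show "0 \<in> \<Lambda>'" using zero by (auto simp: \<Lambda>'_def intro!: exI[of _ "\<lambda>_. 0"])
    show "x - y \<in> \<Lambda>'" if "x \<in> \<Lambda>'" "y \<in> \<Lambda>'" for x y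
    proof -
      obtain t s where "x = (\<Sum>j<n. t j *\<^sub>R b j)" "y = (\<Sum>j<n. s j *\<^sub>R b j)" using \<open>x \<in> \<Lambda>'\<close> \<open>y \<in> \<Lambda>'\<close> by (auto simp: \<Lambda>'_def)
      then have "x - y = (\<Sum>j<n. (t j - s j) *\<^sub>R b j)" by (simp add: scaleR_left_diff_distrib sum_subtractf)
      moreover have "x - y \<in> \<Lambda>" using that diff[of x y] by (simp add: \<Lambda>'_def)
      ultimately show ?thesis unfolding \<Lambda>'_def by (intro CollectI conjI exI[of _ "\<lambda>j. t j - s j"])
    qed
    show "b j \<in> \<Lambda>'" if "j < n" for j
    proof -
      have "b j = (\<Sum>k<n. (if k = j then 1 else 0) *\<^sub>R b k)"
        using that by (simp add: if_distrib[of "\<lambda>r. r *\<^sub>R _"] cong: if_cong)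
      moreover have "b j \<in> \<Lambda>" using that b[of j] by simp
      ultimately show ?thesis unfolding \<Lambda>'_def
        by (intro CollectI conjI exI[of _ "\<lambda>k. if k = j then 1 else 0"])
    qed
  qed (use \<delta> ind' in \<open>auto simp: \<Lambda>'_def\<close>)
  then obtain b' where b': "lin_indep n b'" "\<And>j. j < n \<Longrightarrow> b' j \<in> \<Lambda>'"
    "\<And>x. x \<in> \<Lambda>' \<Longrightarrow> \<exists>m::nat \<Rightarrow> int. x = (\<Sum>j<n. of_int (m j) *\<^sub>R b' j)" by blast
  have b'\<Lambda>: "b' j \<in> \<Lambda>" if "j < n" for j using b'(2)[OF that] by (simp add: \<Lambda>'_def)
  define comb where "comb s c = (\<Sum>j<n. s j *\<^sub>R b' j) + c *\<^sub>R b n" for s :: "nat \<Rightarrow> real" and c :: real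
  obtain \<tau> where \<tau>: "\<And>j. j < n \<Longrightarrow> b' j = (\<Sum>i<n. \<tau> j i *\<^sub>R b i)"
    using b'(2) unfolding \<Lambda>'_def by simp metis
  have b'b: "(\<Sum>j<n. s j *\<^sub>R b' j) = (\<Sum>i<n. (\<Sum>j<n. s j * \<tau> j i) *\<^sub>R b i)" for s
  proof -
    have "(\<Sum>j<n. s j *\<^sub>R b' j) = (\<Sum>j<n. \<Sum>i<n. (s j * \<tau> j i) *\<^sub>R b i)"
      by (intro sum.cong) (auto simp: \<tau> scaleR_sum_right)
    also have "\<dots> = (\<Sum>i<n. (\<Sum>j<n. s j * \<tau> j i) *\<^sub>R b i)"
      by (subst sum.swap) (simp add: scaleR_sum_left)
    finally show ?thesis .
  qed
  have "\<forall>j<n. \<exists>\<sigma>. b j = (\<Sum>i<n. \<sigma> i *\<^sub>R b' i)"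
  proof (intro allI impI)
    fix j assume "j < n"
    have "b j = (\<Sum>k<n. (if k = j then 1 else 0) *\<^sub>R b k)"
      using \<open>j < n\<close> by (simp add: if_distrib[of "\<lambda>r. r *\<^sub>R _"] cong: if_cong)
    moreover have "b j \<in> \<Lambda>" using \<open>j < n\<close> b[of j] by simp
    ultimately have "b j \<in> \<Lambda>'" unfolding \<Lambda>'_def
      by (intro CollectI conjI exI[of _ "\<lambda>k. if k = j then 1 else 0"])
    then obtain m :: "nat \<Rightarrow> int" where "b j = (\<Sum>i<n. of_int (m i) *\<^sub>R b' i)" using b'(3) by blast
    then show "\<exists>\<sigma>. b j = (\<Sum>i<n. \<sigma> i *\<^sub>R b' i)" by (rule exI[of _ "\<lambda>i. of_int (m i)"])
  qed
  then obtain \<sigma> where \<sigma>: "\<And>j. j < n \<Longrightarrow> b j = (\<Sum>i<n. \<sigma> j i *\<^sub>R b' i)" by metis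
  have bb': "(\<Sum>j<n. s j *\<^sub>R b j) = (\<Sum>i<n. (\<Sum>j<n. s j * \<sigma> j i) *\<^sub>R b' i)" for s
  proof -
    have "(\<Sum>j<n. s j *\<^sub>R b j) = (\<Sum>j<n. \<Sum>i<n. (s j * \<sigma> j i) *\<^sub>R b' i)"
      by (intro sum.cong refl) (subst \<sigma>, auto simp: scaleR_sum_right)
    also have "\<dots> = (\<Sum>i<n. (\<Sum>j<n. s j * \<sigma> j i) *\<^sub>R b' i)"
      by (subst sum.swap) (simp add: scaleR_sum_left)
    finally show ?thesis .
  qed
  have comb0: "c = 0 \<and> (\<forall>j<n. s j = 0)" if "comb s c = 0" for s c
  proof -
    have "(\<Sum>i<Suc n. (if i < n then (\<Sum>j<n. s j * \<tau> j i) else c) *\<^sub>R b i) = 0"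
      using that by (simp add: comb_def b'b)
    from ind[unfolded lin_indep_def, rule_format, OF this, of n] have "c = 0" by simp
    then show ?thesis using that b'(1) by (simp add: comb_def lin_indep_def)
  qed
  have comb_diff: "comb s c - comb s' c' = comb (\<lambda>j. s j - s' j) (c - c')" for s c s' c'
    by (simp add: comb_def scaleR_left_diff_distrib sum_subtractf)
  have comb_scale: "r *\<^sub>R comb s c = comb (\<lambda>j. r * s j) (r * c)" for r s c
    by (simp add: comb_def scaleR_right_distrib scaleR_sum_right)
  have rep': "\<exists>s c. x = comb s c" if "x \<in> \<Lambda>" for x
  proof -
    obtain t where "x = (\<Sum>j<Suc n. t j *\<^sub>R b j)" using rep \<open>x \<in> \<Lambda>\<close> by blast
    then have "x = comb (\<lambda>i. \<Sum>j<n. t j * \<sigma> j i) (t n)" by (simp add: comb_def bb')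
    then show ?thesis by blast
  qed
  \<comment> \<open>Candidates for the minimal coefficient. The remaining coordinates are taken in
    the unit cube, which is possible modulo the sublattice and bounds the points; \<open>b n\<close>
    itself shows 1 \<in> C.\<close>
  define C where "C = {c. 0 < c \<and> c \<le> 1 \<and> (\<exists>s. (\<forall>j. s j \<in> {0..1}) \<and> comb s c \<in> \<Lambda>)}"
  have "1 \<in> C"
    using b[of n] by (auto simp: C_def comb_def intro!: exI[of _ "\<lambda>_. 0"])
  have "finite C"
  proof -
    define S where "S = {x \<in> \<Lambda>. \<exists>s c. (\<forall>j. s j \<in> {0..1}) \<and> c \<in> {0..1} \<and> x = comb s c}"
    have "continuous_on A (\<lambda>x :: (nat \<Rightarrow> real) \<times> real. fst x j)" for A j
      by (rule continuous_on_product_then_coordinatewise[OF continuous_on_fst[OF continuous_on_id]])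
    then have cont: "continuous_on A (\<lambda>(s, c). comb s c)" for A
      unfolding comb_def case_prod_unfold by (intro continuous_intros)
    have "compact ((\<lambda>(s, c). comb s c) ` ({s. \<forall>j. s j \<in> {0..1}} \<times> {0..1}))"
      by (intro compact_continuous_image cont compact_Times compact_fun) auto
    then have "finite S"
    proof (rule finite_separated[of _ _ \<delta>])
      show "S \<subseteq> (\<lambda>(s, c). comb s c) ` ({s. \<forall>j. s j \<in> {0..1}} \<times> {0..1})"
        unfolding S_def by (auto simp: image_iff Bex_def)
      show "\<delta> \<le> dist x y" if "x \<in> S" "y \<in> S" "x \<noteq> y" for x y
        using that \<delta>(2)[OF diff[of x y]] by (auto simp: S_def dist_norm)
    qed (use \<delta> in auto)
    obtain f where f: "\<And>c. c \<in> C \<Longrightarrow> (\<forall>j. f c j \<in> {0..1}) \<and> comb (f c) c \<in> \<Lambda>"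
    proof -
      have "\<forall>c\<in>C. \<exists>s. (\<forall>j. s j \<in> {0..1}) \<and> comb s c \<in> \<Lambda>" by (auto simp: C_def)
      from bchoice[OF this] show ?thesis using that by blast
    qed
    have "inj_on (\<lambda>c. comb (f c) c) C"
    proof (rule inj_onI)
      fix c d assume "comb (f c) c = comb (f d) d"
      then have "comb (\<lambda>j. f c j - f d j) (c - d) = 0" using comb_diff by (metis right_minus_eq)
      then show "c = d" using comb0 by fastforce
    qed
    moreover have "(\<lambda>c. comb (f c) c) ` C \<subseteq> S"
    proof clarify
      fix c assume c: "c \<in> C"
      then have "c \<in> {0..1}" by (simp add: C_def)
      then show "comb (f c) c \<in> S" using f[OF c] unfolding S_def by blast
    qed
    ultimately show ?thesis using \<open>finite S\<close> inj_on_finite by blast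
  qed
  define c0 where "c0 = Min C"
  have c0: "c0 \<in> C" "\<And>c. c \<in> C \<Longrightarrow> c0 \<le> c"
    unfolding c0_def using \<open>finite C\<close> \<open>1 \<in> C\<close> Min_in by auto
  then obtain s0 where s0: "comb s0 c0 \<in> \<Lambda>" and c0pos: "c0 > 0" by (auto simp: C_def)
  define w where "w = comb s0 c0"
  define b'' where "b'' j = (if j < n then b' j else w)" for j
  have b''sum: "(\<Sum>j<Suc n. t j *\<^sub>R b'' j) = comb (\<lambda>j. t j + t n * s0 j) (t n * c0)" for t
    by (simp add: b''_def comb_def w_def scaleR_left_distrib sum.distrib scaleR_right_distrib scaleR_sum_right)
  show ?case
  proof (intro exI[of _ b''] conjI allI impI ballI)
    show "lin_indep (Suc n) b''"
      unfolding lin_indep_def b''sum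
    proof (intro allI impI)
      fix t j assume 0: "comb (\<lambda>j. t j + t n * s0 j) (t n * c0) = 0" "j < Suc n"
      have "t n = 0" using comb0[OF 0(1)] c0pos by auto
      moreover have "\<forall>j<n. t j = 0" using comb0[OF 0(1)] \<open>t n = 0\<close> by auto
      ultimately show "t j = 0" using 0(2) less_Suc_eq by blast
    qed
    show "b'' j \<in> \<Lambda>" if "j < Suc n" for j
      using s0 b'\<Lambda> by (auto simp: b''_def w_def)
    fix x assume x: "x \<in> \<Lambda>"
    obtain s c where sc: "x = comb s c" using rep'[OF x] by blast
    \<comment> \<open>Division with remainder by the minimal coefficient c0. A nonzero remainder,
      with the other coordinates replaced by their fractional parts, would be a smaller element of
      C.\<close>
    define q where "q = \<lfloor>c / c0\<rfloor>"
    define r where "r = c - of_int q * c0"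
    have r: "0 \<le> r" "r < c0"
    proof -
      have "of_int q \<le> c / c0" "c / c0 < of_int q + 1" unfolding q_def by linarith+
      then show "0 \<le> r" "r < c0" using c0pos by (auto simp: r_def field_simps)
    qed
    define y where "y j = s j - of_int q * s0 j" for j
    define z where "z = x - of_int q *\<^sub>R w - (\<Sum>j<n. of_int \<lfloor>y j\<rfloor> *\<^sub>R b' j)"
    have z\<Lambda>: "z \<in> \<Lambda>" unfolding z_def
      using x s0 b'\<Lambda> by (intro diff zmult sums) (auto simp: w_def)
    have zc: "z = comb (\<lambda>j. frac (y j)) r"
    proof -
      have "z = comb y r - comb (\<lambda>j. of_int \<lfloor>y j\<rfloor>) 0"
      proof -
        have "comb y r = x - of_int q *\<^sub>R w"
          unfolding sc w_def comb_scale comb_diff by (simp add: y_def[abs_def] r_def)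
        then show ?thesis unfolding z_def by (simp add: comb_def)
      qed
      then show ?thesis unfolding comb_diff by (simp add: frac_def)
    qed
    have "r = 0"
    proof (rule ccontr)
      assume "r \<noteq> 0"
      then have "r \<in> C" using r z\<Lambda> c0 unfolding zc C_def
        by (auto intro!: exI[of _ "\<lambda>j. frac (y j)"] less_imp_le[OF frac_lt_1])
      then show False using c0(2) r by fastforce
    qed
    then have "z \<in> \<Lambda>'" using z\<Lambda> unfolding \<Lambda>'_def by (auto simp: zc comb_def b'b)
    then obtain m :: "nat \<Rightarrow> int" where m: "z = (\<Sum>j<n. of_int (m j) *\<^sub>R b' j)" using b'(3) by blast
    have "x = z + of_int q *\<^sub>R w + (\<Sum>j<n. of_int \<lfloor>y j\<rfloor> *\<^sub>R b' j)" by (simp add: z_def)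
    also have "\<dots> = (\<Sum>j<Suc n. of_int (if j < n then m j + \<lfloor>y j\<rfloor> else q) *\<^sub>R b'' j)"
      by (simp add: m b''_def scaleR_left_distrib sum.distrib)
    finally show "\<exists>m::nat \<Rightarrow> int. x = (\<Sum>j<Suc n. of_int (m j) *\<^sub>R b'' j)"
      by (rule exI[of _ "\<lambda>j. if j < n then m j + \<lfloor>y j\<rfloor> else q"])
  qed
qed

text \<open>A maximal independent family in the lattice spans it. If some x of the given span were
  missed, take a linear functional f that vanishes on the lattice with f x = 1: each multiple k x
  lies within R of a lattice point y, where f (k x - y) = k, against the bound on f. So the family
  has g members and \<open>lattice_basis\<close> applies.\<close>

lemma cocompact_lattice_basis:
  fixes \<Lambda> :: "'a::real_normed_vector set"
  assumes zero: "0 \<in> \<Lambda>" and diff: "\<And>x y. x \<in> \<Lambda> \<Longrightarrow> y \<in> \<Lambda> \<Longrightarrow> x - y \<in> \<Lambda>"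
    and \<delta>: "\<delta> > 0" "\<And>x. x \<in> \<Lambda> \<Longrightarrow> x \<noteq> 0 \<Longrightarrow> \<delta> \<le> norm x"
    and e: "lin_indep g e" and \<Lambda>W: "\<Lambda> \<subseteq> span (e ` {..<g})"
    and cob: "\<And>x. x \<in> span (e ` {..<g}) \<Longrightarrow> \<exists>y\<in>\<Lambda>. norm (x - y) \<le> R"
    and fun_bdd: "\<And>f :: 'a \<Rightarrow> real. linear f \<Longrightarrow> \<exists>C. \<forall>x\<in>span (e ` {..<g}). \<bar>f x\<bar> \<le> C * norm x"
  shows "\<exists>b. lin_indep g b \<and> (\<forall>j<g. b j \<in> \<Lambda>) \<and>
    (\<forall>x\<in>\<Lambda>. \<exists>m::nat \<Rightarrow> int. x = (\<Sum>j<g. of_int (m j) *\<^sub>R b j)) \<and>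
    (\<forall>x\<in>span (e ` {..<g}). \<exists>t. x = (\<Sum>j<g. t j *\<^sub>R b j))"
proof -
  let ?W = "span (e ` {..<g})"
  note e' = lin_indep_independent[OF e]
  have fam: "\<exists>t. x = (\<Sum>j<n. t j *\<^sub>R b j)" if b: "lin_indep n b" and x: "x \<in> span (b ` {..<n})"
    for n and b :: "nat \<Rightarrow> 'a" and x
  proof -
    obtain u where "x = (\<Sum>v\<in>b ` {..<n}. u v *\<^sub>R v)"
      using x span_finite[of "b ` {..<n}"] by auto
    then have "x = (\<Sum>j<n. u (b j) *\<^sub>R b j)"
      by (simp add: sum.reindex[OF lin_indep_independent(1)[OF b]])
    then show ?thesis by (rule exI[of _ "\<lambda>j. u (b j)"])
  qed
  define N where "N = {n. \<exists>b. lin_indep n b \<and> (\<forall>j<n. b j \<in> \<Lambda>)}"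
  have N_le: "n \<le> g" if "n \<in> N" for n
  proof -
    obtain b where b: "lin_indep n b" "\<forall>j<n. b j \<in> \<Lambda>" using \<open>n \<in> N\<close> by (auto simp: N_def)
    have "b ` {..<n} \<subseteq> ?W" using b \<Lambda>W by auto
    then have "card (b ` {..<n}) \<le> card (e ` {..<g})"
      using independent_span_bound[OF _ lin_indep_independent(2)[OF b(1)]] by blast
    then show ?thesis by (simp add: card_image lin_indep_independent(1)[OF b(1)] e')
  qed
  have "0 \<in> N" by (simp add: N_def lin_indep_def)
  define n where "n = Max N"
  have "finite N" using N_le finite_nat_set_iff_bounded_le by blast
  then have nN: "n \<in> N" and nmax: "\<And>m. m \<in> N \<Longrightarrow> m \<le> n"
    unfolding n_def using \<open>0 \<in> N\<close> Max_in by auto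
  obtain b where b: "lin_indep n b" "\<And>j. j < n \<Longrightarrow> b j \<in> \<Lambda>" using nN by (auto simp: N_def)
  let ?B = "b ` {..<n}"
  note b' = lin_indep_independent[OF b(1)]
  have \<Lambda>B: "\<Lambda> \<subseteq> span ?B"
  proof (rule subsetI, rule ccontr)
    fix x assume x: "x \<in> \<Lambda>" "x \<notin> span ?B"
    have "lin_indep (Suc n) (b(n := x))"
      unfolding lin_indep_def
    proof (intro allI impI)
      fix t j assume "(\<Sum>j<Suc n. t j *\<^sub>R (b(n := x)) j) = 0" and j: "j < Suc n"
      then have s: "(\<Sum>j<n. t j *\<^sub>R b j) + t n *\<^sub>R x = 0" by simp
      have "t n = 0"
      proof (rule ccontr)
        assume "t n \<noteq> 0"
        have "t n *\<^sub>R x = - (\<Sum>j<n. t j *\<^sub>R b j)" using s by (simp add: add_eq_0_iff2)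
        also have "\<dots> \<in> span ?B"
          by (intro span_neg span_sum span_scale span_base) auto
        finally have "t n *\<^sub>R x \<in> span ?B" .
        then have "(1 / t n) *\<^sub>R t n *\<^sub>R x \<in> span ?B" by (rule span_scale)
        then show False using x \<open>t n \<noteq> 0\<close> by simp
      qed
      then show "t j = 0" using s b(1) j by (auto simp: lin_indep_def less_Suc_eq)
    qed
    then have "Suc n \<in> N" unfolding N_def using b(2) x(1) by (auto simp: less_Suc_eq intro!: exI[of _ "b(n := x)"])
    then show False using nmax by fastforce
  qed
  have WB: "?W \<subseteq> span ?B"
  proof (rule subsetI, rule ccontr)
    fix x assume x: "x \<in> ?W" "x \<notin> span ?B"
    have "independent (insert x ?B)" using x b'(2) by (simp add: independent_insertI)
    from linear_independent_extend[OF this, of "\<lambda>y. if y = x then 1 else (0::real)"]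
    obtain f where f: "linear f" "\<And>y. y \<in> insert x ?B \<Longrightarrow> f y = (if y = x then 1 else (0::real))"
      by (elim exE conjE) (simp only:)
    have fB: "f y = 0" if "y \<in> span ?B" for y
    proof (rule linear_eq_0_on_span[OF f(1) _ that])
      fix z assume "z \<in> ?B"
      moreover from this have "z \<noteq> x" using x(2) span_base by metis
      ultimately show "f z = 0" using f(2)[of z] by simp
    qed
    have fx: "f x = 1" using f(2)[of x] by simp
    obtain C where C: "\<And>y. y \<in> ?W \<Longrightarrow> \<bar>f y\<bar> \<le> C * norm y" using fun_bdd[OF f(1)] by blast
    \<comment> \<open>One more than the bound for f on vectors of norm at most R.\<close>
    define k :: real where "k = \<bar>C\<bar> * \<bar>R\<bar> + 1"
    obtain y where y: "y \<in> \<Lambda>" "norm (k *\<^sub>R x - y) \<le> R" using cob[OF span_scale[OF x(1)], of k] by blast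
    have "k *\<^sub>R x - y \<in> ?W" using x(1) y(1) \<Lambda>W by (auto intro: span_diff span_scale)
    then have "\<bar>f (k *\<^sub>R x - y)\<bar> \<le> C * norm (k *\<^sub>R x - y)" by (rule C)
    also have "\<dots> \<le> \<bar>C\<bar> * \<bar>R\<bar>"
      using y(2) by (intro mult_mono) auto
    finally have "\<bar>f (k *\<^sub>R x - y)\<bar> \<le> \<bar>C\<bar> * \<bar>R\<bar>" .
    moreover have "f (k *\<^sub>R x - y) = k"
      using fB[of y] y(1) \<Lambda>B fx f(1) by (auto simp: linear_diff linear_scale)
    moreover have "\<bar>k\<bar> = k" unfolding k_def by simp
    ultimately show False by (simp add: k_def)
  qed
  have "card (e ` {..<g}) \<le> card ?B"
  proof -
    have "e ` {..<g} \<subseteq> span ?B" using WB span_superset[of "e ` {..<g}"] by (rule order_trans[rotated])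
    then show ?thesis using independent_span_bound[OF _ e'(2), of ?B] by simp
  qed
  then have "n = g" using N_le[OF nN] by (simp add: card_image b' e')
  have rep: "\<exists>t. x = (\<Sum>j<n. t j *\<^sub>R b j)" if "x \<in> \<Lambda>" for x
    using fam[OF b(1)] \<Lambda>B that by blast
  obtain b2 where b2: "lin_indep n b2" "\<forall>j<n. b2 j \<in> \<Lambda>"
    "\<forall>x\<in>\<Lambda>. \<exists>m::nat \<Rightarrow> int. x = (\<Sum>j<n. of_int (m j) *\<^sub>R b2 j)"
  proof -
    have "\<exists>b'. lin_indep n b' \<and> (\<forall>j<n. b' j \<in> \<Lambda>) \<and>
      (\<forall>x\<in>\<Lambda>. \<exists>m::nat \<Rightarrow> int. x = (\<Sum>j<n. of_int (m j) *\<^sub>R b' j))"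
      by (rule lattice_basis[of \<Lambda> \<delta> n b]) (use zero diff \<delta> b rep in auto)
    then show ?thesis using that by blast
  qed
  have "span ?B \<subseteq> span (b2 ` {..<n})"
  proof (rule span_minimal)
    show "?B \<subseteq> span (b2 ` {..<n})"
    proof clarify
      fix j assume "j < n"
      then obtain m :: "nat \<Rightarrow> int" where "b j = (\<Sum>j<n. of_int (m j) *\<^sub>R b2 j)" using b(2) b2(3) by blast
      moreover have "(\<Sum>j<n. of_int (m j) *\<^sub>R b2 j) \<in> span (b2 ` {..<n})"
        by (intro span_sum span_scale span_base) auto
      ultimately show "b j \<in> span (b2 ` {..<n})" by simp
    qed
  qed auto
  then show ?thesis using b2 fam[OF b2(1)] WB unfolding \<open>n = g\<close> by blast
qed

section \<open>Tori as orbits\<close>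

lemma C_k_cis: "C_k k U r \<Longrightarrow> C_k k U (\<lambda>x. cis (r x))"
proof (induction k arbitrary: r)
  case 0
  then show ?case by (auto intro: continuous_intros)
next
  case (Suc k)
  show ?case unfolding C_k.simps
  proof (intro conjI allI)
    show "continuous_on U (\<lambda>x. cis (r x))"
      using Suc.prems by (auto intro: continuous_intros)
    fix i v
    obtain r' where r': "C_k k U r'"
      "\<And>x. x \<in> U \<Longrightarrow> ((\<lambda>t. r (x(i := x i + t *\<^sub>R v))) has_vector_derivative r' x) (at 0)"
      using Suc.prems by (metis C_k.simps(2))
    have "C_k k U (\<lambda>x. r' x *\<^sub>R (\<i> * cis (r x)))"
      by (intro C_k_bilinear[OF bounded_bilinear_scaleR] r' C_k_bilinear[OF bounded_bilinear_mult]
          C_k_const Suc.IH C_k_SucD[OF Suc.prems])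
    moreover have "((\<lambda>t. cis (r (x(i := x i + t *\<^sub>R v)))) has_vector_derivative r' x *\<^sub>R (\<i> * cis (r x))) (at 0)"
      if "x \<in> U" for x
    proof -
      have "(cis has_vector_derivative \<i> * cis y) (at y within S)" for y S
        unfolding has_vector_derivative_def
        by (rule has_derivative_eq_rhs, rule has_derivative_cis[OF has_derivative_ident]) (auto simp: fun_eq_iff)
      then show ?thesis
        using vector_diff_chain_within[OF r'(2)[OF that], of cis "\<i> * cis (r x)"] by (simp add: o_def)
    qed
    ultimately show "\<exists>f'. C_k k U f' \<and>
        (\<forall>x\<in>U. ((\<lambda>t. cis (r (x(i := x i + t *\<^sub>R v)))) has_vector_derivative f' x) (at 0))"
      by blast
  qed
qed

lemma continuous_on_coordinate: "continuous_on U (\<lambda>x :: 'i \<Rightarrow> 'v::topological_space. x i)"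
  by (rule continuous_on_product_then_coordinatewise[OF continuous_on_id])

text \<open>The derivative of 1/z is polynomial in 1/z. This covers the angles on the torus, whose
  derivatives involve only the inverse of a coordinate.\<close>

lemma C_k_inverse_coordinate: "C_k k {z :: 'i \<Rightarrow> complex. z j \<noteq> 0} (\<lambda>z. inverse (z j))"
proof (induction k)
  case 0
  show ?case unfolding C_k.simps by (intro continuous_on_inverse continuous_on_coordinate) auto
next
  case (Suc k)
  show ?case
  proof (rule C_k_SucI)
    show "continuous_on {z :: 'i \<Rightarrow> complex. z j \<noteq> 0} (\<lambda>z. inverse (z j))"
      by (intro continuous_on_inverse continuous_on_coordinate) auto
    fix i v
    show "C_k k {z :: 'i \<Rightarrow> complex. z j \<noteq> 0} (\<lambda>z. (if i = j then - v else 0) * (inverse (z j) * inverse (z j)))"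
      by (intro C_k_bilinear[OF bounded_bilinear_mult] C_k_const Suc)
    fix z :: "'i \<Rightarrow> complex" assume z: "z \<in> {z. z j \<noteq> 0}"
    show "((\<lambda>t. inverse ((z(i := z i + t *\<^sub>R v)) j)) has_vector_derivative
        (if i = j then - v else 0) * (inverse (z j) * inverse (z j))) (at 0)"
    proof (cases "i = j")
      case True
      have "((\<lambda>t::real. z i + t *\<^sub>R v) has_vector_derivative v) (at 0)"
        by (auto intro!: derivative_eq_intros)
      moreover have "(inverse has_field_derivative - (inverse (z i) * inverse (z i))) (at (z i + 0 *\<^sub>R v))"
        using z True by (auto intro!: derivative_eq_intros simp: power2_eq_square)
      ultimately show ?thesis
        using field_vector_diff_chain_at[of "\<lambda>t::real. z i + t *\<^sub>R v" v 0 inverse "- (inverse (z i) * inverse (z i))"] True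
        by (simp add: o_def)
    qed auto
  qed
qed

lemma smooth_map_continuous:
  assumes "smooth_map X f"
  shows "continuous_on X f"
proof (rule continuous_on_coordinatewise_then_product)
  fix j
  show "continuous_on X (\<lambda>x. f x j)"
    unfolding continuous_on_def
  proof (rule ballI)
    fix x assume x: "x \<in> X"
    obtain U F where UF: "open U" "x \<in> U" "\<And>y. y \<in> X \<inter> U \<Longrightarrow> F y = f y"
      "\<And>j k. C_k k U (\<lambda>y. F y j)" using assms x unfolding smooth_map_def by metis
    have "((\<lambda>y. F y j) \<longlongrightarrow> F x j) (at x)"
      using C_k_continuous[OF UF(4)] UF(1,2) unfolding continuous_on_def by (metis at_within_open)
    then have "((\<lambda>y. F y j) \<longlongrightarrow> F x j) (at x within X)"
      by (rule tendsto_within_subset) auto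
    moreover have "\<forall>\<^sub>F y in at x within X. F y j = f y j"
      unfolding eventually_at_topological using UF by (intro exI[of _ U]) auto
    moreover have "F x j = f x j" using UF(2,3) x by auto
    ultimately show "((\<lambda>y. f y j) \<longlongrightarrow> f x j) (at x within X)"
      by (simp add: tendsto_cong)
  qed
qed

text \<open>A g-dimensional span acts inside a larger parameter space, and by \<open>V_\<pi>\<close>
  only the projection to that span is felt. \<open>chart\<close> holds both facts behind the orbit
  picture: the tangent map at p has a left inverse L on the span, so the action is locally free, and
  near p the points of \<open>M\<close> are separated by L, so orbits are open.\<close>

locale torus_flow = commuting_fields Q M
  for Q :: "'e::banach \<Rightarrow> 'e \<Rightarrow> ('p::banach \<Rightarrow>\<^sub>L 'e)" and M :: "'e set" +
  fixes g :: nat and e :: "nat \<Rightarrow> 'p" and \<pi> :: "'p \<Rightarrow>\<^sub>L 'p"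
  assumes compact_M: "compact M"
    and e: "lin_indep g e"
    and \<pi>: "\<And>v. \<pi> v \<in> span (e ` {..<g})" "\<And>v. v \<in> span (e ` {..<g}) \<Longrightarrow> \<pi> v = v"
    and functional_bounded: "\<And>f :: 'p \<Rightarrow> real. linear f \<Longrightarrow> \<exists>C. \<forall>x\<in>span (e ` {..<g}). \<bar>f x\<bar> \<le> C * norm x"
    and V_\<pi>: "\<And>v x. V (\<pi> v) x = V v x"
    and chart: "\<And>p. p \<in> M \<Longrightarrow> \<exists>(L :: 'e \<Rightarrow>\<^sub>L 'p) \<epsilon>. \<epsilon> > 0 \<and> (\<forall>v. L (V v p) = \<pi> v) \<and> (\<forall>x. \<pi> (L x) = L x) \<and>
       (\<forall>x\<in>M. \<forall>y\<in>M. dist x p < \<epsilon> \<longrightarrow> dist y p < \<epsilon> \<longrightarrow> L x = L y \<longrightarrow> x = y)"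
begin

abbreviation W :: "'p set" where "W \<equiv> span (e ` {..<g})"

lemma flow_\<pi>: "flow (\<pi> v) p = flow v p"
  unfolding flow_def is_sol_def V_\<pi> ..

lemma flow_chart:
  fixes l :: "('i \<Rightarrow> 'v::real_normed_vector) \<Rightarrow> 'e"
  assumes p: "p \<in> M" and contl: "continuous_on UNIV l"
    and l': "\<And>i v x t. l (x(i := x i + t *\<^sub>R v)) = l x + t *\<^sub>R l' i v"
  obtains \<delta> \<epsilon> H where "\<delta> > 0" "\<epsilon> > 0" "\<And>w. w \<in> W \<Longrightarrow> norm w < \<delta> \<Longrightarrow> H (flow w p) = w"
    "\<And>x. x \<in> M \<Longrightarrow> dist x p < \<epsilon> \<Longrightarrow> H x \<in> W"
    "\<And>x. x \<in> M \<Longrightarrow> dist x p < \<epsilon> \<Longrightarrow> norm (H x) < \<delta>"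
    "\<And>x. x \<in> M \<Longrightarrow> dist x p < \<epsilon> \<Longrightarrow> flow (H x) p = x"
    "\<And>k. C_k k {y. dist (l y) p < \<epsilon>} (\<lambda>y. H (l y))"
proof -
  obtain L \<epsilon>0 where L: "\<epsilon>0 > 0" "\<And>v. blinfun_apply L (V v p) = \<pi> v" "\<And>x. \<pi> (blinfun_apply L x) = L x"
    "\<And>x y. x \<in> M \<Longrightarrow> y \<in> M \<Longrightarrow> dist x p < \<epsilon>0 \<Longrightarrow> dist y p < \<epsilon>0 \<Longrightarrow> blinfun_apply L x = L y \<Longrightarrow> x = y"
    using chart[OF p] by (elim exE conjE) blast
  have "\<exists>\<delta>>0. \<exists>\<epsilon>>0. \<exists>H. (\<forall>w. \<pi> w = w \<longrightarrow> norm w < \<delta> \<longrightarrow> H (flow w p) = w) \<and>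
     (\<forall>x\<in>M. dist x p < \<epsilon> \<longrightarrow> \<pi> (H x) = H x \<and> norm (H x) < \<delta> \<and> flow (H x) p = x) \<and>
     (\<forall>(l :: ('i \<Rightarrow> 'v) \<Rightarrow> 'e) l'. continuous_on UNIV l \<longrightarrow>
        (\<forall>i v x t. l (x(i := x i + t *\<^sub>R v)) = l x + t *\<^sub>R l' i v) \<longrightarrow>
        (\<forall>k. C_k k {y. dist (l y) p < \<epsilon>} (\<lambda>y. H (l y))))"
    by (rule local_chart[OF p L(2,3) _ L(1,4)]) (use \<pi> in auto)
  then obtain \<delta> \<epsilon> H where H: "\<delta> > 0" "\<epsilon> > 0" "\<forall>w. \<pi> w = w \<longrightarrow> norm w < \<delta> \<longrightarrow> H (flow w p) = w"
     "\<forall>x\<in>M. dist x p < \<epsilon> \<longrightarrow> \<pi> (H x) = H x \<and> norm (H x) < \<delta> \<and> flow (H x) p = x"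
     "\<forall>(l :: ('i \<Rightarrow> 'v) \<Rightarrow> 'e) l'. continuous_on UNIV l \<longrightarrow>
        (\<forall>i v x t. l (x(i := x i + t *\<^sub>R v)) = l x + t *\<^sub>R l' i v) \<longrightarrow>
        (\<forall>k. C_k k {y. dist (l y) p < \<epsilon>} (\<lambda>y. H (l y)))" by (elim exE conjE)
  show ?thesis
  proof (rule that[of \<delta> \<epsilon> H])
    show "H x \<in> W" if "x \<in> M" "dist x p < \<epsilon>" for x using H(4) that \<pi>(1) by metis
    show "C_k k {y. dist (l y) p < \<epsilon>} (\<lambda>y. H (l y))" for k using H(5) contl l' by blast
  qed (use H \<pi> in auto)
qed

text \<open>A constant coordinate map serves where only the topology of the chart matters.\<close>

lemmas flow_chart_const = flow_chart[where l = "\<lambda>_ :: nat \<Rightarrow> real. 0" and l' = "\<lambda>_ _. 0",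
  OF _ continuous_on_const, simplified]

text \<open>A limit point of the orbit has a chart neighbourhood whose points of \<open>M\<close>
  lie on its own orbit. The given orbit meets this neighbourhood, so the two orbits coincide; the
  orbit is closed in the compact set \<open>M\<close>.\<close>

lemma orbit_compact:
  assumes p: "p \<in> M"
  shows "compact (range (\<lambda>v. flow v p))"
proof -
  let ?O = "\<lambda>p. range (\<lambda>v. flow v p)"
  have orb: "flow v x \<in> ?O p" if "x \<in> ?O p" for x v
    using that flow_add[OF p] by (auto intro: range_eqI[symmetric] simp: flow_add[OF p, symmetric])
  have OM: "?O p \<subseteq> M" using flow_in_M[OF p] by auto
  have "closed (?O p)"
    unfolding closed_limpt
  proof (intro allI impI)
    fix x assume x: "x islimpt ?O p"
    then have "x islimpt M" using OM islimpt_subset by blast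
    then have xM: "x \<in> M" using compact_imp_closed[OF compact_M] closed_limpt by blast
    obtain \<delta> \<epsilon> H where H: "\<epsilon> > 0" "\<And>y. y \<in> M \<Longrightarrow> dist y x < \<epsilon> \<Longrightarrow> flow (H y) x = y"
      by (rule flow_chart_const[OF xM]) blast
    obtain y where y: "y \<in> ?O p" "dist y x < \<epsilon>" using x H(1) unfolding islimpt_approachable by blast
    have yx: "flow (H y) x = y" using H(2) y OM by blast
    have "flow (- H y) y = x"
      using flow_add[OF xM, of "H y" "- H y"] by (simp add: yx flow_0[OF xM])
    then show "x \<in> ?O p" using orb[OF y(1), of "- H y"] by simp
  qed
  then show ?thesis using compact_M OM by (metis closed_Int_compact inf.absorb1)
qed

text \<open>Functionals dual to the basis, continued beyond the span by precomposition with \<pi>;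
  \<open>functional_bounded\<close> makes the result bounded on the whole space.\<close>

lemma coordinates:
  assumes b: "lin_indep g b" and bW: "\<And>j. j < g \<Longrightarrow> b j \<in> W"
    and rep: "\<And>x. x \<in> W \<Longrightarrow> \<exists>t. x = (\<Sum>j<g. t j *\<^sub>R b j)"
  shows "\<exists>\<tau>. (\<forall>j. bounded_linear (\<tau> j)) \<and> (\<forall>x\<in>W. x = (\<Sum>j<g. \<tau> j x *\<^sub>R b j)) \<and>
     (\<forall>t. \<forall>j<g. \<tau> j (\<Sum>i<g. t i *\<^sub>R b i) = (t j :: real))"
proof -
  have "\<exists>f :: 'p \<Rightarrow> real. linear f \<and> (\<forall>i<g. f (b i) = (if i = j then 1 else 0))" if "j < g" for j
  proof -
    from linear_independent_extend[OF lin_indep_independent(2)[OF b], of "\<lambda>x. if x = b j then 1 else (0::real)"]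
    obtain f :: "'p \<Rightarrow> real" where f: "linear f" "\<forall>x\<in>b ` {..<g}. f x = (if x = b j then 1 else 0)" by blast
    have "f (b i) = (if i = j then 1 else 0)" if "i < g" for i
      using f(2) inj_onD[OF lin_indep_independent(1)[OF b], of i j] that \<open>j < g\<close> by auto
    then show ?thesis using f(1) by blast
  qed
  then obtain f :: "nat \<Rightarrow> 'p \<Rightarrow> real" where f: "\<And>j. j < g \<Longrightarrow> linear (f j)"
    "\<And>j i. j < g \<Longrightarrow> i < g \<Longrightarrow> f j (b i) = (if i = j then 1 else 0)"
    by metis
  define \<tau> where "\<tau> j x = (if j < g then f j (\<pi> x) else 0)" for j x
  have bl: "bounded_linear (\<tau> j)" for j
  proof (cases "j < g")
    case True
    obtain C where C: "\<And>x. x \<in> W \<Longrightarrow> \<bar>f j x\<bar> \<le> C * norm x" using functional_bounded[OF f(1)[OF True]] by blast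
    have "norm (f j (\<pi> x)) \<le> norm x * (\<bar>C\<bar> * norm \<pi>)" for x
    proof -
      have "norm (f j (\<pi> x)) \<le> C * norm (\<pi> x)" using C[OF \<pi>(1)] by simp
      also have "\<dots> \<le> \<bar>C\<bar> * (norm \<pi> * norm x)" by (intro mult_mono norm_blinfun) auto
      finally show ?thesis by (simp add: mult_ac)
    qed
    then show ?thesis unfolding \<tau>_def using True f(1)[OF True]
      by (auto intro!: bounded_linear_intro[where K = "\<bar>C\<bar> * norm \<pi>"] simp: blinfun.add_right blinfun.scaleR_right linear_add linear_scale)
  qed (simp add: \<tau>_def[abs_def])
  have \<tau>t: "\<tau> j (\<Sum>i<g. t i *\<^sub>R b i) = t j" if j: "j < g" for t :: "nat \<Rightarrow> real" and j
  proof -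
    have "(\<Sum>i<g. t i *\<^sub>R b i) \<in> W" using bW by (intro span_sum span_scale) auto
    then have "\<tau> j (\<Sum>i<g. t i *\<^sub>R b i) = f j (\<Sum>i<g. t i *\<^sub>R b i)" using j by (simp add: \<tau>_def \<pi>(2))
    also have "\<dots> = (\<Sum>i<g. t i * (if i = j then 1 else 0))"
      using f j by (simp add: linear_sum linear_scale)
    also have "\<dots> = t j" using j by (simp add: if_distrib[of "\<lambda>r. _ * r"] cong: if_cong)
    finally show ?thesis .
  qed
  have "x = (\<Sum>j<g. \<tau> j x *\<^sub>R b j)" if "x \<in> W" for x
  proof -
    obtain t where t: "x = (\<Sum>j<g. t j *\<^sub>R b j)" using rep[OF \<open>x \<in> W\<close>] by blast
    show ?thesis by (subst t, intro sum.cong refl) (simp add: t \<tau>t)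
  qed
  then show ?thesis using bl \<tau>t by blast
qed

text \<open>The stabiliser of p is discrete because the chart is injective near 0, and cocompact
  because compactness of \<open>M\<close> bounds the parameters needed to reach any point. So it is
  a full lattice, and in the coordinates \<tau> of one of its bases it becomes the integer
  lattice.\<close>

lemma period_lattice:
  assumes p: "p \<in> M" and orbit: "\<And>x. x \<in> M \<Longrightarrow> \<exists>v. flow v p = x"
  shows "\<exists>b \<tau>. (\<forall>j<g. b j \<in> W) \<and> (\<forall>j. bounded_linear (\<tau> j)) \<and> (\<forall>x\<in>W. x = (\<Sum>j<g. \<tau> j x *\<^sub>R b j)) \<and>
     (\<forall>t. \<forall>j<g. \<tau> j (\<Sum>i<g. t i *\<^sub>R b i) = (t j :: real)) \<and>
     (\<forall>v\<in>W. \<forall>w\<in>W. flow v p = flow w p \<longleftrightarrow> (\<forall>j<g. \<tau> j v - \<tau> j w \<in> \<int>))"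
proof -
  define \<Lambda> where "\<Lambda> = {v \<in> W. flow v p = p}"
  have neg: "flow (- w) p = p" if "flow w p = p" for w
    using flow_add[OF p, of w "- w"] that flow_0[OF p] by simp
  have diff_iff: "flow v p = flow w p \<longleftrightarrow> flow (v - w) p = p" for v w
  proof
    assume "flow v p = flow w p"
    then have "flow (v + - w) p = flow (w + - w) p" by (simp only: flow_add[OF p])
    then show "flow (v - w) p = p" by (simp add: flow_0[OF p])
  next
    assume "flow (v - w) p = p"
    then have "flow ((v - w) + w) p = flow w p" by (simp only: flow_add[OF p])
    then show "flow v p = flow w p" by simp
  qed
  have diff: "x - y \<in> \<Lambda>" if "x \<in> \<Lambda>" "y \<in> \<Lambda>" for x y
    using that diff_iff[of x y] by (auto simp: \<Lambda>_def span_diff)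
  have zero: "0 \<in> \<Lambda>" by (simp add: \<Lambda>_def span_zero flow_0[OF p])
  obtain \<delta> H where \<delta>: "\<delta> > 0" "\<And>w. w \<in> W \<Longrightarrow> norm w < \<delta> \<Longrightarrow> H (flow w p) = w"
    by (rule flow_chart_const[OF p]) blast
  have disc: "\<delta> \<le> norm x" if "x \<in> \<Lambda>" "x \<noteq> 0" for x
  proof (rule ccontr)
    assume "\<not> \<delta> \<le> norm x"
    then have "H p = x" using \<delta>(2)[of x] that by (auto simp: \<Lambda>_def)
    moreover have "H p = 0" using \<delta>(2)[of 0] \<delta>(1) by (simp add: span_zero flow_0[OF p])
    ultimately show False using that by simp
  qed
  \<comment> \<open>Each point is reached by some parameter, and its chart reaches the neighbours
    with a bounded correction; finitely many charts cover \<open>M\<close>.\<close>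
  have "\<exists>R. \<forall>x\<in>M. \<exists>v\<in>W. norm v \<le> R \<and> flow v p = x"
  proof -
    have "\<exists>\<epsilon> r. \<epsilon> > 0 \<and> (\<forall>y\<in>M. dist y x < \<epsilon> \<longrightarrow> (\<exists>v\<in>W. norm v \<le> r \<and> flow v p = y))" if x: "x \<in> M" for x
    proof -
      obtain v where v: "flow v p = x" using orbit[OF x] by blast
      obtain \<delta> \<epsilon> H where H: "\<epsilon> > 0" "\<And>y. y \<in> M \<Longrightarrow> dist y x < \<epsilon> \<Longrightarrow> H y \<in> W"
        "\<And>y. y \<in> M \<Longrightarrow> dist y x < \<epsilon> \<Longrightarrow> norm (H y) < \<delta>" "\<And>y. y \<in> M \<Longrightarrow> dist y x < \<epsilon> \<Longrightarrow> flow (H y) x = y"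
        by (rule flow_chart_const[OF x]) blast
      have "\<exists>w\<in>W. norm w \<le> norm (\<pi> v) + \<delta> \<and> flow w p = y" if y: "y \<in> M" "dist y x < \<epsilon>" for y
      proof (intro bexI[of _ "\<pi> v + H y"] conjI)
        show "\<pi> v + H y \<in> W" using \<pi>(1) H(2)[OF y] by (rule span_add)
        show "norm (\<pi> v + H y) \<le> norm (\<pi> v) + \<delta>"
          using norm_triangle_ineq[of "\<pi> v" "H y"] H(3)[OF y] by simp
        show "flow (\<pi> v + H y) p = y" using H(4)[OF y] by (simp add: flow_add[OF p] flow_\<pi> v)
      qed
      then show ?thesis using H(1) by (intro exI[of _ \<epsilon>] exI[of _ "norm (\<pi> v) + \<delta>"]) blast
    qed
    then obtain \<epsilon> r where \<epsilon>: "\<And>x. x \<in> M \<Longrightarrow> \<epsilon> x > 0"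
      "\<And>x y. x \<in> M \<Longrightarrow> y \<in> M \<Longrightarrow> dist y x < \<epsilon> x \<Longrightarrow> (\<exists>v\<in>W. norm v \<le> r x \<and> flow v p = y)"
      by metis
    obtain C where C: "C \<subseteq> M" "finite C" "M \<subseteq> (\<Union>x\<in>C. ball x (\<epsilon> x))"
      by (rule compactE_image[OF compact_M, of M "\<lambda>x. ball x (\<epsilon> x)"]) (use \<epsilon>(1) in auto)
    show ?thesis
    proof (intro exI[of _ "\<Sum>x\<in>C. \<bar>r x\<bar>"] ballI)
      fix y assume y: "y \<in> M"
      then obtain x where x: "x \<in> C" "dist y x < \<epsilon> x" using C(3) by (auto simp: dist_commute)
      then obtain v where v: "v \<in> W" "norm v \<le> r x" "flow v p = y" using \<epsilon>(2)[of x y] C(1) y by blast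
      have "\<bar>r x\<bar> \<le> (\<Sum>x\<in>C. \<bar>r x\<bar>)" using x C(2) by (intro member_le_sum) auto
      then show "\<exists>v\<in>W. norm v \<le> (\<Sum>x\<in>C. \<bar>r x\<bar>) \<and> flow v p = y" using v by (intro bexI[of _ v]) auto
    qed
  qed
  then obtain R where R: "\<And>x. x \<in> M \<Longrightarrow> \<exists>v\<in>W. norm v \<le> R \<and> flow v p = x" by blast
  have cob: "\<exists>y\<in>\<Lambda>. norm (x - y) \<le> R" if "x \<in> W" for x
  proof -
    obtain v where v: "v \<in> W" "norm v \<le> R" "flow v p = flow x p" using R[OF flow_in_M[OF p]] by blast
    then have "x - v \<in> \<Lambda>" using diff_iff[of x v] that by (simp add: \<Lambda>_def span_diff)
    then show ?thesis using v(2) by (intro bexI[of _ "x - v"]) auto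
  qed
  have "\<exists>b. lin_indep g b \<and> (\<forall>j<g. b j \<in> \<Lambda>) \<and>
    (\<forall>x\<in>\<Lambda>. \<exists>m::nat \<Rightarrow> int. x = (\<Sum>j<g. of_int (m j) *\<^sub>R b j)) \<and>
    (\<forall>x\<in>W. \<exists>t. x = (\<Sum>j<g. t j *\<^sub>R b j))"
    by (rule cocompact_lattice_basis[OF zero diff \<delta>(1) disc e _ cob functional_bounded]) (auto simp: \<Lambda>_def)
  then obtain b where b: "lin_indep g b" "\<And>j. j < g \<Longrightarrow> b j \<in> \<Lambda>"
    "\<And>x. x \<in> \<Lambda> \<Longrightarrow> \<exists>m::nat \<Rightarrow> int. x = (\<Sum>j<g. of_int (m j) *\<^sub>R b j)"
    "\<And>x. x \<in> W \<Longrightarrow> \<exists>t. x = (\<Sum>j<g. t j *\<^sub>R b j)" by blast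
  have bW: "b j \<in> W" if "j < g" for j using b(2)[OF that] by (simp add: \<Lambda>_def)
  obtain \<tau> where \<tau>: "\<forall>j. bounded_linear (\<tau> j)" "\<forall>x\<in>W. x = (\<Sum>j<g. \<tau> j x *\<^sub>R b j)"
     "\<forall>t. \<forall>j<g. \<tau> j (\<Sum>i<g. t i *\<^sub>R b i) = (t j :: real)"
  proof -
    have "\<exists>\<tau>. (\<forall>j. bounded_linear (\<tau> j)) \<and> (\<forall>x\<in>W. x = (\<Sum>j<g. \<tau> j x *\<^sub>R b j)) \<and>
     (\<forall>t. \<forall>j<g. \<tau> j (\<Sum>i<g. t i *\<^sub>R b i) = (t j :: real))"
      by (rule coordinates[OF b(1)]) (use bW b(4) in auto)
    then show ?thesis using that by blast
  qed
  have minus: "- x \<in> \<Lambda>" if "x \<in> \<Lambda>" for x using diff[OF zero that] by simp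
  have add: "x + y \<in> \<Lambda>" if "x \<in> \<Lambda>" "y \<in> \<Lambda>" for x y using diff[OF that(1) minus[OF that(2)]] by simp
  have nmult: "of_nat k *\<^sub>R x \<in> \<Lambda>" if "x \<in> \<Lambda>" for x and k :: nat
    by (induction k) (auto simp: zero algebra_simps intro: add that)
  have zmult: "of_int k *\<^sub>R x \<in> \<Lambda>" if "x \<in> \<Lambda>" for x and k :: int
  proof (cases "k \<ge> 0")
    case True
    then show ?thesis using nmult[OF that, of "nat k"] by simp
  next
    case False
    then show ?thesis using minus[OF nmult[OF that, of "nat (- k)"]] by simp
  qed
  have sums: "(\<Sum>j\<in>A. f j) \<in> \<Lambda>" if "\<And>j. j \<in> A \<Longrightarrow> f j \<in> \<Lambda>" for A :: "nat set" and f
    using that by (induction A rule: infinite_finite_induct) (auto simp: zero intro: add)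
  have \<Lambda>_iff: "x \<in> \<Lambda> \<longleftrightarrow> (\<forall>j<g. \<tau> j x \<in> \<int>)" if x: "x \<in> W" for x
  proof
    assume "x \<in> \<Lambda>"
    then obtain m :: "nat \<Rightarrow> int" where m: "x = (\<Sum>j<g. of_int (m j) *\<^sub>R b j)" using b(3) by blast
    have "\<tau> j x = of_int (m j)" if "j < g" for j
      unfolding m using \<tau>(3)[rule_format, OF that, of "\<lambda>j. of_int (m j)"] .
    then show "\<forall>j<g. \<tau> j x \<in> \<int>" by simp
  next
    assume *: "\<forall>j<g. \<tau> j x \<in> \<int>"
    have "\<tau> j x *\<^sub>R b j \<in> \<Lambda>" if j: "j < g" for j
    proof -
      obtain k where "\<tau> j x = of_int k" using * j by (auto elim: Ints_cases)
      then show ?thesis using zmult[OF b(2)[OF j], of k] by simp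
    qed
    then have "(\<Sum>j<g. \<tau> j x *\<^sub>R b j) \<in> \<Lambda>" by (intro sums) auto
    then show "x \<in> \<Lambda>" using \<tau>(2) x by metis
  qed
  have "flow v p = flow w p \<longleftrightarrow> (\<forall>j<g. \<tau> j v - \<tau> j w \<in> \<int>)" if "v \<in> W" "w \<in> W" for v w
  proof -
    have "flow v p = flow w p \<longleftrightarrow> v - w \<in> \<Lambda>" using diff_iff that by (simp add: \<Lambda>_def span_diff)
    then show ?thesis using \<Lambda>_iff[of "v - w"] that \<tau>(1)
      by (simp add: span_diff bounded_linear.linear linear_diff)
  qed
  then show ?thesis using bW \<tau> by (intro exI[of _ b] exI[of _ \<tau>]) blast
qed

end

lemma C_k_coordinate_sum:
  fixes b :: "nat \<Rightarrow> 'p::real_normed_vector" and x :: "nat \<Rightarrow> real"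
  shows "((\<lambda>t. \<Sum>j<g. (x(i := x i + t *\<^sub>R v)) j *\<^sub>R b j) has_vector_derivative (if i < g then v *\<^sub>R b i else 0)) (at 0)"
proof -
  have "((\<lambda>t. \<Sum>j<g. (x(i := x i + t *\<^sub>R v)) j *\<^sub>R b j) has_vector_derivative (\<Sum>j<g. if j = i then v *\<^sub>R b j else 0)) (at 0)"
  proof (rule has_vector_derivative_sum)
    fix j
    show "((\<lambda>t. (x(i := x i + t *\<^sub>R v)) j *\<^sub>R b j) has_vector_derivative (if j = i then v *\<^sub>R b j else 0)) (at 0)"
    proof (cases "j = i")
      case True
      have "((\<lambda>t. (x i + t *\<^sub>R v) *\<^sub>R b i) has_vector_derivative v *\<^sub>R b i) (at 0)"
        by (auto intro!: derivative_eq_intros)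
      then show ?thesis using True by simp
    qed auto
  qed
  then show ?thesis by (simp add: sum.delta)
qed

context torus_flow
begin

text \<open>\<open>M\<close> lies in a normed space, the manifold in a product; \<open>l\<close> and
  \<open>emb\<close> translate. Since \<open>l\<close> is defined on the whole product and affine
  along coordinates, the chart composed with \<open>l\<close> is smooth on an ambient open set, as
  smoothness on a subset demands.\<close>

lemma orbit_manifold:
  fixes X :: "('i \<Rightarrow> 'v::real_normed_vector) set" and l :: "('i \<Rightarrow> 'v) \<Rightarrow> 'e" and emb :: "'e \<Rightarrow> 'i \<Rightarrow> 'v"
  assumes contl: "continuous_on UNIV l" and l': "\<And>i v x t. l (x(i := x i + t *\<^sub>R v)) = l x + t *\<^sub>R l' i v"
    and emb: "\<And>i. bounded_linear (\<lambda>x. emb x i)"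
    and X: "\<And>y. y \<in> X \<Longrightarrow> l y \<in> M" "\<And>y. y \<in> X \<Longrightarrow> emb (l y) = y"
      "\<And>x. x \<in> M \<Longrightarrow> emb x \<in> X" "\<And>x. x \<in> M \<Longrightarrow> l (emb x) = x"
  shows "smooth_manifold g X"
  unfolding smooth_manifold_def
proof
  fix q assume q: "q \<in> X"
  define p where "p = l q"
  have p: "p \<in> M" using X(1)[OF q] by (simp add: p_def)
  have eW: "e j \<in> W" if "j < g" for j using that by (auto intro: span_base)
  have "\<exists>t. x = (\<Sum>j<g. t j *\<^sub>R e j)" if "x \<in> W" for x
  proof -
    obtain u where "x = (\<Sum>v\<in>e ` {..<g}. u v *\<^sub>R v)"
      using \<open>x \<in> W\<close> span_finite[of "e ` {..<g}"] by auto
    then have "x = (\<Sum>j<g. u (e j) *\<^sub>R e j)"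
      by (simp add: sum.reindex[OF lin_indep_independent(1)[OF e]])
    then show ?thesis by (rule exI[of _ "\<lambda>j. u (e j)"])
  qed
  with eW have "\<exists>\<tau>. (\<forall>j. bounded_linear (\<tau> j)) \<and> (\<forall>x\<in>W. x = (\<Sum>j<g. \<tau> j x *\<^sub>R e j)) \<and>
     (\<forall>t. \<forall>j<g. \<tau> j (\<Sum>i<g. t i *\<^sub>R e i) = (t j :: real))"
    by (intro coordinates[OF e]) auto
  then obtain \<tau> where \<tau>: "\<And>j. bounded_linear (\<tau> j)" "\<And>x. x \<in> W \<Longrightarrow> (\<Sum>j<g. \<tau> j x *\<^sub>R e j) = x"
     "\<And>t j. j < g \<Longrightarrow> \<tau> j (\<Sum>i<g. t i *\<^sub>R e i) = (t j :: real)" by metis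
  obtain \<delta> \<epsilon> H where H: "\<delta> > 0" "\<epsilon> > 0" "\<And>w. w \<in> W \<Longrightarrow> norm w < \<delta> \<Longrightarrow> H (flow w p) = w"
    "\<And>x. x \<in> M \<Longrightarrow> dist x p < \<epsilon> \<Longrightarrow> H x \<in> W"
    "\<And>x. x \<in> M \<Longrightarrow> dist x p < \<epsilon> \<Longrightarrow> norm (H x) < \<delta>"
    "\<And>x. x \<in> M \<Longrightarrow> dist x p < \<epsilon> \<Longrightarrow> flow (H x) p = x"
    "\<And>k. C_k k {y. dist (l y) p < \<epsilon>} (\<lambda>y. H (l y))"
    by (rule flow_chart[OF p contl l']) blast
  have opU: "open {y. dist (l y) p < \<epsilon>}"
    by (intro open_Collect_less continuous_on_dist contl continuous_on_const)
  define w where "w x = (\<Sum>j<g. x j *\<^sub>R e j)" for x :: "nat \<Rightarrow> real"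
  have wW: "w x \<in> W" for x unfolding w_def using eW by (intro span_sum span_scale) auto
  have contw: "continuous_on UNIV w"
    unfolding w_def by (intro continuous_intros continuous_on_coordinate)
  have Ck_w: "C_k k UNIV (\<lambda>x. flow (w x) p)" for k
  proof (rule flow_C_k[OF p contw, where u' = "\<lambda>i v x. if i < g then v *\<^sub>R e i else 0"])
    show "C_k k UNIV (\<lambda>x. if i < g then v *\<^sub>R e i else 0)" for i v k by (rule C_k_const)
  qed (unfold w_def, rule C_k_coordinate_sum)
  define N where "N = {y \<in> X. dist (l y) p < \<epsilon>}"
  \<comment> \<open>The carrier of \<open>Euclidean_space g\<close>: sequences that vanish from
    index g on.\<close>
  define E where "E = {x :: nat \<Rightarrow> real. \<forall>i\<ge>g. x i = 0}"
  define Z where "Z = {x \<in> E. norm (w x) < \<delta> \<and> dist (flow (w x) p) p < \<epsilon>}"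
  define \<phi> where "\<phi> y = (\<lambda>j. if j < g then \<tau> j (H (l y)) else 0)" for y
  define \<psi> where "\<psi> x = emb (flow (w x) p)" for x
  have N\<phi>: "w (\<phi> y) = H (l y)" if "y \<in> N" for y
    unfolding w_def \<phi>_def using \<tau>(2)[OF H(4)[OF X(1), of y]] that by (simp add: N_def)
  have \<psi>\<phi>: "\<psi> (\<phi> y) = y" if "y \<in> N" for y
    unfolding \<psi>_def N\<phi>[OF that] using that H(6)[OF X(1), of y] X(2) by (simp add: N_def)
  have \<phi>Z: "\<phi> y \<in> Z" if "y \<in> N" for y
    using that H(5)[OF X(1), of y] H(6)[OF X(1), of y] unfolding Z_def mem_Collect_eq N\<phi>[OF that]
    by (auto simp: E_def \<phi>_def N_def)
  have \<psi>N: "\<psi> x \<in> N" if "x \<in> Z" for x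
    using that X(3,4)[OF flow_in_M[OF p]] by (simp add: N_def Z_def \<psi>_def)
  have \<phi>\<psi>: "\<phi> (\<psi> x) = x" if "x \<in> Z" for x
  proof
    fix j
    have "\<phi> (\<psi> x) j = (if j < g then \<tau> j (w x) else 0)"
      using that X(4)[OF flow_in_M[OF p]] H(3)[OF wW] by (simp add: Z_def \<psi>_def \<phi>_def)
    then show "\<phi> (\<psi> x) j = x j" using \<tau>(3)[of j x] that by (auto simp: w_def Z_def E_def)
  qed
  have sm1: "smooth_map N \<phi>"
    unfolding smooth_map_def
  proof
    fix x assume "x \<in> N"
    show "\<exists>U F. open U \<and> x \<in> U \<and> (\<forall>y\<in>N \<inter> U. F y = \<phi> y) \<and> (\<forall>j k. C_k k U (\<lambda>y. F y j))"
    proof (intro exI conjI allI)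
      show "open {y. dist (l y) p < \<epsilon>}" by (rule opU)
      show "x \<in> {y. dist (l y) p < \<epsilon>}" using \<open>x \<in> N\<close> by (simp add: N_def)
      show "\<forall>y\<in>N \<inter> {y. dist (l y) p < \<epsilon>}. \<phi> y = \<phi> y" by simp
      show "C_k k {y. dist (l y) p < \<epsilon>} (\<lambda>y. \<phi> y j)" for j k
        unfolding \<phi>_def by (cases "j < g") (auto intro: C_k_const C_k_bounded_linear[OF \<tau>(1) H(7)])
    qed
  qed
  have sm2: "smooth_map Z \<psi>"
    unfolding smooth_map_def
  proof
    fix x assume "x \<in> Z"
    show "\<exists>U F. open U \<and> x \<in> U \<and> (\<forall>y\<in>Z \<inter> U. F y = \<psi> y) \<and> (\<forall>j k. C_k k U (\<lambda>y. F y j))"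
      by (rule exI[of _ UNIV], rule exI[of _ \<psi>]) (auto simp: \<psi>_def intro!: C_k_bounded_linear[OF emb Ck_w])
  qed
  have "homeomorphism N Z \<phi> \<psi>"
    unfolding homeomorphism_def
    using smooth_map_continuous[OF sm1] smooth_map_continuous[OF sm2] \<phi>\<psi> \<psi>\<phi> \<phi>Z \<psi>N
    by (auto simp: image_iff) (metis, metis)
  then have "diffeomorphic N Z" unfolding diffeomorphic_def using sm1 sm2 by blast
  moreover have "openin (top_of_set X) N"
    unfolding openin_open using opU by (intro exI[of _ "{y. dist (l y) p < \<epsilon>}"]) (auto simp: N_def)
  moreover have "q \<in> N" using q H(2) by (simp add: N_def p_def)
  moreover have "openin (Euclidean_space g) Z"
  proof -
    have "open {x. norm (w x) < \<delta> \<and> dist (flow (w x) p) p < \<epsilon>}"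
      by (intro open_Collect_conj open_Collect_less continuous_on_dist continuous_on_norm contw continuous_on_const
         continuous_on_compose2[OF continuous_flow[OF p] contw]) auto
    then show ?thesis
      unfolding Euclidean_space_def euclidean_product_topology openin_open
      by (intro exI[of _ "{x. norm (w x) < \<delta> \<and> dist (flow (w x) p) p < \<epsilon>}"]) (auto simp: Z_def E_def)
  qed
  ultimately show "\<exists>Wa Z. openin (top_of_set X) Wa \<and> q \<in> Wa \<and> openin (Euclidean_space g) Z \<and> diffeomorphic Wa Z"
    by blast
qed

lemma orbit_torus:
  fixes X :: "('i \<Rightarrow> 'v::real_normed_vector) set" and l :: "('i \<Rightarrow> 'v) \<Rightarrow> 'e" and emb :: "'e \<Rightarrow> 'i \<Rightarrow> 'v"
  assumes p: "p \<in> M" and orbit: "\<And>x. x \<in> M \<Longrightarrow> \<exists>v. flow v p = x"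
    and contl: "continuous_on UNIV l" and l': "\<And>i v x t. l (x(i := x i + t *\<^sub>R v)) = l x + t *\<^sub>R l' i v"
    and emb: "\<And>i. bounded_linear (\<lambda>x. emb x i)"
    and X: "\<And>y. y \<in> X \<Longrightarrow> l y \<in> M" "\<And>y. y \<in> X \<Longrightarrow> emb (l y) = y"
      "\<And>x. x \<in> M \<Longrightarrow> emb x \<in> X" "\<And>x. x \<in> M \<Longrightarrow> l (emb x) = x"
  shows "diffeomorphic X (torus g)"
proof -
  obtain b \<tau> where b0: "\<forall>j<g. b j \<in> W" and \<tau>0: "\<forall>j. bounded_linear (\<tau> j)"
     "\<forall>x\<in>W. x = (\<Sum>j<g. \<tau> j x *\<^sub>R b j)" "\<forall>t. \<forall>j<g. \<tau> j (\<Sum>i<g. t i *\<^sub>R b i) = (t j :: real)"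
     "\<forall>v\<in>W. \<forall>w\<in>W. flow v p = flow w p \<longleftrightarrow> (\<forall>j<g. \<tau> j v - \<tau> j w \<in> \<int>)"
    using period_lattice[OF p] orbit by blast
  have b: "\<And>j. j < g \<Longrightarrow> b j \<in> W" using b0 by blast
  have \<tau>: "\<And>j. bounded_linear (\<tau> j)"
     "\<And>x. x \<in> W \<Longrightarrow> (\<Sum>j<g. \<tau> j x *\<^sub>R b j) = x"
     "\<And>t j. j < g \<Longrightarrow> \<tau> j (\<Sum>i<g. t i *\<^sub>R b i) = (t j :: real)"
     "\<And>v w. v \<in> W \<Longrightarrow> w \<in> W \<Longrightarrow> flow v p = flow w p \<longleftrightarrow> (\<forall>j<g. \<tau> j v - \<tau> j w \<in> \<int>)"
    using \<tau>0(1,3,4) \<tau>0(2)[rule_format, symmetric] by blast+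
  have cis_int: "cis (2 * pi * s) = cis (2 * pi * t) \<longleftrightarrow> s - t \<in> \<int>" for s t
  proof -
    have "cis (2 * pi * s) = cis (2 * pi * t) \<longleftrightarrow> (\<exists>n::int. 2 * pi * s = 2 * pi * t + 2 * pi * of_int n)"
      by (auto simp: complex_eq_iff sin_cos_eq_iff[symmetric])
    also have "\<dots> \<longleftrightarrow> (\<exists>n::int. s - t = of_int n)"
    proof (intro ex_cong1)
      fix n :: int
      have "2 * pi * s = 2 * pi * t + 2 * pi * of_int n \<longleftrightarrow> 2 * pi * (s - t - of_int n) = 0"
        by (simp add: algebra_simps)
      then show "2 * pi * s = 2 * pi * t + 2 * pi * of_int n \<longleftrightarrow> s - t = of_int n" by auto
    qed
    finally show ?thesis by (auto simp: Ints_def)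
  qed
  \<comment> \<open>The angles are the coordinates of any parameter that leads to the point; two
    choices differ by integers, which \<open>cis\<close> forgets. The value \<open>undefined\<close>
    beyond g is forced by the extensional product in \<open>torus\<close>.\<close>
  define f where "f y = (\<lambda>j. if j < g then cis (2 * pi * \<tau> j (SOME v. v \<in> W \<and> flow v p = l y)) else undefined)" for y
  have f: "f y = (\<lambda>j. if j < g then cis (2 * pi * \<tau> j v) else undefined)" if "v \<in> W" "flow v p = l y" for v y
  proof -
    have "(SOME v. v \<in> W \<and> flow v p = l y) \<in> W \<and> flow (SOME v. v \<in> W \<and> flow v p = l y) p = l y"
      using that by (intro someI_ex[of "\<lambda>v. v \<in> W \<and> flow v p = l y"]) auto
    then have "\<forall>j<g. \<tau> j (SOME v. v \<in> W \<and> flow v p = l y) - \<tau> j v \<in> \<int>"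
      using that \<tau>(4) by metis
    then show ?thesis unfolding f_def by (auto simp: cis_int fun_eq_iff)
  qed
  define comb where "comb t = (\<Sum>j<g. t j *\<^sub>R b j)" for t :: "nat \<Rightarrow> real"
  have combW: "comb t \<in> W" for t unfolding comb_def using b by (intro span_sum span_scale) auto
  \<comment> \<open>\<open>Arg\<close> is discontinuous, but the next fact replaces it by any other
    choice of angles, so a branch adapted to each base point can be used.\<close>
  define h where "h z = emb (flow (comb (\<lambda>j. Arg (z j) / (2 * pi))) p)" for z :: "nat \<Rightarrow> complex"
  have h: "h z = emb (flow (comb t) p)" if "\<And>j. j < g \<Longrightarrow> cis (2 * pi * t j) = z j" for z t
  proof -
    have "flow (comb (\<lambda>j. Arg (z j) / (2 * pi))) p = flow (comb t) p"
      unfolding \<tau>(4)[OF combW combW]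
    proof (intro allI impI)
      fix j assume j: "j < g"
      have "norm (z j) = 1" using that[OF j] by (metis norm_cis)
      then have "cis (2 * pi * (Arg (z j) / (2 * pi))) = cis (2 * pi * t j)"
        using that[OF j] cis_Arg[of "z j"] by (fastforce simp: sgn_eq)
      then show "\<tau> j (comb (\<lambda>j. Arg (z j) / (2 * pi))) - \<tau> j (comb t) \<in> \<int>"
        unfolding cis_int by (simp add: comb_def \<tau>(3)[OF j])
    qed
    then show ?thesis by (simp add: h_def)
  qed
  have f_torus: "f y \<in> torus g" if "y \<in> X" for y
    unfolding torus_def f_def by (auto simp: PiE_iff extensional_def)
  have h_X: "h z \<in> X" for z unfolding h_def by (intro X flow_in_M[OF p])
  have fh: "f (h z) = z" if z: "z \<in> torus g" for z
  proof -
    have "f (h z) = (\<lambda>j. if j < g then cis (2 * pi * \<tau> j (comb (\<lambda>j. Arg (z j) / (2 * pi)))) else undefined)"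
      by (rule f[OF combW]) (simp add: h_def X(4)[OF flow_in_M[OF p]])
    also have "\<dots> = z"
    proof
      fix j
      show "(if j < g then cis (2 * pi * \<tau> j (comb (\<lambda>j. Arg (z j) / (2 * pi)))) else undefined) = z j"
      proof (cases "j < g")
        case True
        then have "norm (z j) = 1" using z by (auto simp: torus_def PiE_iff)
        moreover from this have "cis (Arg (z j)) = z j" using cis_Arg[of "z j"] by (fastforce simp: sgn_eq)
        ultimately show ?thesis using True by (simp add: comb_def \<tau>(3))
      next
        case False
        then show ?thesis using z by (auto simp: torus_def PiE_iff extensional_def)
      qed
    qed
    finally show ?thesis .
  qed
  have exW: "\<exists>v\<in>W. flow v p = x" if "x \<in> M" for x
    using orbit[OF that] flow_\<pi> \<pi>(1) by metis
  have hf: "h (f y) = y" if y: "y \<in> X" for y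
  proof -
    obtain v where v: "v \<in> W" "flow v p = l y" using exW[OF X(1)[OF y]] by blast
    have "h (f y) = emb (flow (comb (\<lambda>j. \<tau> j v)) p)"
      by (rule h) (simp add: f[OF v])
    then show ?thesis using v X(2)[OF y] \<tau>(2)[OF v(1)] by (simp add: comb_def)
  qed
  have sm_f: "smooth_map X f"
    unfolding smooth_map_def
  proof
    fix q assume q: "q \<in> X"
    define r where "r = l q"
    have r: "r \<in> M" using X(1)[OF q] by (simp add: r_def)
    obtain v0 where v0: "v0 \<in> W" "flow v0 p = r" using exW[OF r] by blast
    obtain \<epsilon> H where H: "\<epsilon> > 0" "\<And>x. x \<in> M \<Longrightarrow> dist x r < \<epsilon> \<Longrightarrow> H x \<in> W"
      "\<And>x. x \<in> M \<Longrightarrow> dist x r < \<epsilon> \<Longrightarrow> flow (H x) r = x"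
      "\<And>k. C_k k {y. dist (l y) r < \<epsilon>} (\<lambda>y. H (l y))"
      by (rule flow_chart[OF r contl l']) blast
    \<comment> \<open>A smooth local choice of the parameter: v0 leads from p to the base point, and
      H from there to the neighbours.\<close>
    define F where "F y = (\<lambda>j. if j < g then cis (2 * pi * \<tau> j (v0 + H (l y))) else undefined)" for y
    show "\<exists>U F. open U \<and> q \<in> U \<and> (\<forall>y\<in>X \<inter> U. F y = f y) \<and> (\<forall>j k. C_k k U (\<lambda>y. F y j))"
    proof (intro exI conjI allI)
      show "open {y. dist (l y) r < \<epsilon>}"
        by (intro open_Collect_less continuous_on_dist contl continuous_on_const)
      show "q \<in> {y. dist (l y) r < \<epsilon>}" using H(1) by (simp add: r_def)
      show "\<forall>y\<in>X \<inter> {y. dist (l y) r < \<epsilon>}. F y = f y"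
      proof
        fix y assume y: "y \<in> X \<inter> {y. dist (l y) r < \<epsilon>}"
        then have "flow (v0 + H (l y)) p = l y" "v0 + H (l y) \<in> W"
          using H(2,3) X(1) v0 by (auto simp: flow_add[OF p] intro: span_add)
        then show "F y = f y" by (simp add: f F_def)
      qed
      show "C_k k {y. dist (l y) r < \<epsilon>} (\<lambda>y. F y j)" for j k
      proof (cases "j < g")
        case True
        have "bounded_linear (\<lambda>v. 2 * pi * \<tau> j v)"
          by (intro bounded_linear_const_mult \<tau>(1))
        then have "C_k k {y. dist (l y) r < \<epsilon>} (\<lambda>y. cis (2 * pi * \<tau> j (v0 + H (l y))))"
          by (intro C_k_cis C_k_bounded_linear[where T = "\<lambda>v. 2 * pi * \<tau> j v"] C_k_add C_k_const H(4))
        then show ?thesis using True by (simp add: F_def)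
      qed (simp add: F_def C_k_const)
    qed
  qed
  have sm_h: "smooth_map (torus g) h"
    unfolding smooth_map_def
  proof
    fix z0 assume z0: "z0 \<in> torus g"
    have n0: "norm (z0 j) = 1" if "j < g" for j using z0 that by (auto simp: torus_def PiE_iff)
    then have z0nz: "z0 j \<noteq> 0" if "j < g" for j using that by fastforce
    \<comment> \<open>Near z0 the quotients z j / z0 j avoid the branch cut of \<open>Ln\<close>, so
      the angles relative to those of z0 are smooth.\<close>
    define U where "U = (\<Inter>j\<in>{..<g}. (\<lambda>z. z j / z0 j) -` (- \<real>\<^sub>\<le>\<^sub>0))"
    have opU: "open U"
      unfolding U_def
    proof (intro open_INT ballI)
      fix j assume "j \<in> {..<g}"
      then have "continuous_on UNIV (\<lambda>z. z j / z0 j)"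
        using z0nz by (intro continuous_on_divide continuous_on_coordinate continuous_on_const) auto
      then show "open ((\<lambda>z. z j / z0 j) -` (- \<real>\<^sub>\<le>\<^sub>0))"
        by (intro open_vimage) auto
    qed simp
    have Unz: "z j \<noteq> 0" if "z \<in> U" "j < g" for z j
    proof
      assume "z j = 0"
      moreover have "z j / z0 j \<notin> \<real>\<^sub>\<le>\<^sub>0" using that by (auto simp: U_def)
      ultimately show False by simp
    qed
    have ULn: "z j / z0 j \<notin> \<real>\<^sub>\<le>\<^sub>0" if "z \<in> U" "j < g" for z j
      using that by (auto simp: U_def)
    define \<theta> where "\<theta> z j = (Arg (z0 j) + Im (Ln (z j / z0 j))) / (2 * pi)" for z :: "nat \<Rightarrow> complex" and j
    define u where "u z = comb (\<theta> z)" for z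
    define u' where "u' i v z = (if i < g then (Im (v * inverse (z i)) / (2 * pi)) *\<^sub>R b i else 0)"
      for i v and z :: "nat \<Rightarrow> complex"
    have contu: "continuous_on U u"
      unfolding u_def comb_def \<theta>_def
    proof (intro continuous_on_sum continuous_on_scaleR continuous_on_const continuous_on_divide continuous_on_add continuous_on_Im)
      fix j assume j: "j \<in> {..<g}"
      show "continuous_on U (\<lambda>z. Ln (z j / z0 j))"
        using j z0nz ULn by (intro continuous_on_Ln' continuous_on_divide continuous_on_coordinate continuous_on_const) auto
    qed auto
    have Ck_u': "C_k k U (u' i v)" for i v k
    proof (cases "i < g")
      case True
      have "C_k k U (\<lambda>z. inverse (z i))"
        by (rule C_k_subset[OF C_k_inverse_coordinate]) (use Unz True in auto)
      moreover have "bounded_linear (\<lambda>w. (Im (v * w) / (2 * pi)) *\<^sub>R b i)"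
        by (intro bounded_linear_scaleR_const bounded_linear_divide[THEN bounded_linear_compose] bounded_linear_compose[OF bounded_linear_Im] bounded_linear_mult_right)
      ultimately have "C_k k U (\<lambda>z. (Im (v * inverse (z i)) / (2 * pi)) *\<^sub>R b i)"
        using C_k_bounded_linear by blast
      then show ?thesis unfolding u'_def using True by (simp only: if_True)
    qed (simp add: u'_def[abs_def] C_k_const)
    have du: "((\<lambda>t. u (z(i := z i + t *\<^sub>R v))) has_vector_derivative u' i v z) (at 0)" if z: "z \<in> U" for i v z
    proof -
      have "((\<lambda>t. \<Sum>j<g. \<theta> (z(i := z i + t *\<^sub>R v)) j *\<^sub>R b j) has_vector_derivative
          (\<Sum>j<g. if j = i then (Im (v * inverse (z j)) / (2 * pi)) *\<^sub>R b j else 0)) (at 0)"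
      proof (rule has_vector_derivative_sum)
        fix j assume j: "j \<in> {..<g}"
        show "((\<lambda>t. \<theta> (z(i := z i + t *\<^sub>R v)) j *\<^sub>R b j) has_vector_derivative
          (if j = i then (Im (v * inverse (z j)) / (2 * pi)) *\<^sub>R b j else 0)) (at 0)"
        proof (cases "j = i")
          case True
          have "((\<lambda>t. (z i + t *\<^sub>R v) / z0 i) has_vector_derivative v / z0 i) (at 0)"
            by (auto intro!: derivative_eq_intros)
          moreover have "(Ln has_field_derivative inverse (z i / z0 i)) (at ((z i + 0 *\<^sub>R v) / z0 i))"
            using has_field_derivative_Ln[of "z i / z0 i"] ULn[OF z, of i] j True by simp
          ultimately have "((\<lambda>t. Ln ((z i + t *\<^sub>R v) / z0 i)) has_vector_derivative v / z0 i * inverse (z i / z0 i)) (at 0)"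
            using field_vector_diff_chain_at[of "\<lambda>t::real. (z i + t *\<^sub>R v) / z0 i" "v / z0 i" 0 Ln "inverse (z i / z0 i)"]
            by (simp add: o_def)
          also have "v / z0 i * inverse (z i / z0 i) = v * inverse (z i)"
            using z0nz[of i] j True by (simp add: divide_simps)
          finally have 1: "((\<lambda>t. Ln ((z i + t *\<^sub>R v) / z0 i)) has_vector_derivative v * inverse (z i)) (at 0)" .
          have bl: "bounded_linear (\<lambda>w. (Im w / (2 * pi)) *\<^sub>R b i)"
            by (intro bounded_linear_scaleR_const bounded_linear_divide[THEN bounded_linear_compose] bounded_linear_Im)
          have "((\<lambda>t. (Arg (z0 i) / (2 * pi)) *\<^sub>R b i + (Im (Ln ((z i + t *\<^sub>R v) / z0 i)) / (2 * pi)) *\<^sub>R b i)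
            has_vector_derivative 0 + (Im (v * inverse (z i)) / (2 * pi)) *\<^sub>R b i) (at 0)"
            by (intro has_vector_derivative_add has_vector_derivative_const bounded_linear.has_vector_derivative[OF bl 1])
          then show ?thesis using True by (simp add: \<theta>_def scaleR_left_distrib[symmetric] add_divide_distrib)
        next
          case False
          then show ?thesis by (simp add: \<theta>_def)
        qed
      qed
      then show ?thesis by (simp add: u_def comb_def u'_def sum.delta)
    qed
    show "\<exists>U F. open U \<and> z0 \<in> U \<and> (\<forall>z\<in>torus g \<inter> U. F z = h z) \<and> (\<forall>j k. C_k k U (\<lambda>y. F y j))"
    proof (intro exI conjI allI)
      show "open U" by (rule opU)
      show "z0 \<in> U" using z0nz by (auto simp: U_def)
      show "\<forall>z\<in>torus g \<inter> U. emb (flow (u z) p) = h z"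
      proof
        fix z assume z: "z \<in> torus g \<inter> U"
        have "h z = emb (flow (comb (\<theta> z)) p)"
        proof (rule h)
          fix j assume j: "j < g"
          have "norm (z j) = 1" using z j by (auto simp: torus_def PiE_iff)
          then have nz: "norm (z j / z0 j) = 1" using n0[OF j] by (simp add: norm_divide)
          have "cis (2 * pi * \<theta> z j) = cis (Arg (z0 j)) * cis (Im (Ln (z j / z0 j)))"
            by (simp add: \<theta>_def cis_mult)
          also have "cis (Arg (z0 j)) = z0 j" using z0nz[OF j] n0[OF j] by (simp add: cis_Arg sgn_eq)
          also have "cis (Im (Ln (z j / z0 j))) = z j / z0 j"
          proof -
            have "z j / z0 j \<noteq> 0" using nz by fastforce
            then have "exp (Ln (z j / z0 j)) = z j / z0 j" by simp
            then show ?thesis using nz \<open>z j / z0 j \<noteq> 0\<close> by (simp add: exp_eq_polar[of "Ln _"])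
          qed
          finally show "cis (2 * pi * \<theta> z j) = z j" using z0nz[OF j] by simp
        qed
        then show "emb (flow (u z) p) = h z" by (simp add: u_def)
      qed
      show "C_k k U (\<lambda>z. emb (flow (u z) p) j)" for j k
        by (intro C_k_bounded_linear[OF emb] flow_C_k[OF p contu Ck_u' du])
    qed
  qed
  have "homeomorphism X (torus g) f h"
    unfolding homeomorphism_def
    using smooth_map_continuous[OF sm_f] smooth_map_continuous[OF sm_h] hf fh f_torus h_X
    by (auto simp: image_iff) (metis, metis)
  then show ?thesis unfolding diffeomorphic_def using sm_f sm_h by blast
qed

end

section \<open>Polynomial Lax flows\<close>

lemma poly_eq_off_finite:
  fixes p q :: "complex poly"
  assumes "finite F" "\<And>x. x \<notin> F \<Longrightarrow> poly p x = poly q x"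
  shows "p = q"
proof (rule ccontr)
  assume "p \<noteq> q"
  then have "finite {x. poly (p - q) x = 0}" by (intro poly_roots_finite) auto
  moreover have "- F \<subseteq> {x. poly (p - q) x = 0}" using assms(2) by auto
  ultimately have "finite (- F)" by (rule finite_subset[rotated])
  then show False using assms(1) infinite_UNIV_char_0 by (metis finite_compl)
qed

text \<open>A strict bound that the zero polynomial meets for every n. For n = 0 it forces p = 0,
  which is what \<alpha> has to be when g = 0.\<close>

definition deg_lt :: "'a::zero poly \<Rightarrow> nat \<Rightarrow> bool" where
  "deg_lt p n \<longleftrightarrow> (\<forall>k\<ge>n. coeff p k = 0)"

lemma deg_lt_iff: "deg_lt p n \<longleftrightarrow> p = 0 \<or> degree p < n"
proof
  assume "deg_lt p n"
  then show "p = 0 \<or> degree p < n"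
    unfolding deg_lt_def by (metis leading_coeff_0_iff not_le)
qed (auto simp: deg_lt_def coeff_eq_0)

lemma deg_lt_0: "deg_lt 0 n"
  and deg_lt_add: "deg_lt p n \<Longrightarrow> deg_lt q n \<Longrightarrow> deg_lt (p + q) n"
  and deg_lt_diff: "deg_lt p' n \<Longrightarrow> deg_lt q' n \<Longrightarrow> deg_lt (p' - q') n"
  and deg_lt_minus: "deg_lt p' n \<Longrightarrow> deg_lt (- p') n"
  and deg_lt_smult: "deg_lt s n \<Longrightarrow> deg_lt (smult c s) n"
  and deg_lt_mono: "deg_lt p n \<Longrightarrow> n \<le> m \<Longrightarrow> deg_lt p m"
  for p q :: "'a::comm_monoid_add poly" and p' q' :: "'b::ab_group_add poly" and s :: "'c::comm_semiring_0 poly"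
  by (auto simp: deg_lt_def)

lemma deg_lt_sum: "(\<And>j. j \<in> J \<Longrightarrow> deg_lt (f j) n) \<Longrightarrow> deg_lt (\<Sum>j\<in>J. f j) n"
  by (induction J rule: infinite_finite_induct) (auto simp: deg_lt_0 deg_lt_add)

lemma deg_lt_mult_linear:
  fixes p :: "complex poly"
  assumes "deg_lt ([:-x, 1:] * p) (Suc n)"
  shows "deg_lt p n"
proof (cases "p = 0")
  case False
  have "degree ([:-x, 1:] * p) = 1 + degree p" using False by (subst degree_mult_eq) auto
  then show ?thesis using assms False by (auto simp: deg_lt_iff)
qed (simp add: deg_lt_0)

lemma deg_lt_mult_X:
  fixes p :: "complex poly"
  shows "deg_lt ([:0, 1:] * p) (Suc n) \<longleftrightarrow> deg_lt p n"
proof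
  show "deg_lt p n" if "deg_lt ([:0, 1:] * p) (Suc n)"
    using deg_lt_mult_linear[of 0 p n] that by simp
  show "deg_lt ([:0, 1:] * p) (Suc n)" if "deg_lt p n"
    using that by (auto simp: deg_lt_def coeff_pCons split: nat.split)
qed

lemma deg_lt_dvd_0:
  fixes p q :: "complex poly"
  assumes "q dvd p" "deg_lt p n" "q \<noteq> 0" "n \<le> degree q"
  shows "p = 0"
proof (rule ccontr)
  assume "p \<noteq> 0"
  then have "degree q \<le> degree p" using assms(1) by (rule dvd_imp_degree_le[rotated])
  then show False using assms \<open>p \<noteq> 0\<close> by (auto simp: deg_lt_iff)
qed

text \<open>\<open>star n p\<close> is \<open>\<lambda>\<^sup>n p\<^sup>-(1/\<lambda>)\<close> with conjugated coefficients. In terms of \<open>\<alpha> = \<xi>\<^sub>1\<^sub>1\<close>, \<open>b = \<lambda> \<xi>\<^sub>1\<^sub>2\<close> and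
  \<open>c = \<xi>\<^sub>2\<^sub>1\<close> the reality condition reads \<open>star (g - 1) \<alpha> = - \<alpha>\<close>, \<open>c = - star g b\<close>, and the spectral
  polynomial is \<open>\<lambda> \<alpha>\<^sup>2 + b c\<close>.\<close>

definition star :: "nat \<Rightarrow> complex poly \<Rightarrow> complex poly" where
  "star n p = (\<Sum>k\<le>n. monom (cnj (coeff p (n - k))) k)"

lemma coeff_star: "coeff (star n p) k = (if k \<le> n then cnj (coeff p (n - k)) else 0)"
  unfolding star_def by (simp add: coeff_sum sum.delta if_distrib[of "\<lambda>x. x = _"])

lemma star_add: "star n (p + q) = star n p + star n q"
  and star_minus: "star n (- p) = - star n p"
  and star_smult: "star n (smult c p) = smult (cnj c) (star n p)"
  by (rule poly_eqI, simp add: coeff_star)+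

lemma star_sum: "star n (\<Sum>j\<in>J. f j) = (\<Sum>j\<in>J. star n (f j))"
  by (rule poly_eqI) (simp add: coeff_star coeff_sum)

lemma deg_lt_star: "deg_lt (star n p) (Suc n)"
  by (auto simp: deg_lt_def coeff_star)

lemma star_star: "deg_lt p (Suc n) \<Longrightarrow> star n (star n p) = p"
  by (rule poly_eqI) (auto simp: coeff_star deg_lt_def)

lemma poly_star:
  assumes p: "deg_lt p (Suc n)" and x: "x \<noteq> 0"
  shows "poly (star n p) x = x ^ n * cnj (poly p (inverse (cnj x)))"
proof -
  have pe: "poly p y = (\<Sum>i\<le>n. coeff p i * y ^ i)" for y
    using p by (intro poly_altdef[THEN trans] sum.mono_neutral_left) (auto simp: deg_lt_iff coeff_eq_0)
  have se: "poly (star n p) x = (\<Sum>k\<le>n. cnj (coeff p (n - k)) * x ^ k)"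
    by (simp add: star_def poly_sum poly_monom)
  have "\<dots> = (\<Sum>i\<le>n. cnj (coeff p i) * x ^ (n - i))"
    by (rule sum.reindex_bij_witness[of _ "\<lambda>i. n - i" "\<lambda>i. n - i"]) auto
  also have "\<dots> = (\<Sum>i\<le>n. x ^ n * cnj (coeff p i * inverse (cnj x) ^ i))"
    by (intro sum.cong) (use x in \<open>auto simp: power_diff power_inverse field_simps\<close>)
  finally show ?thesis unfolding se pe cnj_sum sum_distrib_left .
qed

text \<open>The isospectral Lax flow with parameter \<open>z\<close> is \<open>\<alpha>' = bezoutian b c z\<close>, \<open>b' = lax_b \<alpha> b z\<close>, \<open>c' = - lax_b \<alpha> c z\<close>;
  see \<open>poly_bezoutian\<close> and \<open>poly_lax_b\<close> for the usual rational expressions. Its gauge is chosen such that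
  \<open>b(0)\<close> is only rescaled.\<close>

definition bezoutian :: "complex poly \<Rightarrow> complex poly \<Rightarrow> complex \<Rightarrow> complex poly" where
  "bezoutian b c z = c * synthetic_div b z - b * synthetic_div c z"

definition lax_b :: "complex poly \<Rightarrow> complex poly \<Rightarrow> complex \<Rightarrow> complex poly" where
  "lax_b \<alpha> b z = 2 * [:0, 1:] * (b * synthetic_div \<alpha> z - \<alpha> * synthetic_div b z) + smult (poly \<alpha> z) b"

lemma synthetic_div_mult: "[:-z, 1:] * synthetic_div p z = p - [:poly p z:]"
  for p :: "complex poly"
  using synthetic_div_correct'[of z p] by (metis add_diff_cancel_right')

lemma bezoutian_mult: "[:-z, 1:] * bezoutian b c z = smult (poly c z) b - smult (poly b z) c"
proof -
  have "[:-z, 1:] * bezoutian b c z = c * ([:-z, 1:] * synthetic_div b z) - b * ([:-z, 1:] * synthetic_div c z)"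
    by (simp add: bezoutian_def algebra_simps)
  also have "\<dots> = smult (poly c z) b - smult (poly b z) c"
    unfolding synthetic_div_mult by (simp add: algebra_simps)
  finally show ?thesis .
qed

lemma lax_b_mult: "[:-z, 1:] * lax_b \<alpha> b z = 2 * [:0, 1:] * smult (poly b z) \<alpha> - [:z, 1:] * smult (poly \<alpha> z) b"
proof -
  have "[:-z, 1:] * lax_b \<alpha> b z = 2 * [:0, 1:] * (b * ([:-z, 1:] * synthetic_div \<alpha> z) - \<alpha> * ([:-z, 1:] * synthetic_div b z))
     + [:-z, 1:] * smult (poly \<alpha> z) b"
    by (simp add: lax_b_def algebra_simps)
  also have "\<dots> = 2 * [:0, 1:] * smult (poly b z) \<alpha> - (2 * [:0, 1:] - [:-z, 1:]) * smult (poly \<alpha> z) b"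
    unfolding synthetic_div_mult by (simp add: algebra_simps)
  also have "2 * [:0, 1:] - [:-z, 1:] = [:z, 1:]" by (simp add: numeral_poly)
  finally show ?thesis .
qed

lemma poly_bezoutian: "x \<noteq> z \<Longrightarrow> poly (bezoutian b c z) x = (poly b x * poly c z - poly c x * poly b z) / (x - z)"
  using arg_cong[OF bezoutian_mult[of z b c], of "\<lambda>p. poly p x"] by (simp add: field_simps)

lemma poly_lax_b: "x \<noteq> z \<Longrightarrow> poly (lax_b \<alpha> b z) x = (2 * x * poly \<alpha> x * poly b z - (x + z) * poly \<alpha> z * poly b x) / (x - z)"
  using arg_cong[OF lax_b_mult[of z \<alpha> b], of "\<lambda>p. poly p x"] by (simp add: field_simps)

lemma deg_lt_bezoutian:
  assumes "deg_lt b (Suc g)" "deg_lt c (Suc g)"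
  shows "deg_lt (bezoutian b c z) g"
  by (rule deg_lt_mult_linear[of z]) (unfold bezoutian_mult, intro deg_lt_diff deg_lt_smult assms)

lemma deg_lt_lax_b:
  assumes \<alpha>: "deg_lt \<alpha> g" and b: "deg_lt b (Suc g)"
  shows "deg_lt (lax_b \<alpha> b z) (Suc g)"
proof (rule deg_lt_mult_linear[of z])
  have "deg_lt ([:0, 1:] * smult (2 * poly b z) \<alpha>) (Suc (Suc g))"
    by (rule deg_lt_mono[OF iffD2[OF deg_lt_mult_X deg_lt_smult[OF \<alpha>]]]) simp
  moreover have "deg_lt ([:0, 1:] * smult (poly \<alpha> z) b + smult (z * poly \<alpha> z) b) (Suc (Suc g))"
    by (rule deg_lt_add[OF iffD2[OF deg_lt_mult_X deg_lt_smult[OF b]] deg_lt_mono[OF deg_lt_smult[OF b]]]) simp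
  moreover have "2 * [:0, 1:] * smult (poly b z) \<alpha> = [:0, 1:] * smult (2 * poly b z) \<alpha>"
    "[:z, 1:] * smult (poly \<alpha> z) b = [:0, 1:] * smult (poly \<alpha> z) b + smult (z * poly \<alpha> z) b"
    by (simp_all add: poly_eq_poly_eq_iff[symmetric] fun_eq_iff algebra_simps)
  ultimately show "deg_lt ([:-z, 1:] * lax_b \<alpha> b z) (Suc (Suc g))"
    unfolding lax_b_mult by (simp only: deg_lt_diff)
qed

lemma coeff_0_lax_b: "coeff (lax_b \<alpha> b z) 0 = poly \<alpha> z * coeff b 0"
  unfolding poly_0_coeff_0[symmetric] by (simp add: lax_b_def)

text \<open>Isospectrality: with c' = - \<open>lax_b \<alpha> c z\<close> the left-hand side is the
  derivative of \<open>\<lambda> \<alpha>\<^sup>2 + b c\<close> along the flow at z.\<close>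

lemma curve_tangent: "2 * [:0, 1:] * \<alpha> * bezoutian b c z + lax_b \<alpha> b z * c - b * lax_b \<alpha> c z = 0"
  by (simp add: bezoutian_def lax_b_def algebra_simps)

lemma bezoutian_swap: "bezoutian c b z = - bezoutian b c z"
  by (simp add: bezoutian_def)

lemma bezoutian_sym: "poly (bezoutian b c x) y = poly (bezoutian b c y) x"
  by (cases "x = y") (simp_all add: poly_bezoutian field_simps)

lemma inverse_cnj_unit: "norm z = 1 \<Longrightarrow> inverse (cnj z) = z"
  by (metis complex_cnj_inverse divide_inverse complex_div_cnj complex_cnj_cnj complex_mod_cnj inverse_eq_divide mult_1 of_real_1 one_power2 div_by_1)

text \<open>The reflection x \<mapsto> 1 / cnj x interchanges b and c up to a sign and a power of x,
  and it fixes z on the unit circle. The condition on \<rho> compensates the phase z^(g-1) that the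
  reflection leaves behind. Comparison off x = 0 and x = z suffices and permits quotients.\<close>

lemma star_bezoutian:
  assumes b: "deg_lt b (Suc g)" and c: "c = - star g b" and z: "norm z = 1"
    and \<rho>: "\<rho> * z ^ (g - 1) = - cnj \<rho>" and g: "g > 0"
  shows "star (g - 1) (smult \<rho> (bezoutian b c z)) = - smult \<rho> (bezoutian b c z)"
proof (rule poly_eq_off_finite[of "{0, z}"])
  have c': "deg_lt c (Suc g)" unfolding c by (intro deg_lt_minus deg_lt_star)
  have bc: "b = - star g c" using star_star[OF b] by (simp add: c star_minus)
  have z0: "z \<noteq> 0" using z by auto
  fix x assume x: "x \<notin> {0, z}"
  define m where "m = inverse (cnj x)"
  have m: "m \<noteq> 0" "inverse (cnj m) = x" using x by (auto simp: m_def)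
  have mz: "m \<noteq> z" using x inverse_cnj_unit[OF z] by (auto simp: m_def)
  have bp: "poly b y = - poly (star g c) y" "poly c y = - poly (star g b) y" for y
    using arg_cong[OF bc, of "\<lambda>p. poly p y"] arg_cong[OF c, of "\<lambda>p. poly p y"] by simp_all
  have cx: "poly c x = - (x ^ g * cnj (poly b m))" "poly b x = - (x ^ g * cnj (poly c m))"
    using poly_star[OF b, of x] poly_star[OF c', of x] x unfolding m_def bp(1)[of x] bp(2)[of x] by auto
  have cz: "poly c z = - (z ^ g * cnj (poly b z))" "poly b z = - (z ^ g * cnj (poly c z))"
    using poly_star[OF b z0] poly_star[OF c' z0] bp[of z] unfolding inverse_cnj_unit[OF z] by metis+
  have div: "R = - P / Q" if "P = - (Q * R)" "Q \<noteq> 0" for P Q R :: complex using that by simp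
  have cc: "cnj (poly b m) = - poly c x / x ^ g" "cnj (poly c m) = - poly b x / x ^ g"
      "cnj (poly b z) = - poly c z / z ^ g" "cnj (poly c z) = - poly b z / z ^ g"
    using div[OF cx(1)] div[OF cx(2)] div[OF cz(1)] div[OF cz(2)] x z0 by auto
  have cm: "cnj (m - z) = (z - x) / (x * z)"
    using x z0 inverse_cnj_unit[OF z] by (simp add: m_def field_simps)
  have pw: "x ^ g = x * x ^ (g - 1)" "z ^ g = z * z ^ (g - 1)" using g by (simp_all add: power_eq_if)
  have c\<rho>: "cnj \<rho> = - (\<rho> * z ^ (g - 1))" using \<rho> by simp
  have "poly (star (g - 1) (smult \<rho> (bezoutian b c z))) x = x ^ (g - 1) * cnj (\<rho> * poly (bezoutian b c z) m)"
    using x g deg_lt_smult[OF deg_lt_bezoutian[OF b c']] by (subst poly_star) (auto simp: m_def)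
  also have "\<dots> = x ^ (g - 1) * (cnj \<rho> * ((cnj (poly b m) * cnj (poly c z) - cnj (poly c m) * cnj (poly b z)) / cnj (m - z)))"
    by (simp add: poly_bezoutian[OF mz])
  also have "\<dots> = - (\<rho> * ((poly b x * poly c z - poly c x * poly b z) / (x - z)))"
  proof -
    have "x - z \<noteq> 0" "z - x \<noteq> 0" "x \<noteq> 0" "x ^ (g - 1) \<noteq> 0" "z ^ (g - 1) \<noteq> 0" using x z0 by auto
    then show ?thesis unfolding cc cm pw c\<rho> using z0
      by (simp add: divide_simps) (simp add: algebra_simps)
  qed
  also have "\<dots> = poly (- smult \<rho> (bezoutian b c z)) x" using x by (simp add: poly_bezoutian)
  finally show "poly (star (g - 1) (smult \<rho> (bezoutian b c z))) x = poly (- smult \<rho> (bezoutian b c z)) x" .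
qed simp

lemma star_lax_b:
  assumes \<alpha>: "deg_lt \<alpha> g" "star (g - 1) \<alpha> = - \<alpha>" and b: "deg_lt b (Suc g)" and c: "c = - star g b" and z: "norm z = 1"
    and \<rho>: "\<rho> * z ^ (g - 1) = - cnj \<rho>" and g: "g > 0"
  shows "star g (smult \<rho> (lax_b \<alpha> b z)) = smult \<rho> (lax_b \<alpha> c z)"
proof (rule poly_eq_off_finite[of "{0, z}"])
  have c': "deg_lt c (Suc g)" unfolding c by (intro deg_lt_minus deg_lt_star)
  have z0: "z \<noteq> 0" using z by auto
  have \<alpha>': "deg_lt \<alpha> (Suc (g - 1))" using \<alpha>(1) g by simp
  fix x assume x: "x \<notin> {0, z}"
  define m where "m = inverse (cnj x)"
  have mz: "m \<noteq> z" using x inverse_cnj_unit[OF z] by (auto simp: m_def)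
  have cx: "poly c x = - (x ^ g * cnj (poly b m))" using poly_star[OF b, of x] x by (simp add: c m_def)
  have cz: "poly c z = - (z ^ g * cnj (poly b z))"
    using poly_star[OF b z0] unfolding inverse_cnj_unit[OF z] by (simp add: c)
  have ax: "poly \<alpha> x = - (x ^ (g - 1) * cnj (poly \<alpha> m))"
    using poly_star[OF \<alpha>', of x] x unfolding \<alpha>(2) m_def by (simp add: minus_equation_iff[of "poly \<alpha> x"])
  have az: "poly \<alpha> z = - (z ^ (g - 1) * cnj (poly \<alpha> z))"
    using poly_star[OF \<alpha>' z0] unfolding \<alpha>(2) inverse_cnj_unit[OF z] by (simp add: minus_equation_iff[of "poly \<alpha> z"])
  have cc: "cnj (poly b m) = - poly c x / x ^ g" "cnj (poly b z) = - poly c z / z ^ g"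
     "cnj (poly \<alpha> m) = - poly \<alpha> x / x ^ (g - 1)" "cnj (poly \<alpha> z) = - poly \<alpha> z / z ^ (g - 1)"
  proof -
    have div: "R = - P / Q" if "P = - (Q * R)" "Q \<noteq> 0" for P Q R :: complex using that by simp
    show "cnj (poly b m) = - poly c x / x ^ g" "cnj (poly b z) = - poly c z / z ^ g"
     "cnj (poly \<alpha> m) = - poly \<alpha> x / x ^ (g - 1)" "cnj (poly \<alpha> z) = - poly \<alpha> z / z ^ (g - 1)"
      using div[OF cx] div[OF cz] div[OF ax] div[OF az] x z0 by auto
  qed
  have cm': "cnj m = 1 / x" by (simp add: m_def inverse_eq_divide)
  have cz': "cnj z = 1 / z" using inverse_cnj_unit[OF z] by (metis inverse_eq_divide inverse_inverse_eq)
  have pw: "x ^ g = x * x ^ (g - 1)" "z ^ g = z * z ^ (g - 1)" using g by (simp_all add: power_eq_if)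
  have c\<rho>: "cnj \<rho> = - (\<rho> * z ^ (g - 1))" using \<rho> by simp
  have "poly (star g (smult \<rho> (lax_b \<alpha> b z))) x = x ^ g * cnj (\<rho> * poly (lax_b \<alpha> b z) m)"
    using x deg_lt_smult[OF deg_lt_lax_b[OF \<alpha>(1) b]] by (subst poly_star) (auto simp: m_def)
  also have "\<dots> = x ^ g * (cnj \<rho> * ((2 * cnj m * cnj (poly \<alpha> m) * cnj (poly b z) - (cnj m + cnj z) * cnj (poly \<alpha> z) * cnj (poly b m)) / (cnj m - cnj z)))"
    by (simp add: poly_lax_b[OF mz])
  also have "\<dots> = \<rho> * ((2 * x * poly \<alpha> x * poly c z - (x + z) * poly \<alpha> z * poly c x) / (x - z))"
  proof -
    have "x - z \<noteq> 0" "z - x \<noteq> 0" "x \<noteq> 0" "x ^ (g - 1) \<noteq> 0" "z ^ (g - 1) \<noteq> 0" using x z0 by auto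
    moreover from this have "1 / x - 1 / z = (z - x) / (x * z)" using z0 by (simp add: field_simps)
    ultimately show ?thesis unfolding cc cm' cz' pw c\<rho> using z0
      by (simp add: divide_simps) (simp add: algebra_simps)
  qed
  also have "\<dots> = poly (smult \<rho> (lax_b \<alpha> c z)) x" using x by (simp add: poly_lax_b)
  finally show "poly (star g (smult \<rho> (lax_b \<alpha> b z))) x = poly (smult \<rho> (lax_b \<alpha> c z)) x" .
qed simp

text \<open>The reflection fixes z, so the reality condition relates \<alpha>(z) to its own
  conjugate, and \<rho> is the phase that makes it real. The node values \<rho> \<alpha>(z) are thus
  real coordinates of \<alpha>.\<close>

lemma evaluation_real:
  assumes \<alpha>: "deg_lt \<alpha> g" "star (g - 1) \<alpha> = - \<alpha>" and z: "norm z = 1"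
    and \<rho>: "\<rho> * z ^ (g - 1) = - cnj \<rho>" and g: "g > 0"
  shows "cnj (\<rho> * poly \<alpha> z) = \<rho> * poly \<alpha> z"
proof -
  have z0: "z \<noteq> 0" using z by auto
  have \<alpha>': "deg_lt \<alpha> (Suc (g - 1))" using \<alpha>(1) g by simp
  have az: "poly \<alpha> z = - (z ^ (g - 1) * cnj (poly \<alpha> z))"
    using poly_star[OF \<alpha>' z0] unfolding \<alpha>(2) inverse_cnj_unit[OF z] by (simp add: minus_equation_iff[of "poly \<alpha> z"])
  have "cnj (\<rho> * poly \<alpha> z) = - (\<rho> * z ^ (g - 1)) * cnj (poly \<alpha> z)" using \<rho> by simp
  also have "\<dots> = \<rho> * poly \<alpha> z" by (subst (2) az) simp
  finally show ?thesis .
qed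

text \<open>The \<alpha>-component of the vanishing Lie bracket of the flows at z and w: each side
  differentiates one \<open>bezoutian\<close> along the other flow, where c' carries the minus sign.
  The identity is rational in the values at x, z and w, so it is checked off the poles.\<close>

lemma bezoutian_commute:
  "bezoutian (lax_b \<alpha> b z) c w - bezoutian b (lax_b \<alpha> c z) w = bezoutian (lax_b \<alpha> b w) c z - bezoutian b (lax_b \<alpha> c w) z"
proof (cases "z = w")
  case False
  show ?thesis
  proof (rule poly_eq_off_finite[of "{z, w}"])
    fix x assume "x \<notin> {z, w}"
    then have "x \<noteq> z" "x \<noteq> w" by auto
    moreover have "w \<noteq> z" using False by simp
    moreover from calculation have "x - z \<noteq> 0" "x - w \<noteq> 0" "z - w \<noteq> 0" "w - z \<noteq> 0" by auto
    ultimately show "poly (bezoutian (lax_b \<alpha> b z) c w - bezoutian b (lax_b \<alpha> c z) w) x = poly (bezoutian (lax_b \<alpha> b w) c z - bezoutian b (lax_b \<alpha> c w) z) x"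
      by (simp add: poly_bezoutian poly_lax_b False divide_simps) (simp add: algebra_simps)
  qed simp
qed simp

text \<open>The b-component of the same bracket; b' depends on both \<alpha> and b, hence two terms
  on each side.\<close>

lemma lax_b_commute:
  "lax_b (bezoutian b c z) b w + lax_b \<alpha> (lax_b \<alpha> b z) w = lax_b (bezoutian b c w) b z + lax_b \<alpha> (lax_b \<alpha> b w) z"
proof (cases "z = w")
  case False
  show ?thesis
  proof (rule poly_eq_off_finite[of "{z, w}"])
    fix x assume "x \<notin> {z, w}"
    then have "x \<noteq> z" "x \<noteq> w" by auto
    moreover have "w \<noteq> z" using False by simp
    moreover from calculation have "x - z \<noteq> 0" "x - w \<noteq> 0" "z - w \<noteq> 0" "w - z \<noteq> 0" by auto
    ultimately show "poly (lax_b (bezoutian b c z) b w + lax_b \<alpha> (lax_b \<alpha> b z) w) x = poly (lax_b (bezoutian b c w) b z + lax_b \<alpha> (lax_b \<alpha> b w) z) x"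
      by (simp add: poly_bezoutian poly_lax_b False divide_simps) (simp add: algebra_simps)
  qed simp
qed simp

section \<open>Simple roots and coprimality\<close>

lemma double_root_card:
  fixes a :: "complex poly"
  assumes "[:-x, 1:]\<^sup>2 dvd a" "a \<noteq> 0"
  shows "card {l. poly a l = 0} < degree a"
proof -
  obtain q where q: "a = [:-x, 1:]\<^sup>2 * q" using assms(1) by blast
  then have "q \<noteq> 0" using assms(2) by auto
  have "{l. poly a l = 0} \<subseteq> insert x {l. poly q l = 0}" by (auto simp: q)
  then have "card {l. poly a l = 0} \<le> card (insert x {l. poly q l = 0})"
    using poly_roots_finite[OF \<open>q \<noteq> 0\<close>] by (intro card_mono) auto
  also have "\<dots> \<le> Suc (card {l. poly q l = 0})" by (rule card_insert_le_m1[THEN order_trans]) (auto simp: card_insert_if)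
  also have "\<dots> \<le> Suc (degree q)" using card_poly_roots_bound[OF \<open>q \<noteq> 0\<close>] by simp
  also have "\<dots> < degree a"
    unfolding q using \<open>q \<noteq> 0\<close> by (subst degree_mult_eq) (auto simp: degree_power_eq)
  finally show ?thesis .
qed

definition no_common_root :: "complex poly \<Rightarrow> complex poly \<Rightarrow> complex poly \<Rightarrow> bool" where
  "no_common_root p q r \<longleftrightarrow> (\<forall>x. \<not> (poly p x = 0 \<and> poly q x = 0 \<and> poly r x = 0))"

lemma no_common_root_bezout:
  assumes "no_common_root p q r"
  shows "\<exists>u v w. u * p + v * q + w * r = 1"
proof -
  define d where "d = gcd p (gcd q r)"
  have "d \<noteq> 0"
  proof
    assume "d = 0"
    then have "p = 0" "q = 0" "r = 0" by (auto simp: d_def)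
    then show False using assms by (simp add: no_common_root_def)
  qed
  have "poly d x \<noteq> 0" for x
  proof
    assume "poly d x = 0"
    then have "[:-x, 1:] dvd d" by (simp add: poly_eq_0_iff_dvd)
    then have "[:-x, 1:] dvd p" "[:-x, 1:] dvd q" "[:-x, 1:] dvd r"
      unfolding d_def by (auto intro: dvd_trans)
    then show False using assms unfolding no_common_root_def by (auto simp: poly_eq_0_iff_dvd[symmetric])
  qed
  then have "constant (poly d)" using fundamental_theorem_of_algebra by blast
  then have "degree d = 0" by (simp add: constant_degree)
  then obtain k where k: "d = [:k:]" "k \<noteq> 0" using \<open>d \<noteq> 0\<close> by (metis degree_eq_zeroE pCons_0_0)
  obtain u1 v1 where 1: "u1 * q + v1 * r = gcd q r" using bezout_coefficients_fst_snd by blast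
  obtain u2 v2 where 2: "u2 * p + v2 * gcd q r = d" using bezout_coefficients_fst_snd d_def by blast
  have "u2 * p + v2 * (u1 * q + v1 * r) = [:k:]" using 1 2 k by simp
  then have "[:1/k:] * (u2 * p + v2 * (u1 * q + v1 * r)) = 1" using k(2) by (simp add: one_pCons)
  then have "([:1/k:] * u2) * p + ([:1/k:] * v2 * u1) * q + ([:1/k:] * v2 * v1) * r = 1"
    by (simp only: algebra_simps)
  then show ?thesis by blast
qed

text \<open>A common root x is nonzero since b(0) \<noteq> 0, hence a root of \<alpha>; then
  \<open>\<alpha>\<^sup>2\<close> and b c both vanish doubly at x, and \<open>a\<close> has fewer
  roots than its degree.\<close>

lemma no_common_root_spectral:
  assumes a: "a = [:0, 1:] * \<alpha>\<^sup>2 + b * c" and deg: "degree a \<le> 2 * g" and card: "card {l. poly a l = 0} = 2 * g"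
    and b0: "poly b 0 \<noteq> 0" and b: "deg_lt b (Suc g)"
  shows "no_common_root b c ([:0, 1:] * \<alpha>)"
  unfolding no_common_root_def
proof (intro allI notI, elim conjE)
  fix x assume x: "poly b x = 0" "poly c x = 0" "poly ([:0, 1:] * \<alpha>) x = 0"
  have "x \<noteq> 0" using b0 x(1) by auto
  then have d: "[:-x, 1:] dvd \<alpha>" "[:-x, 1:] dvd b" "[:-x, 1:] dvd c"
    using x by (auto simp: poly_eq_0_iff_dvd[symmetric])
  have "[:-x, 1:]\<^sup>2 dvd a"
    unfolding a power2_eq_square using d by (intro dvd_add dvd_mult mult_dvd_mono)
  moreover have "a \<noteq> 0"
  proof
    assume "a = 0"
    then have "g = 0" using card infinite_UNIV_char_0[where 'a = complex] by simp
    then obtain k where "b = [:k:]" using b by (metis deg_lt_iff less_Suc0 degree_eq_zeroE pCons_0_0)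
    then show False using x b0 by simp
  qed
  ultimately show False using double_root_card[of x a] card deg by simp
qed

text \<open>The flows are parametrised by their values at \<open>g\<close> points of the unit circle. For real \<open>v\<^sub>j\<close> the combinations
  \<open>\<Sum> v\<^sub>j \<rho>\<^sub>j V(z\<^sub>j)\<close> are exactly the flows that preserve the reality condition of the potentials.\<close>

locale nodes =
  fixes g :: nat and z \<rho> :: "nat \<Rightarrow> complex"
  assumes inj: "inj_on z {..<g}" and unit: "\<And>j. j < g \<Longrightarrow> norm (z j) = 1"
    and \<rho>_nz: "\<And>j. j < g \<Longrightarrow> \<rho> j \<noteq> 0"
    and \<rho>: "\<And>j. j < g \<Longrightarrow> \<rho> j * z j ^ (g - 1) = - cnj (\<rho> j)"
begin

definition Zj :: "nat \<Rightarrow> complex poly" where "Zj j = (\<Prod>i\<in>{..<g} - {j}. [:- z i, 1:])"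

text \<open>What a flow looks like modulo b: by \<open>VA_\<eta>\<close> and
  \<open>VB_\<eta>\<close> its components are c h and - 2 \<lambda> \<alpha> h modulo b, where h =
  \<eta> r b. So a single polynomial of degree below g controls the flow.\<close>

definition \<eta> :: "(nat \<Rightarrow> complex) \<Rightarrow> complex poly \<Rightarrow> complex poly" where
  "\<eta> r p = (\<Sum>j<g. smult (r j) (synthetic_div p (z j)))"

text \<open>The logarithmic derivative of b(0) along the flow, see
  \<open>coeff_0_VB\<close>.\<close>

definition \<sigma> :: "(nat \<Rightarrow> complex) \<Rightarrow> complex poly \<Rightarrow> complex" where
  "\<sigma> r p = (\<Sum>j<g. r j * poly p (z j))"

definition VA :: "(nat \<Rightarrow> complex) \<Rightarrow> complex poly \<Rightarrow> complex poly \<Rightarrow> complex poly" where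
  "VA r b c = (\<Sum>j<g. smult (r j) (bezoutian b c (z j)))"

definition VB :: "(nat \<Rightarrow> complex) \<Rightarrow> complex poly \<Rightarrow> complex poly \<Rightarrow> complex poly" where
  "VB r \<alpha> b = (\<Sum>j<g. smult (r j) (lax_b \<alpha> b (z j)))"

lemma VA_\<eta>: "VA r b c = c * \<eta> r b - b * \<eta> r c"
  by (simp add: VA_def \<eta>_def bezoutian_def sum_distrib_left sum_subtractf[symmetric] smult_diff_right)

lemma VB_\<eta>: "VB r \<alpha> b = 2 * [:0, 1:] * (b * \<eta> r \<alpha> - \<alpha> * \<eta> r b) + smult (\<sigma> r \<alpha>) b"
proof -
  have "smult (\<sigma> r \<alpha>) b = (\<Sum>j<g. smult (r j) (smult (poly \<alpha> (z j)) b))"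
    by (simp add: \<sigma>_def smult_sum)
  moreover have "2 * [:0, 1:] * (b * \<eta> r \<alpha> - \<alpha> * \<eta> r b) =
      (\<Sum>j<g. smult (r j) (2 * [:0, 1:] * (b * synthetic_div \<alpha> (z j) - \<alpha> * synthetic_div b (z j))))"
    by (simp only: \<eta>_def sum_distrib_left sum_subtractf[symmetric] mult_smult_right smult_diff_right right_diff_distrib)
  ultimately show ?thesis
    by (simp only: VB_def lax_b_def smult_add_right sum.distrib)
qed

lemma Zj: "j < g \<Longrightarrow> deg_lt (Zj j) g" "j < g \<Longrightarrow> poly (Zj j) (z j) \<noteq> 0"
  "i < g \<Longrightarrow> i \<noteq> j \<Longrightarrow> poly (Zj j) (z i) = 0"
proof -
  assume j: "j < g"
  have "degree (Zj j) \<le> (\<Sum>i\<in>{..<g} - {j}. degree [:- z i, 1:])"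
    unfolding Zj_def using degree_prod_sum_le[of "{..<g} - {j}" "\<lambda>i. [:- z i, 1:]"] by (simp add: o_def)
  also have "\<dots> < g" using j by simp
  finally show "deg_lt (Zj j) g" by (simp add: deg_lt_iff)
  show "poly (Zj j) (z j) \<noteq> 0"
    using inj j by (auto simp: Zj_def poly_prod inj_on_def)
next
  assume "i < g" "i \<noteq> j"
  then show "poly (Zj j) (z i) = 0" by (auto simp: Zj_def poly_prod)
qed

lemma zero_by_nodes:
  assumes "deg_lt p g" "\<And>j. j < g \<Longrightarrow> poly p (z j) = 0"
  shows "p = 0"
proof (rule ccontr)
  assume p: "p \<noteq> 0"
  have "g = card (z ` {..<g})" by (simp add: card_image inj)
  also have "\<dots> \<le> card {x. poly p x = 0}" using assms(2) poly_roots_finite[OF p] by (intro card_mono) auto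
  also have "\<dots> \<le> degree p" using card_poly_roots_bound[OF p] by simp
  finally show False using assms(1) p by (simp add: deg_lt_iff)
qed

lemma poly_sum_Zj:
  assumes "i < g"
  shows "poly (\<Sum>j<g. smult (r j) (Zj j)) (z i) = r i * poly (Zj i) (z i)"
proof -
  have "poly (\<Sum>j<g. smult (r j) (Zj j)) (z i) = (\<Sum>j<g. if j = i then r i * poly (Zj i) (z i) else 0)"
    unfolding poly_sum using Zj(3)[OF assms] by (intro sum.cong) auto
  then show ?thesis using assms by simp
qed

lemma lagrange:
  assumes "deg_lt h g"
  shows "h = (\<Sum>j<g. smult (poly h (z j) / poly (Zj j) (z j)) (Zj j))"
proof -
  have "h - (\<Sum>j<g. smult (poly h (z j) / poly (Zj j) (z j)) (Zj j)) = 0"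
  proof (rule zero_by_nodes)
    show "deg_lt (h - (\<Sum>j<g. smult (poly h (z j) / poly (Zj j) (z j)) (Zj j))) g"
      using Zj(1) by (intro deg_lt_diff deg_lt_sum deg_lt_smult assms) auto
    show "poly (h - (\<Sum>j<g. smult (poly h (z j) / poly (Zj j) (z j)) (Zj j))) (z i) = 0" if "i < g" for i
      using poly_sum_Zj[OF that, of "\<lambda>j. poly h (z j) / poly (Zj j) (z j)"] Zj(2)[OF that] by simp
  qed
  then show ?thesis by simp
qed

text \<open>Clears the denominators in the sum of r_j (b(x) - b(z_j)) / (x - z_j), which is \<eta> r
  b.\<close>

lemma \<eta>_Z: "(\<Prod>j<g. [:- z j, 1:]) * \<eta> r b =
    b * (\<Sum>j<g. smult (r j) (Zj j)) - (\<Sum>j<g. smult (r j * poly b (z j)) (Zj j))"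
proof -
  have "(\<Prod>j<g. [:- z j, 1:]) * \<eta> r b = (\<Sum>j<g. smult (r j) (Zj j * ([:- z j, 1:] * synthetic_div b (z j))))"
    unfolding \<eta>_def sum_distrib_left
  proof (intro sum.cong refl)
    fix j assume "j \<in> {..<g}"
    then have "(\<Prod>j<g. [:- z j, 1:]) = [:- z j, 1:] * Zj j"
      unfolding Zj_def by (intro prod.remove) auto
    then show "(\<Prod>j<g. [:- z j, 1:]) * smult (r j) (synthetic_div b (z j)) =
        smult (r j) (Zj j * ([:- z j, 1:] * synthetic_div b (z j)))"
      by (simp only: mult_smult_right) (simp only: mult_ac)
  qed
  also have "\<dots> = (\<Sum>j<g. smult (r j) (Zj j) * b - smult (r j * poly b (z j)) (Zj j))"
    unfolding synthetic_div_mult by (intro sum.cong) (auto simp: algebra_simps smult_diff_right)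
  finally show ?thesis by (simp add: sum_subtractf sum_distrib_left mult_ac)
qed

lemma deg_lt_\<eta>: "deg_lt b (Suc g) \<Longrightarrow> deg_lt (\<eta> r b) g"
  unfolding \<eta>_def
proof (intro deg_lt_sum deg_lt_smult)
  fix j assume b: "deg_lt b (Suc g)"
  have k: "deg_lt [:poly b (z j):] (Suc g)" by (auto simp: deg_lt_iff)
  show "deg_lt (synthetic_div b (z j)) g"
    by (rule deg_lt_mult_linear[of "z j"], unfold synthetic_div_mult) (rule deg_lt_diff[OF b k])
qed

lemma degree_eq_g: "deg_lt b (Suc g) \<Longrightarrow> coeff b g \<noteq> 0 \<Longrightarrow> degree b = g"
  by (metis deg_lt_iff le_degree less_Suc_eq_le order_antisym coeff_0)

text \<open>After clearing denominators b R = S, where S has degree below deg b = g. So both vanish,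
  and the node values of R are the r_j up to nonzero factors.\<close>

lemma \<eta>_inj:
  assumes b: "deg_lt b (Suc g)" "coeff b g \<noteq> 0" and 0: "\<eta> r b = 0" and j: "j < g"
  shows "r j = 0"
proof -
  let ?R = "\<Sum>j<g. smult (r j) (Zj j)" and ?S = "\<Sum>j<g. smult (r j * poly b (z j)) (Zj j)"
  have eq: "b * ?R = ?S" using \<eta>_Z[of r b] 0 by simp
  have b0: "b \<noteq> 0" using b(2) by auto
  have "deg_lt ?S g" using Zj(1) by (intro deg_lt_sum deg_lt_smult) auto
  then have "?S = 0"
    using deg_lt_dvd_0[of b ?S g] b0 degree_eq_g[OF b] eq by (metis dvd_triv_left order_refl)
  then have "?R = 0" using eq b0 by simp
  then have "r j * poly (Zj j) (z j) = 0" using poly_sum_Zj[OF j, of r] by simp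
  then show ?thesis using Zj(2)[OF j] by simp
qed

text \<open>The cleared equation asks for R and S of degree below g with b R - S = Z h and S = b R
  at the nodes. Division of Z h by b supplies them, because Z vanishes at the nodes.\<close>

lemma \<eta>_surj:
  assumes b: "deg_lt b (Suc g)" "coeff b g \<noteq> 0" and h: "deg_lt h g"
  shows "\<exists>r. \<eta> r b = h"
proof -
  let ?Z = "\<Prod>j<g. [:- z j, 1:]"
  have b0: "b \<noteq> 0" using b(2) by auto
  have degZ: "degree ?Z = g" by (simp add: degree_prod_eq_sum_degree)
  have Z0: "?Z \<noteq> 0" by simp
  define R where "R = (?Z * h) div b"
  define S where "S = - ((?Z * h) mod b)"
  have RS: "b * R - S = ?Z * h" by (simp add: R_def S_def)
  have degS: "deg_lt S g"
  proof (cases "g = 0")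
    case True
    then have "h = 0" using h by (simp add: deg_lt_iff)
    then show ?thesis by (simp add: S_def deg_lt_0)
  next
    case False
    then have "deg_lt ((?Z * h) mod b) g"
      using degree_mod_less[OF b0, of "?Z * h"] degree_eq_g[OF b] by (auto simp: deg_lt_iff)
    then show ?thesis unfolding S_def by (rule deg_lt_minus)
  qed
  have degR: "deg_lt R g"
  proof (cases "R = 0 \<or> h = 0")
    case False
    have "degree (?Z * h) < g + g"
      using h False Z0 degZ by (simp add: degree_mult_eq deg_lt_iff del: prod_zero_iff)
    moreover have "degree S < g" if "S \<noteq> 0" using degS that by (simp add: deg_lt_iff)
    moreover have "degree (b * R) = g + degree R" using b0 False by (simp add: degree_mult_eq degree_eq_g[OF b])
    moreover have "b * R = ?Z * h + S" using RS by (simp add: algebra_simps)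
    ultimately have "g + degree R < g + g"
      using degree_add_le_max[of "?Z * h" S] by (cases "S = 0") auto
    then show ?thesis by (simp add: deg_lt_iff)
  qed (auto simp: deg_lt_iff R_def)
  define r where "r j = poly R (z j) / poly (Zj j) (z j)" for j
  have R: "R = (\<Sum>j<g. smult (r j) (Zj j))" unfolding r_def by (rule lagrange[OF degR])
  have "S = (\<Sum>j<g. smult (poly S (z j) / poly (Zj j) (z j)) (Zj j))" by (rule lagrange[OF degS])
  also have "\<dots> = (\<Sum>j<g. smult (r j * poly b (z j)) (Zj j))"
  proof (intro sum.cong refl)
    fix j assume "j \<in> {..<g}"
    then have "poly ?Z (z j) = 0" by (auto simp: poly_prod)
    then have "poly S (z j) = poly b (z j) * poly R (z j)"
      using arg_cong[OF RS, of "\<lambda>p. poly p (z j)"] by simp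
    then show "smult (poly S (z j) / poly (Zj j) (z j)) (Zj j) = smult (r j * poly b (z j)) (Zj j)"
      by (simp add: r_def mult.commute)
  qed
  finally have S: "S = (\<Sum>j<g. smult (r j * poly b (z j)) (Zj j))" .
  have "?Z * \<eta> r b = ?Z * h" unfolding \<eta>_Z RS[symmetric] by (simp only: R[symmetric] S[symmetric])
  then show ?thesis using Z0 mult_cancel_left by blast
qed

lemma kernel:
  assumes b: "deg_lt b (Suc g)" "coeff b g \<noteq> 0" and ncr: "no_common_root b c ([:0, 1:] * \<alpha>)"
    and A: "VA r b c = 0" and B: "VB r \<alpha> b + smult s b = 0" and j: "j < g"
  shows "r j = 0"
proof -
  obtain u v w where uvw: "u * b + v * c + w * ([:0, 1:] * \<alpha>) = 1" using no_common_root_bezout[OF ncr] by blast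
  let ?h = "\<eta> r b"
  have 1: "c * ?h = b * \<eta> r c" using A by (simp add: VA_\<eta>)
  have 2: "2 * [:0, 1:] * \<alpha> * ?h = b * (2 * [:0, 1:] * \<eta> r \<alpha> + [:\<sigma> r \<alpha> + s:])"
  proof -
    have "2 * [:0, 1:] * (b * \<eta> r \<alpha> - \<alpha> * ?h) + [:\<sigma> r \<alpha> + s:] * b = 0"
      using B unfolding VB_\<eta> by (simp add: smult_add_left add_ac)
    then show ?thesis by algebra
  qed
  have "2 * ?h = 2 * (u * b + v * c + w * ([:0, 1:] * \<alpha>)) * ?h" by (simp only: uvw mult_1_right)
  also have "\<dots> = b * (2 * u * ?h) + 2 * v * (c * ?h) + w * (2 * [:0, 1:] * \<alpha> * ?h)" by algebra
  also have "\<dots> = b * (2 * u * ?h + 2 * v * \<eta> r c + w * (2 * [:0, 1:] * \<eta> r \<alpha> + [:\<sigma> r \<alpha> + s:]))"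
    unfolding 1 2 by algebra
  finally have "b dvd 2 * ?h" by (rule dvdI)
  moreover have "2 * ?h = smult 2 ?h" by (simp add: numeral_poly)
  ultimately have "b dvd ?h" by (simp add: dvd_smult_iff)
  then have "?h = 0"
    using deg_lt_dvd_0[of b ?h g] deg_lt_\<eta>[OF b(1), of r] b degree_eq_g[OF b] by auto
  then show ?thesis by (rule \<eta>_inj[OF b _ j])
qed

text \<open>Stated for complex v: the reflection conjugates the coefficients, so once the flows are
  independent, preserving the reality condition means v = cnj v.\<close>

lemma star_VA:
  assumes "deg_lt b (Suc g)" "c = - star g b" "g > 0"
  shows "star (g - 1) (VA (\<lambda>j. v j * \<rho> j) b c) = - VA (\<lambda>j. cnj (v j) * \<rho> j) b c"
proof -
  have "star (g - 1) (smult (v j * \<rho> j) (bezoutian b c (z j))) = - smult (cnj (v j) * \<rho> j) (bezoutian b c (z j))" if "j < g" for j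
    using star_bezoutian[OF assms(1,2) unit[OF that] \<rho>[OF that] assms(3)]
    by (simp add: smult_smult[symmetric] star_smult del: smult_smult complex_cnj_mult)
  then show ?thesis unfolding VA_def star_sum sum_negf[symmetric] by (intro sum.cong) auto
qed

lemma star_VB:
  assumes "deg_lt \<alpha> g" "star (g - 1) \<alpha> = - \<alpha>" "deg_lt b (Suc g)" "c = - star g b" "g > 0"
  shows "star g (VB (\<lambda>j. v j * \<rho> j) \<alpha> b) = VB (\<lambda>j. cnj (v j) * \<rho> j) \<alpha> c"
proof -
  have "star g (smult (v j * \<rho> j) (lax_b \<alpha> b (z j))) = smult (cnj (v j) * \<rho> j) (lax_b \<alpha> c (z j))" if "j < g" for j
    using star_lax_b[OF assms(1-4) unit[OF that] \<rho>[OF that] assms(5)]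
    by (simp add: smult_smult[symmetric] star_smult del: smult_smult complex_cnj_mult)
  then show ?thesis unfolding VB_def star_sum by (intro sum.cong) auto
qed

lemma deg_lt_VA: "deg_lt b (Suc g) \<Longrightarrow> deg_lt c (Suc g) \<Longrightarrow> deg_lt (VA r b c) g"
  unfolding VA_def by (intro deg_lt_sum deg_lt_smult deg_lt_bezoutian)

lemma deg_lt_VB: "deg_lt \<alpha> g \<Longrightarrow> deg_lt b (Suc g) \<Longrightarrow> deg_lt (VB r \<alpha> b) (Suc g)"
  unfolding VB_def by (intro deg_lt_sum deg_lt_smult deg_lt_lax_b)

lemma V_curve: "2 * [:0, 1:] * \<alpha> * VA r b c + VB r \<alpha> b * c - b * VB r \<alpha> c = 0"
proof -
  have "2 * [:0, 1:] * \<alpha> * VA r b c + VB r \<alpha> b * c - b * VB r \<alpha> c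
     = (\<Sum>j<g. smult (r j) (2 * [:0, 1:] * \<alpha> * bezoutian b c (z j) + lax_b \<alpha> b (z j) * c - b * lax_b \<alpha> c (z j)))"
    unfolding VA_def VB_def sum_distrib_left sum_distrib_right sum.distrib[symmetric] sum_subtractf[symmetric]
    by (intro sum.cong refl) (simp only: mult_smult_right mult_smult_left smult_add_right smult_diff_right)
  then show ?thesis by (simp only: curve_tangent smult_0_right sum.neutral_const)
qed

lemma coeff_0_VB: "coeff (VB r \<alpha> b) 0 = \<sigma> r \<alpha> * coeff b 0"
  unfolding VB_def coeff_sum \<sigma>_def sum_distrib_right by (simp add: coeff_0_lax_b mult_ac)

lemma \<sigma>_real:
  assumes "deg_lt \<alpha> g" "star (g - 1) \<alpha> = - \<alpha>"
  shows "\<sigma> (\<lambda>j. of_real (v j) * \<rho> j) \<alpha> \<in> \<real>"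
proof (cases "g = 0")
  case False
  have *: "\<rho> j * poly \<alpha> (z j) \<in> \<real>" if "j < g" for j
    using evaluation_real[OF assms unit[OF that] \<rho>[OF that]] False by (simp only: Reals_cnj_iff)
  have "of_real (v j) * (\<rho> j * poly \<alpha> (z j)) \<in> \<real>" if "j < g" for j
    by (rule Reals_mult[OF Reals_of_real *[OF that]])
  then show ?thesis unfolding \<sigma>_def by (intro sum_in_Reals) (simp add: mult.assoc)
qed (unfold \<sigma>_def, simp)

end

lemma synthetic_div_sum:
  fixes p :: "'i \<Rightarrow> complex poly"
  shows "synthetic_div (\<Sum>i\<in>I. smult (r i) (p i)) w = (\<Sum>i\<in>I. smult (r i) (synthetic_div (p i) w))"
proof -
  have "[:- w, 1:] * synthetic_div (\<Sum>i\<in>I. smult (r i) (p i)) w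
      = [:- w, 1:] * (\<Sum>i\<in>I. smult (r i) (synthetic_div (p i) w))"
    unfolding sum_distrib_left mult_smult_right synthetic_div_mult poly_sum poly_smult
    by (rule poly_eqI) (simp add: coeff_sum coeff_pCons sum_subtractf algebra_simps split: nat.split)
  then show ?thesis by (simp only: mult_cancel_left) auto
qed

lemma smult_sum_right: "smult c (\<Sum>i\<in>I. p i) = (\<Sum>i\<in>I. smult c (p i))"
  by (induction I rule: infinite_finite_induct) (auto simp: smult_add_right)

lemma bezoutian_sum_left: "bezoutian (\<Sum>i\<in>I. smult (r i) (p i)) c w = (\<Sum>i\<in>I. smult (r i) (bezoutian (p i) c w))"
  and bezoutian_sum_right: "bezoutian b (\<Sum>i\<in>I. smult (r i) (p i)) w = (\<Sum>i\<in>I. smult (r i) (bezoutian b (p i) w))"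
  by (simp_all add: bezoutian_def synthetic_div_sum sum_distrib_left sum_distrib_right sum_subtractf smult_diff_right)

lemma lax_b_sum_left: "lax_b (\<Sum>i\<in>I. smult (r i) (p i)) b w = (\<Sum>i\<in>I. smult (r i) (lax_b (p i) b w))"
proof -
  have "smult (poly (\<Sum>i\<in>I. smult (r i) (p i)) w) b = (\<Sum>i\<in>I. smult (r i) (smult (poly (p i) w) b))"
    by (simp add: poly_sum smult_sum)
  then show ?thesis
    by (simp only: lax_b_def synthetic_div_sum smult_add_right sum.distrib sum_distrib_left sum_distrib_right
       sum_subtractf right_diff_distrib smult_diff_right mult_smult_left mult_smult_right)
qed

lemma lax_b_sum_right: "lax_b \<alpha> (\<Sum>i\<in>I. smult (r i) (p i)) w = (\<Sum>i\<in>I. smult (r i) (lax_b \<alpha> (p i) w))"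
  by (simp only: lax_b_def synthetic_div_sum smult_add_right sum.distrib sum_distrib_left sum_distrib_right
      sum_subtractf right_diff_distrib smult_diff_right mult_smult_left mult_smult_right smult_sum_right smult_smult mult.commute)

context nodes
begin

lemma VA_diff: "VA (\<lambda>j. r j - s j) b c = VA r b c - VA s b c"
  and VB_diff: "VB (\<lambda>j. r j - s j) \<alpha> b = VB r \<alpha> b - VB s \<alpha> b"
  by (simp_all add: VA_def VB_def smult_diff_left sum_subtractf)

text \<open>Away from double roots of the spectral polynomial \<open>2 \<lambda> \<alpha>\<close>, \<open>b\<close> and \<open>c\<close> are coprime, so every tangent vector
  is a Koszul syzygy; reducing modulo \<open>b\<close> brings it into the form of a flow, and the reality
  condition makes its coefficients real.\<close>

lemma tangent_space:
  assumes \<alpha>: "deg_lt \<alpha> g" "star (g - 1) \<alpha> = - \<alpha>" and b: "deg_lt b (Suc g)" "coeff b g \<noteq> 0"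
    and c: "c = - star g b" and b0: "coeff b 0 = \<i> * of_real t" "t \<noteq> 0"
    and ncr: "no_common_root b c ([:0, 1:] * \<alpha>)"
    and \<alpha>': "deg_lt \<alpha>' g" "star (g - 1) \<alpha>' = - \<alpha>'" and b': "deg_lt b' (Suc g)" "Re (coeff b' 0) = 0"
    and tan: "2 * [:0, 1:] * \<alpha> * \<alpha>' + b' * c - b * star g b' = 0" and g: "g > 0"
  shows "\<exists>v :: nat \<Rightarrow> real. \<alpha>' = VA (\<lambda>j. of_real (v j) * \<rho> j) b c \<and> b' = VB (\<lambda>j. of_real (v j) * \<rho> j) \<alpha> b"
proof -
  obtain u v w where uvw: "u * b + v * c + w * ([:0, 1:] * \<alpha>) = 1" using no_common_root_bezout[OF ncr] by blast
  have b_nz: "b \<noteq> 0" using b(2) by auto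
  have degb: "degree b = g" by (rule degree_eq_g[OF b])
  have c1: "deg_lt c (Suc g)" unfolding c by (intro deg_lt_minus deg_lt_star)
  \<comment> \<open>Dictated by the Bezout identity: if \<alpha>' = c h and b' = - 2 \<lambda>
    \<alpha> h modulo b, then h = (v c + w \<lambda> \<alpha>) h = v \<alpha>' - w b' / 2 modulo
    b.\<close>
  define h0 where "h0 = v * \<alpha>' - smult (1/2) (w * b')"
  define h where "h = h0 mod b"
  have two: "p = 2 * smult (1/2) p" for p :: "complex poly" by (simp add: numeral_poly)
  have e1: "2 * (c * h0 - \<alpha>') = b * (- (w * star g b') - 2 * u * \<alpha>')"
  proof -
    have "2 * h0 = 2 * v * \<alpha>' - w * b'"
      unfolding h0_def right_diff_distrib two[of "w * b'", symmetric] by (simp only: mult.assoc)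
    then show ?thesis using tan uvw by algebra
  qed
  have e2: "b' + 2 * [:0, 1:] * \<alpha> * h0 = b * (u * b' + v * star g b')"
  proof -
    have "2 * h0 = 2 * v * \<alpha>' - w * b'"
      unfolding h0_def right_diff_distrib two[of "w * b'", symmetric] by (simp only: mult.assoc)
    then show ?thesis using tan uvw by algebra
  qed
  have dvd2: "b dvd 2 * p \<Longrightarrow> b dvd p" for p
    using dvd_smult_iff[of 2 b p] by (simp add: numeral_poly)
  have hm: "b dvd q * h0 - q * h" for q
    unfolding h_def right_diff_distrib[symmetric] by (intro dvd_mult) (simp add: mod_eq_dvd_iff[symmetric])
  have d1: "b dvd c * h - \<alpha>'"
  proof -
    have "b dvd c * h0 - \<alpha>'" by (rule dvd2) (simp only: e1 dvd_triv_left)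
    then have "b dvd (c * h0 - \<alpha>') - (c * h0 - c * h)" using hm by (rule dvd_diff)
    then show ?thesis by simp
  qed
  have d2: "b dvd b' + 2 * [:0, 1:] * \<alpha> * h"
  proof -
    have "b dvd b' + 2 * [:0, 1:] * \<alpha> * h0" by (simp only: e2 dvd_triv_left)
    then have "b dvd (b' + 2 * [:0, 1:] * \<alpha> * h0) - (2 * [:0, 1:] * \<alpha> * h0 - 2 * [:0, 1:] * \<alpha> * h)" using hm by (rule dvd_diff)
    also have "(b' + 2 * [:0, 1:] * \<alpha> * h0) - (2 * [:0, 1:] * \<alpha> * h0 - 2 * [:0, 1:] * \<alpha> * h) = b' + 2 * [:0, 1:] * \<alpha> * h" by algebra
    finally show ?thesis .
  qed
  have "deg_lt h g"
    using degree_mod_less[OF b_nz, of h0] g by (auto simp: deg_lt_iff h_def degb)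
  then obtain r where r: "\<eta> r b = h" using \<eta>_surj[OF b] by blast
  have A: "\<alpha>' = VA r b c"
  proof -
    have "b dvd (c * h - \<alpha>') - b * \<eta> r c" by (rule dvd_diff[OF d1 dvd_triv_left])
    then have "b dvd VA r b c - \<alpha>'" by (simp add: VA_\<eta> r algebra_simps)
    then have "VA r b c - \<alpha>' = 0"
      using deg_lt_dvd_0[of b "VA r b c - \<alpha>'" g] deg_lt_diff[OF deg_lt_VA[OF b(1) c1] \<alpha>'(1)] b_nz degb by auto
    then show ?thesis by simp
  qed
  \<comment> \<open>b divides the difference, which has degree at most g = deg b, so the quotient is
    a constant s.\<close>
  have "\<exists>s. b' = VB r \<alpha> b + smult s b"
  proof -
    have "b' - VB r \<alpha> b = (b' + 2 * [:0, 1:] * \<alpha> * h) - b * (2 * [:0, 1:] * \<eta> r \<alpha> + [:\<sigma> r \<alpha>:])"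
      unfolding VB_\<eta> r by (simp add: algebra_simps)
    then have "b dvd b' - VB r \<alpha> b" by (simp only: dvd_diff[OF d2 dvd_triv_left])
    then obtain k where k: "b' - VB r \<alpha> b = b * k" by blast
    have "deg_lt (b * k) (Suc g)" unfolding k[symmetric] by (intro deg_lt_diff b' deg_lt_VB \<alpha> b)
    then have "degree k = 0" using b_nz degb by (cases "k = 0") (auto simp: deg_lt_iff degree_mult_eq)
    then obtain s where "k = [:s:]" by (metis degree_eq_zeroE)
    then have "b' = VB r \<alpha> b + smult s b" using k by (simp add: algebra_simps)
    then show ?thesis by blast
  qed
  then obtain s where B: "b' = VB r \<alpha> b + smult s b" by blast
  define v where "v j = r j / \<rho> j" for j
  define r' where "r' j = cnj (v j) * \<rho> j" for j
  have rv: "r j = v j * \<rho> j" if "j < g" for j using \<rho>_nz[OF that] by (simp add: v_def)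
  have VAr: "VA r b c = VA (\<lambda>j. v j * \<rho> j) b c" "VB r \<alpha> q = VB (\<lambda>j. v j * \<rho> j) \<alpha> q" for q
    unfolding VA_def VB_def by (intro sum.cong; simp add: rv)+
  have A': "VA r b c = VA r' b c"
    using star_VA[OF b(1) c g, of v] \<alpha>'(2) unfolding A r'_def VAr by simp
  have star_b': "star g b' = VB r' \<alpha> c - smult (cnj s) c"
    using star_VB[OF \<alpha> b(1) c g, of v] unfolding B VAr r'_def[symmetric]
    by (simp add: star_add star_smult c)
  have "b * star g b' = b * (VB r \<alpha> c + smult s c)"
    using tan V_curve[of \<alpha> r b c] unfolding A B by (simp add: algebra_simps)
  then have "star g b' = VB r \<alpha> c + smult s c" using b_nz by (metis mult_cancel_left)
  then have B': "VB (\<lambda>j. r j - r' j) \<alpha> c + smult (s + cnj s) c = 0"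
    unfolding star_b' VB_diff by (simp add: smult_add_left algebra_simps)
  \<comment> \<open>The coefficients minus their conjugates lie in the kernel of the flow map, now
    for the pair (c, b), since the reflection has produced an equation for c.\<close>
  have ncr': "no_common_root c b ([:0, 1:] * \<alpha>)" using ncr by (auto simp: no_common_root_def)
  have cg: "coeff c g \<noteq> 0" using b0 by (simp add: c coeff_star)
  have rr: "r j - r' j = 0" if "j < g" for j
  proof (rule kernel[OF c1 cg ncr' _ B' that])
    show "VA (\<lambda>j. r j - r' j) c b = 0"
      using A' by (simp add: VA_diff VA_def bezoutian_swap[of c b] sum_negf)
  qed
  have "VB (\<lambda>j. r j - r' j) \<alpha> c = 0" unfolding VB_def by (intro sum.neutral) (simp add: rr)
  then have "smult (s + cnj s) c = 0" using B' by simp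
  moreover have "c \<noteq> 0" using cg by auto
  ultimately have s: "Re s = 0" by (simp add: complex_eq_iff)
  have vreal: "v j = of_real (Re (v j))" if "j < g" for j
  proof -
    have "v j * \<rho> j = cnj (v j) * \<rho> j" using rr[OF that] rv[OF that] by (simp add: r'_def)
    then have "v j = cnj (v j)" using \<rho>_nz[OF that] by simp
    then show ?thesis by (metis Reals_cnj_iff of_real_Re)
  qed
  define v' where "v' j = Re (v j)" for j
  have r_eq: "r j = of_real (v' j) * \<rho> j" if "j < g" for j
    using rv[OF that] vreal[OF that] by (simp add: v'_def)
  have V_eq: "VA r b c = VA (\<lambda>j. of_real (v' j) * \<rho> j) b c" "VB r \<alpha> b = VB (\<lambda>j. of_real (v' j) * \<rho> j) \<alpha> b"
    unfolding VA_def VB_def by (intro sum.cong; simp add: r_eq)+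
  have "\<sigma> r \<alpha> = \<sigma> (\<lambda>j. of_real (v' j) * \<rho> j) \<alpha>" unfolding \<sigma>_def by (intro sum.cong) (auto simp: r_eq)
  then have "Im (\<sigma> r \<alpha>) = 0" using \<sigma>_real[OF \<alpha>, of v'] by (simp add: complex_is_Real_iff)
  \<comment> \<open>The reflection has made s imaginary. Since b(0) and b'(0) are imaginary and
    \<sigma> is real, s is real as well.\<close>
  moreover have "coeff b' 0 = (\<sigma> r \<alpha> + s) * coeff b 0" by (simp add: B coeff_0_VB algebra_simps)
  ultimately have "Im s = 0" using b'(2) b0 by simp
  then have "s = 0" using s by (simp add: complex_eq_iff)
  then show ?thesis using A B V_eq by auto
qed

lemma sum_nodes_eval:
  assumes "deg_lt h g"
  shows "(\<Sum>j<g. poly (Zj j) \<beta> / poly (Zj j) (z j) * poly h (z j)) = poly h \<beta>"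
proof -
  have "poly h \<beta> = poly (\<Sum>j<g. smult (poly h (z j) / poly (Zj j) (z j)) (Zj j)) \<beta>"
    using lagrange[OF assms] by simp
  then show ?thesis by (simp add: poly_sum mult_ac)
qed

text \<open>The Schur--Cohn criterion: a root of \<open>b\<close> inside the unit disc yields a positive direction of the
  Bezoutian form of \<open>b\<close> and \<open>c\<close>. The real form is extended to complex directions as a Hermitian form,
  and the positive direction is evaluation at the root.\<close>

lemma bezoutian_positive:
  assumes b: "deg_lt b (Suc g)" and c: "c = - star g b" and \<beta>: "poly b \<beta> = 0" "poly c \<beta> \<noteq> 0" "norm \<beta> < 1" "\<beta> \<noteq> 0"
    and g: "g > 0"
  shows "\<exists>v :: nat \<Rightarrow> real. (\<Sum>i<g. \<Sum>j<g. v i * v j * Re (\<rho> i * \<rho> j * poly (bezoutian b c (z i)) (z j))) > 0"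
proof -
  have c1: "deg_lt c (Suc g)" unfolding c by (intro deg_lt_minus deg_lt_star)
  define H where "H i j = \<rho> i * \<rho> j * poly (bezoutian b c (z i)) (z j)" for i j
  have H_sym: "H i j = H j i" for i j unfolding H_def by (subst bezoutian_sym) simp
  \<comment> \<open>Lagrange weights: pairing with them evaluates a polynomial of degree below g at
    \<beta>, and pairing with their conjugates evaluates it, up to a factor, at the mirror image 1 /
    cnj \<beta>.\<close>
  define w where "w j = poly (Zj j) \<beta> / (\<rho> j * poly (Zj j) (z j))" for j
  have w: "(\<Sum>j<g. w j * (\<rho> j * poly h (z j))) = poly h \<beta>" if "deg_lt h g" for h
  proof -
    have "(\<Sum>j<g. w j * (\<rho> j * poly h (z j))) = (\<Sum>j<g. poly (Zj j) \<beta> / poly (Zj j) (z j) * poly h (z j))"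
      using \<rho>_nz by (intro sum.cong) (auto simp: w_def)
    then show ?thesis using sum_nodes_eval[OF that] by simp
  qed
  have w': "(\<Sum>j<g. cnj (w j) * (\<rho> j * poly h (z j))) = - cnj (\<beta> ^ (g - 1)) * poly h (inverse (cnj \<beta>))" if h: "deg_lt h g" for h
  proof -
    have h': "deg_lt h (Suc (g - 1))" using h g by simp
    have "cnj (w j) * (\<rho> j * poly h (z j)) = - cnj (w j * (\<rho> j * poly (star (g - 1) h) (z j)))" if j: "j < g" for j
    proof -
      have zj: "z j \<noteq> 0" using unit[OF j] by auto
      have "cnj (poly (star (g - 1) h) (z j)) = cnj (z j) ^ (g - 1) * poly h (z j)"
        using poly_star[OF h' zj] by (simp add: inverse_cnj_unit[OF unit[OF j]])
      moreover have "- cnj (\<rho> j) * cnj (z j) ^ (g - 1) = \<rho> j"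
        using arg_cong[OF \<rho>[OF j], of cnj] by (simp add: minus_equation_iff)
      moreover have "- cnj (w j * (\<rho> j * poly (star (g - 1) h) (z j)))
          = cnj (w j) * ((- cnj (\<rho> j) * cnj (z j) ^ (g - 1)) * poly h (z j))"
        using calculation(1) by simp
      ultimately show ?thesis by simp
    qed
    then have "(\<Sum>j<g. cnj (w j) * (\<rho> j * poly h (z j))) = - cnj (\<Sum>j<g. w j * (\<rho> j * poly (star (g - 1) h) (z j)))"
      by (simp add: sum_negf)
    also have "\<dots> = - cnj (poly (star (g - 1) h) \<beta>)"
      using deg_lt_star[of "g - 1" h] g by (subst w) auto
    also have "\<dots> = - cnj (\<beta> ^ (g - 1)) * poly h (inverse (cnj \<beta>))"
      using poly_star[OF h' \<beta>(4)] by simp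
    finally show ?thesis .
  qed
  define \<mu> where "\<mu> = inverse (cnj \<beta>)"
  define N where "N = 1 - (norm \<beta>)\<^sup>2"
  have N: "N > 0" using \<beta>(3) by (simp add: N_def abs_square_less_1)
  have c\<beta>: "poly c \<beta> = - (\<beta> ^ g * cnj (poly b \<mu>))" using poly_star[OF b \<beta>(4)] by (simp add: c \<mu>_def)
  then have b\<mu>: "poly b \<mu> \<noteq> 0" using \<beta>(2) by auto
  have \<mu>\<beta>: "\<mu> - \<beta> = of_real N / cnj \<beta>"
    using \<beta>(4) complex_norm_square[of \<beta>] by (simp add: \<mu>_def N_def field_simps)
  have \<mu>\<beta>': "\<mu> \<noteq> \<beta>" using \<mu>\<beta> N \<beta>(4) by auto
  have "(\<Sum>i<g. \<Sum>j<g. w i * cnj (w j) * H i j) = (\<Sum>j<g. cnj (w j) * (\<rho> j * (\<Sum>i<g. w i * (\<rho> i * poly (bezoutian b c (z j)) (z i)))))"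
    unfolding H_def sum_distrib_left by (subst sum.swap, intro sum.cong refl, subst bezoutian_sym) (simp add: mult_ac)
  also have "\<dots> = (\<Sum>j<g. cnj (w j) * (\<rho> j * poly (bezoutian b c \<beta>) (z j)))"
    using deg_lt_bezoutian[OF b c1] by (simp add: w bezoutian_sym[of b c _ \<beta>])
  also have "\<dots> = - cnj (\<beta> ^ (g - 1)) * poly (bezoutian b c \<beta>) \<mu>"
    unfolding \<mu>_def by (rule w'[OF deg_lt_bezoutian[OF b c1]])
  also have "\<dots> = cnj (\<beta> ^ (g - 1)) * (poly b \<mu> * (\<beta> ^ g * cnj (poly b \<mu>))) / (of_real N / cnj \<beta>)"
    unfolding poly_bezoutian[OF \<mu>\<beta>'] \<mu>\<beta> \<beta>(1) c\<beta> by simp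
  also have "\<dots> = (cnj \<beta> ^ g * \<beta> ^ g) * (poly b \<mu> * cnj (poly b \<mu>)) / of_real N"
    using g \<beta>(4) N by (simp add: field_simps power_eq_if[of _ g])
  also have "\<dots> = of_real ((norm \<beta>) ^ (2 * g) * (norm (poly b \<mu>))\<^sup>2 / N)"
  proof -
    have "cnj \<beta> ^ g * \<beta> ^ g = of_real (norm \<beta> ^ (2 * g))"
      by (simp add: power_mult_distrib[symmetric] power_mult complex_norm_square mult.commute del: of_real_power)
        (simp add: complex_norm_square[symmetric] of_real_power[symmetric] power_mult[symmetric] mult.commute del: of_real_power)
    moreover have "poly b \<mu> * cnj (poly b \<mu>) = of_real ((norm (poly b \<mu>))\<^sup>2)" by (simp only: complex_norm_square)
    ultimately show ?thesis by (simp only: of_real_mult of_real_divide)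
  qed
  \<comment> \<open>The value of the Hermitian form is |\<beta>|^(2g) |b(\<mu>)|^2 / (1 -
    |\<beta>|^2); its sign is decided by \<beta> lying inside the disc.\<close>
  finally have pos: "Re (\<Sum>i<g. \<Sum>j<g. w i * cnj (w j) * H i j) > 0"
    using N b\<mu> \<beta>(4) by simp
  \<comment> \<open>The Hermitian value is the sum of the values of the real form at the real and
    imaginary parts of w, as the cross terms cancel by symmetry of H; one of the two is
    positive.\<close>
  define x where "x j = Re (w j)" for j
  define y where "y j = Im (w j)" for j
  have "Re (\<Sum>i<g. \<Sum>j<g. w i * cnj (w j) * H i j) =
     (\<Sum>i<g. \<Sum>j<g. x i * x j * Re (H i j)) + (\<Sum>i<g. \<Sum>j<g. y i * y j * Re (H i j))
     + ((\<Sum>i<g. \<Sum>j<g. x i * y j * Im (H i j)) - (\<Sum>i<g. \<Sum>j<g. y i * x j * Im (H i j)))"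
    by (simp add: x_def y_def sum.distrib[symmetric] sum_subtractf[symmetric] algebra_simps)
  also have "(\<Sum>i<g. \<Sum>j<g. y i * x j * Im (H i j)) = (\<Sum>i<g. \<Sum>j<g. x i * y j * Im (H i j))"
    by (subst sum.swap) (simp add: H_sym[of _] mult_ac)
  finally have "(\<Sum>i<g. \<Sum>j<g. x i * x j * Re (H i j)) + (\<Sum>i<g. \<Sum>j<g. y i * y j * Re (H i j)) > 0"
    using pos by simp
  then have "(\<Sum>i<g. \<Sum>j<g. x i * x j * Re (H i j)) > 0 \<or> (\<Sum>i<g. \<Sum>j<g. y i * y j * Re (H i j)) > 0" by linarith
  then show ?thesis unfolding H_def by blast
qed

lemma \<sigma>_zero:
  assumes "deg_lt \<alpha> g" "\<And>v :: nat \<Rightarrow> real. \<sigma> (\<lambda>j. of_real (v j) * \<rho> j) \<alpha> = 0"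
  shows "\<alpha> = 0"
proof (rule zero_by_nodes[OF assms(1)])
  fix i assume i: "i < g"
  have "\<sigma> (\<lambda>j. of_real (if j = i then 1 else 0) * \<rho> j) \<alpha> = (\<Sum>j<g. if j = i then \<rho> i * poly \<alpha> (z i) else 0)"
    unfolding \<sigma>_def by (intro sum.cong) auto
  then have "\<rho> i * poly \<alpha> (z i) = 0" using assms(2)[of "\<lambda>j. if j = i then 1 else 0"] i by simp
  then show "poly \<alpha> (z i) = 0" using \<rho>_nz[OF i] by simp
qed

lemma VA_commute: "VA s (VB r \<alpha> b) c - VA s b (VB r \<alpha> c) = VA r (VB s \<alpha> b) c - VA r b (VB s \<alpha> c)"
proof -
  have "VA s (VB r \<alpha> b) c - VA s b (VB r \<alpha> c) = (\<Sum>j<g. \<Sum>i<g. smult (s j * r i)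
      (bezoutian (lax_b \<alpha> b (z i)) c (z j) - bezoutian b (lax_b \<alpha> c (z i)) (z j)))" for r s
    by (simp add: VA_def VB_def bezoutian_sum_left bezoutian_sum_right smult_sum_right sum_subtractf[symmetric] smult_diff_right)
  note eq = this
  show ?thesis unfolding eq by (subst sum.swap) (simp add: bezoutian_commute[of \<alpha> b "z _" c "z _"] mult.commute)
qed

lemma VB_commute: "VB s (VA r b c) b + VB s \<alpha> (VB r \<alpha> b) = VB r (VA s b c) b + VB r \<alpha> (VB s \<alpha> b)"
proof -
  have "VB s (VA r b c) b + VB s \<alpha> (VB r \<alpha> b) = (\<Sum>j<g. \<Sum>i<g. smult (s j * r i)
      (lax_b (bezoutian b c (z i)) b (z j) + lax_b \<alpha> (lax_b \<alpha> b (z i)) (z j)))" for r s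
    by (simp add: VA_def VB_def lax_b_sum_left lax_b_sum_right smult_sum_right sum.distrib[symmetric] smult_add_right)
  note eq = this
  show ?thesis unfolding eq by (subst sum.swap) (simp add: lax_b_commute[of b c "z _" "z _" \<alpha>] mult.commute)
qed

end

section \<open>The isospectral set as an invariant set\<close>

lemma bounded_bilinear_outer:
  assumes "bounded_linear T" "bounded_bilinear B"
  shows "bounded_bilinear (\<lambda>x y. T (B x y))"
proof -
  interpret T: bounded_linear T by fact
  interpret B: bounded_bilinear B by fact
  obtain K where K: "\<And>a b. norm (B a b) \<le> norm a * norm b * K" using B.bounded by blast
  obtain C where C: "C \<ge> 0" "\<And>x. norm (T x) \<le> norm x * C" using T.nonneg_bounded by blast
  show ?thesis
  proof
    have "norm (T (B a b)) \<le> norm a * norm b * (K * C)" for a b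
      using order_trans[OF C(2) mult_right_mono[OF K[of a b] C(1)]] by (simp add: mult_ac)
    then show "\<exists>K. \<forall>a b. norm (T (B a b)) \<le> norm a * norm b * K" by blast
  qed (simp_all add: B.add_left B.add_right B.scaleR_left B.scaleR_right T.add T.scaleR)
qed

lemma bounded_bilinear_plus:
  assumes "bounded_bilinear B" "bounded_bilinear C"
  shows "bounded_bilinear (\<lambda>x y. B x y + C x y)"
proof -
  interpret B: bounded_bilinear B by fact
  interpret C: bounded_bilinear C by fact
  obtain K where K: "\<And>a b. norm (B a b) \<le> norm a * norm b * K" using B.bounded by blast
  obtain L where L: "\<And>a b. norm (C a b) \<le> norm a * norm b * L" using C.bounded by blast
  show ?thesis
  proof
    have "norm (B a b + C a b) \<le> norm a * norm b * (K + L)" for a b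
      using norm_triangle_mono[OF K[of a b] L[of a b]] by (simp add: algebra_simps)
    then show "\<exists>K. \<forall>a b. norm (B a b + C a b) \<le> norm a * norm b * K" by blast
  qed (simp_all add: B.add_left B.add_right B.scaleR_left B.scaleR_right C.add_left C.add_right C.scaleR_left C.scaleR_right
       algebra_simps)
qed

lemma bounded_bilinear_zero: "bounded_bilinear (\<lambda>x y. 0)"
  by (unfold_locales) (auto intro: exI[of _ 0])

lemma bounded_bilinear_sum:
  "(\<And>j. j \<in> J \<Longrightarrow> bounded_bilinear (B j)) \<Longrightarrow> bounded_bilinear (\<lambda>x y. \<Sum>j\<in>J. B j x y)"
  by (induction J rule: infinite_finite_induct) (auto simp: bounded_bilinear_zero bounded_bilinear_plus)

definition unit_seq :: "nat \<Rightarrow> 'a::real_normed_vector \<Rightarrow> nat \<Rightarrow>\<^sub>C 'a" where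
  "unit_seq k c = Bcontfun (\<lambda>i. if i = k then c else 0)"

definition seq_of :: "nat \<Rightarrow> (nat \<Rightarrow> 'a::real_normed_vector) \<Rightarrow> nat \<Rightarrow>\<^sub>C 'a" where
  "seq_of n f = (\<Sum>k<n. unit_seq k (f k))"

lemma apply_unit_seq: "apply_bcontfun (unit_seq k c) i = (if i = k then c else 0)"
proof -
  have "(\<lambda>i. if i = k then c else 0) \<in> bcontfun"
    by (rule bcontfun_normI[of _ "norm c"]) (auto simp: continuous_on_open_vimage open_discrete)
  then show ?thesis by (simp add: unit_seq_def Bcontfun_inverse)
qed

lemma apply_bcontfun_sum: "apply_bcontfun (\<Sum>k\<in>K. f k) i = (\<Sum>k\<in>K. apply_bcontfun (f k) i)"
  by (induction K rule: infinite_finite_induct) auto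

lemma apply_seq_of: "apply_bcontfun (seq_of n f) i = (if i < n then f i else 0)"
  by (simp add: seq_of_def apply_bcontfun_sum apply_unit_seq)

lemma bounded_linear_unit_seq: "bounded_linear (unit_seq k)"
proof (rule bounded_linear_intro[where K = 1])
  show "norm (unit_seq k x) \<le> norm x * 1" for x :: 'a
    by (rule norm_bound) (simp add: apply_unit_seq)
qed (auto intro!: bcontfun_eqI simp: apply_unit_seq)

lemma bounded_linear_coordinate: "bounded_linear (\<lambda>x :: nat \<Rightarrow>\<^sub>C 'a::real_normed_vector. apply_bcontfun x k)"
  by (rule bounded_linear_intro[where K = 1]) (auto intro: norm_bounded)

lemma bounded_linear_seq_of:
  "(\<And>k. bounded_linear (\<lambda>x. f x k)) \<Longrightarrow> bounded_linear (\<lambda>x. seq_of n (f x))"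
  unfolding seq_of_def by (intro bounded_linear_sum bounded_linear_compose[OF bounded_linear_unit_seq])

lemma bounded_bilinear_seq_of:
  "(\<And>k. bounded_bilinear (\<lambda>x y. f x y k)) \<Longrightarrow> bounded_bilinear (\<lambda>x y. seq_of n (f x y))"
  unfolding seq_of_def by (intro bounded_bilinear_sum bounded_bilinear_outer[OF bounded_linear_unit_seq])

text \<open>Boundedness of polynomial-valued maps is expressed coefficient by coefficient; under a
  degree bound this also controls evaluation.\<close>

definition coeff_linear :: "('x::real_normed_vector \<Rightarrow> complex poly) \<Rightarrow> bool" where
  "coeff_linear F \<longleftrightarrow> (\<forall>k. bounded_linear (\<lambda>x. coeff (F x) k))"

definition coeff_bilinear :: "('x::real_normed_vector \<Rightarrow> 'y::real_normed_vector \<Rightarrow> complex poly) \<Rightarrow> bool" where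
  "coeff_bilinear G \<longleftrightarrow> (\<forall>k. bounded_bilinear (\<lambda>x y. coeff (G x y) k))"

lemma coeff_linear_minus: "coeff_linear F \<Longrightarrow> coeff_linear (\<lambda>x. - F x)"
  by (auto simp: coeff_linear_def intro: bounded_linear_minus)

lemma coeff_linear_star: "coeff_linear F \<Longrightarrow> coeff_linear (\<lambda>x. star n (F x))"
  unfolding coeff_linear_def coeff_star
proof
  fix k assume F: "\<forall>k. bounded_linear (\<lambda>x. coeff (F x) k)"
  show "bounded_linear (\<lambda>x. if k \<le> n then cnj (coeff (F x) (n - k)) else 0)"
    by (cases "k \<le> n") (use F in \<open>auto intro: bounded_linear_compose[OF bounded_linear_cnj]\<close>)
qed

lemma coeff_bilinear_add: "coeff_bilinear F \<Longrightarrow> coeff_bilinear G \<Longrightarrow> coeff_bilinear (\<lambda>x y. F x y + G x y)"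
  by (auto simp: coeff_bilinear_def intro: bounded_bilinear_plus)

lemma coeff_bilinear_smult: "coeff_bilinear F \<Longrightarrow> coeff_bilinear (\<lambda>x y. smult c (F x y))"
  by (auto simp: coeff_bilinear_def intro: bounded_bilinear_outer[OF bounded_linear_mult_right])

lemma coeff_bilinear_diff: "coeff_bilinear F \<Longrightarrow> coeff_bilinear G \<Longrightarrow> coeff_bilinear (\<lambda>x y. F x y - G x y)"
  using coeff_bilinear_add[of F "\<lambda>x y. smult (-1) (G x y)"] coeff_bilinear_smult[of G "-1"] by simp

lemma coeff_bilinear_mult:
  assumes "coeff_linear F" "coeff_linear G"
  shows "coeff_bilinear (\<lambda>x y. F x * G y)" "coeff_bilinear (\<lambda>x y. F y * G x)"
proof -
  show "coeff_bilinear (\<lambda>x y. F x * G y)"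
    using assms unfolding coeff_linear_def coeff_bilinear_def coeff_mult
    by (intro allI bounded_bilinear_sum bounded_bilinear.comp[OF bounded_bilinear_mult]) auto
  then show "coeff_bilinear (\<lambda>x y. F y * G x)"
    unfolding coeff_bilinear_def by (auto dest: bounded_bilinear.flip)
qed

lemma coeff_bilinear_const_mult: "coeff_bilinear G \<Longrightarrow> coeff_bilinear (\<lambda>x y. c * G x y)"
  unfolding coeff_bilinear_def coeff_mult
  by (intro allI bounded_bilinear_sum bounded_bilinear_outer[OF bounded_linear_mult_right]) auto

lemma bounded_linear_poly:
  assumes "coeff_linear F" "\<And>x. deg_lt (F x) n"
  shows "bounded_linear (\<lambda>x. poly (F x) w)"
proof -
  have "poly (F x) w = (\<Sum>i<n. coeff (F x) i * w ^ i)" for x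
  proof (cases "F x = 0")
    case False
    then show ?thesis
      using assms(2)[of x] by (subst poly_altdef, intro sum.mono_neutral_left) (auto simp: deg_lt_iff coeff_eq_0)
  qed simp
  then show ?thesis
    using assms(1) unfolding coeff_linear_def
    by (simp only:) (intro bounded_linear_sum bounded_linear_compose[OF bounded_linear_mult_left], auto)
qed

text \<open>Horner recursion: each coefficient of the quotient is computed from the one above it, so
  the induction runs downward from the degree bound n.\<close>

lemma coeff_linear_synthetic_div:
  assumes F: "coeff_linear F" "\<And>x. deg_lt (F x) n"
  shows "coeff_linear (\<lambda>x. synthetic_div (F x) w)"
proof -
  have rec: "coeff (synthetic_div (F x) w) k = coeff (F x) (Suc k) + w * coeff (synthetic_div (F x) w) (Suc k)" for x k
    using arg_cong[OF synthetic_div_correct[of "F x" w], of "\<lambda>p. coeff p (Suc k)"] by simp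
  have "bounded_linear (\<lambda>x. coeff (synthetic_div (F x) w) k)" for k
  proof (induction "n - k" arbitrary: k)
    case 0
    have "coeff (synthetic_div (F x) w) k = 0" for x
    proof (cases "degree (F x) = 0")
      case False
      then have "degree (synthetic_div (F x) w) < k"
        using F(2)[of x] 0 degree_synthetic_div[of "F x" w] by (auto simp: deg_lt_iff)
      then show ?thesis by (rule coeff_eq_0)
    qed (simp add: synthetic_div_eq_0_iff[THEN iffD2])
    then show ?case by simp
  next
    case (Suc m)
    then have IH: "bounded_linear (\<lambda>x. coeff (synthetic_div (F x) w) (Suc k))" by simp
    show ?case
      unfolding rec[of _ k] using F(1)
      by (intro bounded_linear_add bounded_linear_compose[OF bounded_linear_mult_right IH])
        (auto simp: coeff_linear_def)
  qed
  then show ?thesis by (simp add: coeff_linear_def)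
qed

text \<open>As the dimension depends on the term \<open>g\<close>, potentials and flow parameters live in sequence spaces with the
  supremum norm, of which only the first coordinates are used.\<close>

type_synonym state = "(nat \<Rightarrow>\<^sub>C complex) \<times> (nat \<Rightarrow>\<^sub>C complex)"

definition poly_of :: "nat \<Rightarrow> (nat \<Rightarrow>\<^sub>C complex) \<Rightarrow> complex poly" where
  "poly_of n x = (\<Sum>k<n. monom (apply_bcontfun x k) k)"

lemma coeff_poly_of: "coeff (poly_of n x) k = (if k < n then apply_bcontfun x k else 0)"
  unfolding poly_of_def by (simp add: coeff_sum sum.delta if_distrib[of "\<lambda>x. x = _"])

lemma deg_lt_poly_of: "deg_lt (poly_of n x) n"
  by (auto simp: deg_lt_def coeff_poly_of)

lemma coeff_linear_poly_of: "bounded_linear f \<Longrightarrow> coeff_linear (\<lambda>x. poly_of n (f x))"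
  unfolding coeff_linear_def coeff_poly_of
proof
  fix k assume f: "bounded_linear f"
  show "bounded_linear (\<lambda>x. if k < n then apply_bcontfun (f x) k else 0)"
    by (cases "k < n") (auto intro: bounded_linear_compose[OF bounded_linear_coordinate f])
qed

lemma poly_of_seq_of: "deg_lt p n \<Longrightarrow> poly_of n (seq_of n (coeff p)) = p"
  by (rule poly_eqI) (auto simp: coeff_poly_of apply_seq_of deg_lt_def)

context nodes
begin

definition al :: "state \<Rightarrow> complex poly" where "al x = poly_of g (fst x)"
definition be :: "state \<Rightarrow> complex poly" where "be x = poly_of (Suc g) (snd x)"
definition ga :: "state \<Rightarrow> complex poly" where "ga x = - star g (be x)"

text \<open>The bounds differ by one: \<alpha> has g coefficients, b has g + 1. On supported states
  \<open>al\<close> and \<open>be\<close> together lose nothing, see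
  \<open>state_eqI\<close>.\<close>

definition supported :: "state \<Rightarrow> bool" where
  "supported x \<longleftrightarrow> (\<forall>k\<ge>g. fst x k = 0) \<and> (\<forall>k>g. snd x k = 0)"

definition state_of :: "complex poly \<Rightarrow> complex poly \<Rightarrow> state" where
  "state_of p q = (seq_of g (coeff p), seq_of (Suc g) (coeff q))"

text \<open>A polarisation that is not symmetric: every product is split between x and y so as to be
  bilinear over the reals. The field at node j, with its phase, is the diagonal.\<close>

definition q :: "nat \<Rightarrow> state \<Rightarrow> state \<Rightarrow> state" where
  "q j x y = state_of (smult (\<rho> j) (bezoutian (be x) (ga y) (z j))) (smult (\<rho> j) (lax_b (al x) (be y) (z j)))"

definition coord :: "nat \<Rightarrow> (nat \<Rightarrow>\<^sub>C real) \<Rightarrow>\<^sub>L real" where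
  "coord j = Blinfun (\<lambda>v. apply_bcontfun v j)"

definition Q :: "state \<Rightarrow> state \<Rightarrow> (nat \<Rightarrow>\<^sub>C real) \<Rightarrow>\<^sub>L state" where
  "Q x y = (\<Sum>j<g. blinfun_scaleR_left (q j x y) o\<^sub>L coord j)"

abbreviation rv :: "(nat \<Rightarrow>\<^sub>C real) \<Rightarrow> nat \<Rightarrow> complex" where
  "rv v \<equiv> \<lambda>j. of_real (apply_bcontfun v j) * \<rho> j"

lemma deg_lt_al: "deg_lt (al x) g" and deg_lt_be: "deg_lt (be x) (Suc g)" and deg_lt_ga: "deg_lt (ga x) (Suc g)"
  by (simp_all add: al_def be_def ga_def deg_lt_poly_of deg_lt_minus deg_lt_star)

lemma coeff_linear_al: "coeff_linear al" and coeff_linear_be: "coeff_linear be" and coeff_linear_ga: "coeff_linear ga"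
  unfolding al_def[abs_def] be_def[abs_def] ga_def[abs_def]
  by (intro coeff_linear_minus coeff_linear_star coeff_linear_poly_of bounded_linear_fst bounded_linear_snd)+

lemma state_eqI: "supported x \<Longrightarrow> supported y \<Longrightarrow> al x = al y \<Longrightarrow> be x = be y \<Longrightarrow> x = y"
proof -
  assume s: "supported x" "supported y" and e: "al x = al y" "be x = be y"
  have "fst x k = fst y k" for k
    using s arg_cong[OF e(1), of "\<lambda>p. coeff p k"] by (cases "k < g") (auto simp: supported_def al_def coeff_poly_of)
  moreover have "snd x k = snd y k" for k
    using s arg_cong[OF e(2), of "\<lambda>p. coeff p k"] by (cases "k < Suc g") (auto simp: supported_def be_def coeff_poly_of)
  ultimately show "x = y" by (intro prod_eqI bcontfun_eqI)
qed

lemma state_of: "deg_lt p g \<Longrightarrow> al (state_of p r) = p" "deg_lt r (Suc g) \<Longrightarrow> be (state_of p r) = r"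
  "supported (state_of p r)"
  by (simp_all add: al_def be_def state_of_def poly_of_seq_of supported_def apply_seq_of)

lemma al_sum: "al (\<Sum>j\<in>J. c j *\<^sub>R y j) = (\<Sum>j\<in>J. smult (of_real (c j)) (al (y j)))"
  and be_sum: "be (\<Sum>j\<in>J. c j *\<^sub>R y j) = (\<Sum>j\<in>J. smult (of_real (c j)) (be (y j)))"
  by (rule poly_eqI, auto simp: al_def be_def coeff_poly_of coeff_sum fst_sum snd_sum apply_bcontfun_sum scaleR_conv_of_real)+

lemma supported_sum: "(\<And>j. j \<in> J \<Longrightarrow> supported (y j)) \<Longrightarrow> supported (\<Sum>j\<in>J. c j *\<^sub>R y j)"
  by (auto simp: supported_def fst_sum snd_sum apply_bcontfun_sum)

lemma Q_apply: "Q x y v = (\<Sum>j<g. apply_bcontfun v j *\<^sub>R q j x y)"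
proof -
  have "coord j v = apply_bcontfun v j" for j
    unfolding coord_def by (simp add: bounded_linear_Blinfun_apply bounded_linear_coordinate)
  then show ?thesis by (simp add: Q_def blinfun.sum_left)
qed

lemma al_Q: "al (Q x y v) = VA (rv v) (be x) (ga y)"
  and be_Q: "be (Q x y v) = VB (rv v) (al x) (be y)"
  and supported_Q: "supported (Q x y v)"
proof -
  have "al (q j x y) = smult (\<rho> j) (bezoutian (be x) (ga y) (z j))" for j
    unfolding q_def by (intro state_of deg_lt_smult deg_lt_bezoutian deg_lt_be deg_lt_ga)
  then show "al (Q x y v) = VA (rv v) (be x) (ga y)" by (simp add: Q_apply al_sum VA_def)
  have "be (q j x y) = smult (\<rho> j) (lax_b (al x) (be y) (z j))" for j
    unfolding q_def by (intro state_of deg_lt_smult deg_lt_lax_b deg_lt_be deg_lt_al)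
  then show "be (Q x y v) = VB (rv v) (al x) (be y)" by (simp add: Q_apply be_sum VB_def)
  show "supported (Q x y v)" unfolding Q_apply q_def by (intro supported_sum state_of)
qed

lemma bounded_bilinear_Q: "bounded_bilinear Q"
proof -
  have "bounded_bilinear (q j)" for j
  proof -
    have 1: "coeff_bilinear (\<lambda>x y. bezoutian (be x) (ga y) (z j))"
      unfolding bezoutian_def
      by (intro coeff_bilinear_diff coeff_bilinear_mult coeff_linear_ga coeff_linear_be
          coeff_linear_synthetic_div[OF coeff_linear_be deg_lt_be] coeff_linear_synthetic_div[OF coeff_linear_ga deg_lt_ga])
    have "bounded_bilinear (\<lambda>x y. coeff (smult (poly (al x) (z j)) (be y)) k)" for k
      unfolding coeff_smult using coeff_linear_be
      by (intro bounded_bilinear.comp[OF bounded_bilinear_mult] bounded_linear_poly[OF coeff_linear_al deg_lt_al])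
        (auto simp: coeff_linear_def)
    then have "coeff_bilinear (\<lambda>x y. smult (poly (al x) (z j)) (be y))" by (simp add: coeff_bilinear_def)
    then have 2: "coeff_bilinear (\<lambda>x y. lax_b (al x) (be y) (z j))"
      unfolding lax_b_def
      by (intro coeff_bilinear_add coeff_bilinear_const_mult coeff_bilinear_diff coeff_bilinear_mult coeff_linear_be coeff_linear_al
          coeff_linear_synthetic_div[OF coeff_linear_be deg_lt_be] coeff_linear_synthetic_div[OF coeff_linear_al deg_lt_al])
    have "bounded_linear (\<lambda>u :: nat \<Rightarrow>\<^sub>C complex. (u, 0 :: nat \<Rightarrow>\<^sub>C complex))" "bounded_linear (\<lambda>u :: nat \<Rightarrow>\<^sub>C complex. (0 :: nat \<Rightarrow>\<^sub>C complex, u))"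
      by (intro bounded_linear_Pair bounded_linear_ident bounded_linear_zero)+
    then have "bounded_bilinear (\<lambda>x y. (seq_of g (coeff (smult (\<rho> j) (bezoutian (be x) (ga y) (z j)))), 0)
        + (0, seq_of (Suc g) (coeff (smult (\<rho> j) (lax_b (al x) (be y) (z j))))))"
      using coeff_bilinear_smult[OF 1] coeff_bilinear_smult[OF 2]
      by (intro bounded_bilinear_plus bounded_bilinear_outer[where T = "\<lambda>u. (u, 0)"]
          bounded_bilinear_outer[where T = "\<lambda>u. (0, u)"] bounded_bilinear_seq_of) (auto simp: coeff_bilinear_def)
    then show ?thesis by (simp add: q_def[abs_def] state_of_def)
  qed
  then show ?thesis
    unfolding Q_def[abs_def]
    by (intro bounded_bilinear_sum bounded_bilinear_outer[where T = "\<lambda>w. blinfun_scaleR_left w o\<^sub>L coord _"]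
        bounded_linear_compose[OF bounded_bilinear.bounded_linear_left[OF bounded_bilinear_blinfun_compose]
        bounded_linear_blinfun_scaleR_left])
qed

end

section \<open>Potentials and states\<close>

text \<open>Since \<open>b = \<lambda> \<xi>\<^sub>1\<^sub>2\<close>, the coefficient of b with
  index k sits at exponent k - 1. For \<alpha> only the exponents from 0 to g - 1 are read: those at
  -1 and g vanish for potentials.\<close>

definition state_of_potential :: "nat \<Rightarrow> (int \<Rightarrow> complex^2^2) \<Rightarrow> state" where
  "state_of_potential g \<xi> = (seq_of g (\<lambda>k. \<xi> (int k) $ 1 $ 1), seq_of (Suc g) (\<lambda>k. \<xi> (int k - 1) $ 1 $ 2))"

text \<open>The guard 0 \<le> d matters at d = -1, where \<open>nat d\<close> would read the
  coefficient of index 0. The lower left entry is the reality condition: minus the conjugate of the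
  upper right entry at exponent g - 1 - d, which is the coefficient of b with index g - d.\<close>

definition potential_of_state :: "nat \<Rightarrow> state \<Rightarrow> int \<Rightarrow> complex^2^2" where
  "potential_of_state g x d = (if d \<in> {-1..int g} then
     (let A = (if 0 \<le> d then fst x (nat d) else 0) in
      vector [vector [A, snd x (nat (d + 1))], vector [- cnj (snd x (nat (int g - d))), - A]]) else 0)"

lemma sum_laurent: "(\<Sum>d = -1..int g. f d) = f (-1) + (\<Sum>k<Suc g. f (int k))"
proof -
  have "int ` {..<Suc g} = {0..int g}"
  proof (intro equalityI subsetI)
    fix d assume "d \<in> {0..int g}"
    then show "d \<in> int ` {..<Suc g}" by (intro image_eqI[of _ _ "nat d"]) auto
  qed auto
  then have "{-1..int g} = insert (-1) (int ` {..<Suc g})" by auto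
  moreover have "-1 \<notin> int ` {..<Suc g}" by auto
  ultimately show ?thesis by (simp add: sum.reindex)
qed

context nodes
begin

text \<open>The condition tr \<noteq> 0 on potentials is carried by a(0) = b(0) c(0) \<noteq> 0, a
  property of \<open>a\<close> alone; what remains are equations and the sign of the
  residue.\<close>

definition M :: "complex poly \<Rightarrow> state set" where
  "M a = {x. supported x \<and> star (g - 1) (al x) = - al x \<and> (\<exists>t>0. snd x 0 = \<i> * of_real t) \<and>
     [:0, 1:] * (al x)\<^sup>2 + be x * ga x = a}"

lemma coeff_al: "supported x \<Longrightarrow> coeff (al x) k = fst x k"
  and coeff_be: "supported x \<Longrightarrow> coeff (be x) k = snd x k"
  by (auto simp: al_def be_def coeff_poly_of supported_def)

lemma poly_al: "poly (al x) w = (\<Sum>k<g. fst x k * w ^ k)"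
  and poly_be: "poly (be x) w = (\<Sum>k<Suc g. snd x k * w ^ k)"
  by (simp_all add: al_def be_def poly_of_def poly_sum poly_monom del: sum.lessThan_Suc)

lemma potentials_state_of_potential:
  assumes \<xi>: "\<xi> \<in> potentials g"
  shows "potential_of_state g (state_of_potential g \<xi>) = \<xi>" "supported (state_of_potential g \<xi>)" "star (g - 1) (al (state_of_potential g \<xi>)) = - al (state_of_potential g \<xi>)"
    "\<exists>t>0. snd (state_of_potential g \<xi>) 0 = \<i> * of_real t" "poly (be (state_of_potential g \<xi>) * ga (state_of_potential g \<xi>)) 0 \<noteq> 0"
    "l \<noteq> 0 \<Longrightarrow> - l * det (laurent_eval g \<xi> l) = poly ([:0, 1:] * (al (state_of_potential g \<xi>))\<^sup>2 + be (state_of_potential g \<xi>) * ga (state_of_potential g \<xi>)) l"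
proof -
  have \<xi>': "\<forall>d. d \<notin> {-1..int g} \<longrightarrow> \<xi> d = 0"
    "\<exists>t::real. t > 0 \<and> \<xi> (-1) = vector [vector [0, \<i> * complex_of_real t], vector [0, 0]]"
    "trace (\<xi> (-1) ** \<xi> 0) \<noteq> 0"
    "\<forall>d \<in> {-1..int g}. \<xi> d \<in> sl2 \<and> \<xi> d = - conj_transpose (\<xi> (int g - 1 - d))"
    using \<xi> unfolding potentials_def by blast+
  have out: "\<xi> d = 0" if "d \<notin> {-1..int g}" for d using \<xi>'(1) that by blast
  obtain t where t: "t > 0" "\<xi> (-1) = vector [vector [0, \<i> * of_real t], vector [0, 0]]"
    using \<xi>'(2) by blast
  have m1: "\<xi> (-1) $ 1 $ 1 = 0" "\<xi> (-1) $ 1 $ 2 = \<i> * of_real t" "\<xi> (-1) $ 2 $ 1 = 0" "\<xi> (-1) $ 2 $ 2 = 0"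
    by (simp_all add: t)
  have nz: "\<xi> 0 $ 2 $ 1 \<noteq> 0" using \<xi>'(3) by (auto simp: trace_def matrix_matrix_mult_def sum_2 m1)
  have tr: "\<xi> d $ 2 $ 2 = - \<xi> d $ 1 $ 1" if "d \<in> {-1..int g}" for d
  proof -
    have "trace (\<xi> d) = 0" using \<xi>'(4) that unfolding sl2_def by blast
    then show ?thesis by (simp add: trace_def sum_2 add_eq_0_iff)
  qed
  have ct: "\<xi> d $ i $ j = - cnj (\<xi> (int g - 1 - d) $ j $ i)" if "d \<in> {-1..int g}" for d i j
  proof -
    have "\<xi> d = - conj_transpose (\<xi> (int g - 1 - d))" using \<xi>'(4) that by blast
    then have "\<xi> d $ i $ j = (- conj_transpose (\<xi> (int g - 1 - d))) $ i $ j" by simp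
    then show ?thesis by (simp add: conj_transpose_def transpose_def map_matrix_def)
  qed
  \<comment> \<open>The exponent g is the mirror image of -1, so the shape of the residue removes
    the upper row at g.\<close>
  have mg: "\<xi> (int g) $ 1 $ 1 = 0" "\<xi> (int g) $ 1 $ 2 = 0"
    using ct[of "int g" 1 1] ct[of "int g" 1 2] m1 by simp_all
  define x where "x = state_of_potential g \<xi>"
  have fx: "fst x k = (if k < g then \<xi> (int k) $ 1 $ 1 else 0)" for k by (simp add: x_def state_of_potential_def apply_seq_of)
  have sx: "snd x k = (if k < Suc g then \<xi> (int k - 1) $ 1 $ 2 else 0)" for k by (simp add: x_def state_of_potential_def apply_seq_of)
  show sup: "supported (state_of_potential g \<xi>)" unfolding x_def[symmetric] by (auto simp: supported_def fx sx)
  then have sup': "supported x" by (simp add: x_def)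
  have cga: "coeff (ga x) k = (if k \<le> g then \<xi> (int k) $ 2 $ 1 else 0)" for k
  proof (cases "k \<le> g")
    case True
    then show ?thesis using ct[of "int k" 2 1]
      by (simp add: ga_def coeff_star coeff_be[OF sup'] sx of_nat_diff diff_diff_eq add.commute)
  qed (simp add: ga_def coeff_star)
  show "potential_of_state g (state_of_potential g \<xi>) = \<xi>"
  proof
    fix d
    show "potential_of_state g (state_of_potential g \<xi>) d = \<xi> d"
    proof (cases "d \<in> {-1..int g}")
      case False
      then show ?thesis using out[OF False] by (simp only: potential_of_state_def if_False)
    next
      case True
      have A: "(if 0 \<le> d then fst x (nat d) else 0) = \<xi> d $ 1 $ 1"
      proof -
        consider "d = -1" | "0 \<le> d" "d < int g" | "d = int g" using True by force
        then show ?thesis by cases (auto simp: fx m1 mg nat_less_iff)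
      qed
      have B: "snd x (nat (d + 1)) = \<xi> d $ 1 $ 2"
      proof -
        consider "-1 \<le> d" "d < int g" | "d = int g" using True by force
        then show ?thesis by cases (auto simp: sx mg)
      qed
      have C: "- cnj (snd x (nat (int g - d))) = \<xi> d $ 2 $ 1"
      proof -
        consider "d = -1" | "0 \<le> d" "d \<le> int g" using True by force
        then show ?thesis
        proof cases
          case 2
          then show ?thesis using ct[OF True, of 2 1] by (auto simp: sx algebra_simps)
        qed (auto simp: sx m1)
      qed
      show ?thesis
        unfolding x_def[symmetric] potential_of_state_def Let_def A B C using True tr[OF True]
        by (auto simp: vec_eq_iff forall_2)
    qed
  qed
  show "star (g - 1) (al (state_of_potential g \<xi>)) = - al (state_of_potential g \<xi>)"
    unfolding x_def[symmetric]
  proof (rule poly_eqI)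
    fix k
    show "coeff (star (g - 1) (al x)) k = coeff (- al x) k"
    proof (cases "k < g")
      case True
      then show ?thesis
        using ct[of "int k" 1 1] by (simp add: coeff_star coeff_al[OF sup'] fx of_nat_diff algebra_simps)
    next
      case False
      then show ?thesis by (auto simp: coeff_star coeff_al[OF sup'] fx)
    qed
  qed
  show "\<exists>t>0. snd (state_of_potential g \<xi>) 0 = \<i> * of_real t"
    unfolding x_def[symmetric] using t(1) by (auto simp: sx m1)
  show "poly (be (state_of_potential g \<xi>) * ga (state_of_potential g \<xi>)) 0 \<noteq> 0"
    unfolding x_def[symmetric] using nz t(1) by (simp add: poly_0_coeff_0 coeff_mult_0 coeff_be[OF sup'] sx m1 cga)
  assume l: "l \<noteq> 0"
  have 11: "laurent_eval g \<xi> l $ 1 $ 1 = poly (al x) l"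
    unfolding laurent_eval_def by (simp add: sum_laurent m1 mg poly_al fx)
  have 22: "laurent_eval g \<xi> l $ 2 $ 2 = - laurent_eval g \<xi> l $ 1 $ 1"
    unfolding laurent_eval_def using tr by (simp add: sum_negf)
  have 21: "laurent_eval g \<xi> l $ 2 $ 1 = poly (ga x) l"
  proof -
    have "poly (ga x) l = (\<Sum>k<Suc g. coeff (ga x) k * l ^ k)"
      using deg_lt_ga[of x] by (subst poly_altdef, intro sum.mono_neutral_left) (auto simp: deg_lt_iff coeff_eq_0)
    then show ?thesis unfolding laurent_eval_def by (simp add: sum_laurent m1 cga)
  qed
  have 12: "l * laurent_eval g \<xi> l $ 1 $ 2 = poly (be x) l"
  proof -
    have "poly (be x) l = (\<Sum>k\<le>g. snd x k * l ^ k)" by (simp add: poly_be lessThan_Suc_atMost)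
    also have "\<dots> = \<i> * of_real t + (\<Sum>k<g. \<xi> (int k) $ 1 $ 2 * l ^ Suc k)"
      by (subst sum.atMost_shift) (simp add: sx m1)
    finally show ?thesis unfolding laurent_eval_def using l
      by (simp add: sum_laurent m1 mg sum_distrib_left algebra_simps power_int_minus)
  qed
  have "- l * det (laurent_eval g \<xi> l) = l * (poly (al x))l ^ 2 + (l * laurent_eval g \<xi> l $ 1 $ 2) * laurent_eval g \<xi> l $ 2 $ 1"
    by (simp add: det_2 11 22 power2_eq_square algebra_simps)
  then show "- l * det (laurent_eval g \<xi> l) = poly ([:0, 1:] * (al (state_of_potential g \<xi>))\<^sup>2 + be (state_of_potential g \<xi>) * ga (state_of_potential g \<xi>)) l"
    unfolding x_def[symmetric] 12 21 by simp
qed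

lemma isospectral_iff:
  assumes "\<xi> \<in> potentials g"
  shows "\<xi> \<in> isospectral_set g a \<longleftrightarrow> state_of_potential g \<xi> \<in> M a"
proof -
  note p = potentials_state_of_potential[OF assms]
  let ?a = "[:0, 1:] * (al (state_of_potential g \<xi>))\<^sup>2 + be (state_of_potential g \<xi>) * ga (state_of_potential g \<xi>)"
  have "spectral_poly g \<xi> a \<longleftrightarrow> (\<forall>l. l \<noteq> 0 \<longrightarrow> poly a l = poly ?a l)"
    unfolding spectral_poly_def using p(6) by metis
  also have "\<dots> \<longleftrightarrow> ?a = a" using poly_eq_off_finite[of "{0}" a ?a] by auto
  finally show ?thesis using assms p(2-4) by (auto simp: isospectral_set_def M_def)
qed

lemma state_of_potential_of_state: "supported x \<Longrightarrow> state_of_potential g (potential_of_state g x) = x"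
proof -
  assume s: "supported x"
  have "fst (state_of_potential g (potential_of_state g x)) k = fst x k" for k
    using s by (auto simp: state_of_potential_def apply_seq_of potential_of_state_def supported_def Let_def)
  moreover have "snd (state_of_potential g (potential_of_state g x)) k = snd x k" for k
    using s by (auto simp: state_of_potential_def apply_seq_of potential_of_state_def supported_def Let_def)
  ultimately show ?thesis by (intro prod_eqI bcontfun_eqI)
qed

lemma potential_of_state_in_potentials:
  assumes x: "x \<in> M a" and a0: "poly a 0 \<noteq> 0"
  shows "potential_of_state g x \<in> potentials g"
proof -
  have s: "supported x" and r: "star (g - 1) (al x) = - al x" and c: "[:0, 1:] * (al x)\<^sup>2 + be x * ga x = a"
    using x by (auto simp: M_def)
  obtain t where t: "t > 0" "snd x 0 = \<i> * of_real t" using x by (auto simp: M_def)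
  have fz: "fst x k = 0" if "k \<ge> g" for k using s that by (simp add: supported_def)
  have fr: "fst x (g - 1 - k) = - cnj (fst x k)" if "k < g" for k
  proof -
    have "g - 1 - (g - 1 - k) = k" "g - 1 - k \<le> g - 1" using that by auto
    then show ?thesis using arg_cong[OF r, of "\<lambda>p. coeff p (g - 1 - k)"]
      by (simp only: coeff_star coeff_minus coeff_al[OF s] if_True) (simp add: minus_equation_iff)
  qed
  define A where "A d = (if 0 \<le> d then fst x (nat d) else 0)" for d
  have A: "A (int g - 1 - d) = - cnj (A d)" if d: "d \<in> {-1..int g}" for d
  proof -
    consider "d = -1" | "0 \<le> d" "d < int g" | "d = int g" using d by force
    then show ?thesis
    proof cases
      case 2
      then have "nat (int g - 1 - d) = g - 1 - nat d" by auto
      then show ?thesis using 2 fr[of "nat d"] by (auto simp: A_def)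
    qed (auto simp: A_def fz)
  qed
  have e: "potential_of_state g x d = (if d \<in> {-1..int g} then
     vector [vector [A d, snd x (nat (d + 1))], vector [- cnj (snd x (nat (int g - d))), - A d]] else 0)" for d
    by (simp add: potential_of_state_def A_def Let_def)
  show ?thesis
    unfolding potentials_def
  proof (intro CollectI conjI allI impI ballI)
    show "potential_of_state g x d = 0" if "d \<notin> {-1..int g}" for d unfolding e using that by (simp only: if_False)
    have "snd x (Suc g) = 0" using s by (simp add: supported_def)
    then have m1: "potential_of_state g x (-1) = vector [vector [0, \<i> * of_real t], vector [0, 0]]"
      by (simp add: e A_def t nat_add_distrib)
    then show "\<exists>t>0. potential_of_state g x (-1) = vector [vector [0, \<i> * complex_of_real t], vector [0, 0]]" using t(1) by blast
    have "poly a 0 = snd x 0 * (- cnj (snd x g))"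
      by (simp add: c[symmetric] poly_0_coeff_0 coeff_mult_0 coeff_be[OF s] ga_def coeff_star)
    then have "snd x 0 * (- cnj (snd x g)) \<noteq> 0" using a0 by simp
    moreover have "potential_of_state g x 0 $ 2 $ 1 = - cnj (snd x g)" by (simp add: e)
    ultimately show "trace (potential_of_state g x (-1) ** potential_of_state g x 0) \<noteq> 0"
      unfolding m1 t(2) by (auto simp: trace_def matrix_matrix_mult_def sum_2)
    fix d assume d: "d \<in> {-1..int g}"
    then have d': "int g - 1 - d \<in> {-1..int g}" by auto
    show "potential_of_state g x d \<in> sl2" using d by (simp add: sl2_def trace_def sum_2 e)
    have "nat (int g - 1 - d + 1) = nat (int g - d)" "nat (int g - (int g - 1 - d)) = nat (d + 1)" by auto
    then show "potential_of_state g x d = - conj_transpose (potential_of_state g x (int g - 1 - d))"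
      unfolding e using d d' A[OF d]
      by (simp add: vec_eq_iff forall_2 conj_transpose_def transpose_def map_matrix_def)
  qed
qed

text \<open>A description through continuous maps on the whole product, suited to topological
  arguments: the fixed points of the retraction onto supported states that land in
  \<open>M a\<close>.\<close>

lemma isospectral_eq:
  assumes "poly a 0 \<noteq> 0"
  shows "isospectral_set g a = {\<xi>. potential_of_state g (state_of_potential g \<xi>) = \<xi> \<and> state_of_potential g \<xi> \<in> M a}"
proof (intro set_eqI iffI)
  fix \<xi> assume "\<xi> \<in> isospectral_set g a"
  then show "\<xi> \<in> {\<xi>. potential_of_state g (state_of_potential g \<xi>) = \<xi> \<and> state_of_potential g \<xi> \<in> M a}"
    using isospectral_iff[of \<xi> a] potentials_state_of_potential(1)[of \<xi>] by (auto simp: isospectral_set_def)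
next
  fix \<xi> assume "\<xi> \<in> {\<xi>. potential_of_state g (state_of_potential g \<xi>) = \<xi> \<and> state_of_potential g \<xi> \<in> M a}"
  then show "\<xi> \<in> isospectral_set g a"
    using isospectral_iff[of \<xi> a] potential_of_state_in_potentials[of "state_of_potential g \<xi>" a] assms by auto
qed

lemma potential_of_state_in_isospectral:
  assumes "poly a 0 \<noteq> 0" "x \<in> M a"
  shows "potential_of_state g x \<in> isospectral_set g a"
  using assms state_of_potential_of_state[of x] unfolding isospectral_eq[OF assms(1)] by (auto simp: M_def)

end

lemma bounded_linear_potential_of_state: "bounded_linear (\<lambda>x. potential_of_state g x d)"
proof (cases "d \<in> {-1..int g}")
  case True
  define T :: "complex \<times> complex \<times> complex \<Rightarrow> complex^2^2" where
    "T = (\<lambda>(a, b, c). vector [vector [a, b], vector [- cnj c, - a]])"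
  have "linear T"
    by (rule linearI) (auto simp: T_def vec_eq_iff forall_2 algebra_simps)
  then have T: "bounded_linear T" by (simp add: linear_conv_bounded_linear)
  have c: "bounded_linear (\<lambda>x :: state. apply_bcontfun (snd x) k)" "bounded_linear (\<lambda>x :: state. apply_bcontfun (fst x) k)" for k
    by (intro bounded_linear_compose[OF bounded_linear_coordinate] bounded_linear_snd bounded_linear_fst bounded_linear_ident)+
  have "bounded_linear (\<lambda>x :: state. if 0 \<le> d then apply_bcontfun (fst x) (nat d) else 0)"
    using c(2) by (cases "0 \<le> d") auto
  then have "bounded_linear (\<lambda>x :: state. T (if 0 \<le> d then apply_bcontfun (fst x) (nat d) else 0,
      apply_bcontfun (snd x) (nat (d + 1)), apply_bcontfun (snd x) (nat (int g - d))))"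
    by (intro bounded_linear_compose[OF T] bounded_linear_Pair c)
  then show ?thesis using True by (simp add: T_def potential_of_state_def Let_def del: atLeastAtMost_iff)
next
  case False
  then have "(\<lambda>x. potential_of_state g x d) = (\<lambda>x. 0)" by (simp only: potential_of_state_def if_False)
  then show ?thesis by simp
qed

lemma continuous_on_state_of_potential: "continuous_on A (state_of_potential g)"
proof -
  have "continuous_on A (\<lambda>\<xi> :: int \<Rightarrow> complex^2^2. \<xi> d $ i $ j)" for d i j
    by (intro continuous_on_component continuous_on_coordinate)
  then show ?thesis
    unfolding state_of_potential_def[abs_def] seq_of_def
    by (intro continuous_on_Pair continuous_on_sum bounded_linear.continuous_on[OF bounded_linear_unit_seq])
qed

lemma state_of_potential_fun_upd: "state_of_potential g (\<xi>(d := \<xi> d + t *\<^sub>R v)) = state_of_potential g \<xi> + t *\<^sub>R state_of_potential g ((\<lambda>_. 0)(d := v))"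
proof (intro prod_eqI bcontfun_eqI)
  fix k
  show "fst (state_of_potential g (\<xi>(d := \<xi> d + t *\<^sub>R v))) k = fst (state_of_potential g \<xi> + t *\<^sub>R state_of_potential g ((\<lambda>_. 0)(d := v))) k"
    by (simp add: state_of_potential_def apply_seq_of)
  show "snd (state_of_potential g (\<xi>(d := \<xi> d + t *\<^sub>R v))) k = snd (state_of_potential g \<xi> + t *\<^sub>R state_of_potential g ((\<lambda>_. 0)(d := v))) k"
    by (simp add: state_of_potential_def apply_seq_of)
qed

section \<open>Conservation laws and compactness\<close>

lemma constant_on_unit_interval:
  fixes f :: "real \<Rightarrow> 'e::banach"
  assumes "\<And>s. s \<in> {0..1} \<Longrightarrow> (f has_vector_derivative 0) (at s within {0..1})" "s \<in> {0..1}"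
  shows "f s = f 0"
proof -
  have "norm (f s - f 0) \<le> 0 * exp 0"
    by (rule gronwall[of "\<lambda>s. f s - f 0" "\<lambda>_. 0" 0 0])
      (use assms in \<open>auto intro!: derivative_eq_intros\<close>)
  then show ?thesis by simp
qed

context nodes
begin

text \<open>Polarises the coefficients of the spectral polynomial. The form is not symmetric, so the
  linearised equation is the sum over both orders of the arguments.\<close>

definition curve_form :: "nat \<Rightarrow> state \<Rightarrow> state \<Rightarrow> complex" where
  "curve_form k x y = coeff ([:0, 1:] * (al x * al y) + be x * ga y) k"

lemma bounded_bilinear_curve_form: "bounded_bilinear (curve_form k)"
proof -
  have "coeff_bilinear (\<lambda>x y. [:0, 1:] * (al x * al y) + be x * ga y)"
    by (intro coeff_bilinear_add coeff_bilinear_const_mult coeff_bilinear_mult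
        coeff_linear_al coeff_linear_be coeff_linear_ga)
  then show ?thesis by (simp add: coeff_bilinear_def curve_form_def[abs_def])
qed

lemma curve_form_M: "x \<in> M a \<Longrightarrow> curve_form k x x = coeff a k"
  by (auto simp: M_def curve_form_def power2_eq_square)

lemma star_VA_real: "star (g - 1) (VA (rv v) (be x) (ga y)) = - VA (rv v) (be x) (ga y)" if "be x = be y"
proof (cases "g = 0")
  case True
  have "VA (rv v) (be x) (ga y) = 0" unfolding VA_def using True by simp
  then show ?thesis by (simp only:) (rule poly_eqI, simp add: coeff_star)
next
  case False
  then show ?thesis
    using star_VA[OF deg_lt_be[of x], of "ga y" "\<lambda>j. of_real (apply_bcontfun v j)"] that by (simp add: ga_def)
qed

lemma star_VB_real:
  assumes "star (g - 1) (al x) = - al x"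
  shows "star g (VB (rv v) (al x) (be x)) = VB (rv v) (al x) (ga x)"
proof (cases "g = 0")
  case True
  have "VB (rv v) (al x) b = 0" for b unfolding VB_def using True by simp
  then show ?thesis by (simp only:) (rule poly_eqI, simp add: coeff_star)
next
  case False
  then show ?thesis
    using star_VB[of "al x" "be x" "ga x" "\<lambda>j. of_real (apply_bcontfun v j)"] deg_lt_al deg_lt_be assms
    by (simp add: ga_def)
qed

lemma ga_Q: "star (g - 1) (al x) = - al x \<Longrightarrow> ga (Q x x v) = - VB (rv v) (al x) (ga x)"
  unfolding ga_def be_Q by (simp only: star_VB_real) (simp add: ga_def)

lemma M_commute:
  assumes "x \<in> M a"
  shows "Q (Q x x v) x w + Q x (Q x x v) w = Q (Q x x w) x v + Q x (Q x x w) v"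
proof (rule state_eqI)
  have r: "star (g - 1) (al x) = - al x" using assms by (simp add: M_def)
  have add: "supported (p + p')" if "supported p" "supported p'" for p p' using that by (simp add: supported_def)
  show "supported (Q (Q x x v) x w + Q x (Q x x v) w)" "supported (Q (Q x x w) x v + Q x (Q x x w) v)"
    by (intro add supported_Q)+
  have al_add: "al (p + p') = al p + al p'" "be (p + p') = be p + be p'" for p p'
    by (rule poly_eqI, simp add: al_def be_def coeff_poly_of)+
  have "synthetic_div (- c) w = - synthetic_div c w" for c :: "complex poly" and w
    using synthetic_div_sum[of "\<lambda>_. -1" "\<lambda>_. c" "{()}" w] by simp
  then have "bezoutian b (- c) w = - bezoutian b c w" for b c w by (simp add: bezoutian_def)
  then have m: "VA s b (- c) = - VA s b c" for s b c by (simp add: VA_def sum_negf[symmetric])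
  show "al (Q (Q x x v) x w + Q x (Q x x v) w) = al (Q (Q x x w) x v + Q x (Q x x w) v)"
    unfolding al_add al_Q be_Q ga_Q[OF r] m using VA_commute[of "rv w" "rv v" "al x" "be x" "ga x"] by simp
  show "be (Q (Q x x v) x w + Q x (Q x x v) w) = be (Q (Q x x w) x v + Q x (Q x x w) v)"
    unfolding al_add al_Q be_Q using VB_commute[of "rv w" "rv v" "be x" "ga x" "al x"] by simp
qed

text \<open>Support, reality of \<alpha> and the curve are conserved because the field lies in the
  kernel of their derivatives. Re b(0) satisfies a homogeneous linear equation, as \<sigma> is real,
  and stays 0; Im b(0) cannot change sign, since b(0) = 0 would give a(0) = 0. The factor \<kappa>
  only changes the speed.\<close>

lemma M_invariant:
  assumes a0: "poly a 0 \<noteq> 0" and c0: "c 0 \<in> M a" and \<kappa>: "\<And>s. \<bar>\<kappa> s :: real\<bar> \<le> 1"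
    and c': "\<And>s. s \<in> {0..1} \<Longrightarrow> (c has_vector_derivative \<kappa> s *\<^sub>R Q (c s) (c s) v) (at s within {0..1})"
    and s: "s \<in> {0..1}"
  shows "c s \<in> M a"
proof -
  have lin: "T (c s) = T (c 0)" if T: "bounded_linear T" and "\<And>x. T (Q x x v) = 0" and s: "s \<in> {0..1}"
    for T :: "state \<Rightarrow> complex" and s
  proof (rule constant_on_unit_interval[OF _ s])
    fix s :: real assume "s \<in> {0..1}"
    from bounded_linear.has_vector_derivative[OF T c'[OF this]]
    show "((\<lambda>s. T (c s)) has_vector_derivative 0) (at s within {0..1})"
      using T that(2) by (simp add: bounded_linear.linear linear_scale)
  qed
  have f: "bounded_linear (\<lambda>x :: state. apply_bcontfun (fst x) k)" and sn: "bounded_linear (\<lambda>x :: state. apply_bcontfun (snd x) k)" for k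
    by (intro bounded_linear_compose[OF bounded_linear_coordinate] bounded_linear_snd bounded_linear_fst bounded_linear_ident)+
  have sup0: "supported (c 0)" using c0 by (simp add: M_def)
  have sup: "supported (c s)" if s: "s \<in> {0..1}" for s
    unfolding supported_def
  proof (intro conjI allI impI)
    fix k
    show "apply_bcontfun (fst (c s)) k = 0" if "k \<ge> g"
      using lin[OF f _ s, of k] sup0 supported_Q that by (simp add: supported_def)
    show "apply_bcontfun (snd (c s)) k = 0" if "k > g"
      using lin[OF sn _ s, of k] sup0 supported_Q that by (simp add: supported_def)
  qed
  have real: "star (g - 1) (al (c s)) = - al (c s)" if s: "s \<in> {0..1}" for s
  proof (rule poly_eqI)
    fix k
    have "coeff (star (g - 1) (al (c s))) k + coeff (al (c s)) k = coeff (star (g - 1) (al (c 0))) k + coeff (al (c 0)) k"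
    proof (rule lin[OF _ _ s])
      show "bounded_linear (\<lambda>x. coeff (star (g - 1) (al x)) k + coeff (al x) k)"
        using coeff_linear_star[OF coeff_linear_al] coeff_linear_al
        by (intro bounded_linear_add) (auto simp: coeff_linear_def)
      show "coeff (star (g - 1) (al (Q x x v))) k + coeff (al (Q x x v)) k = 0" for x
        unfolding al_Q by (simp only: star_VA_real refl) simp
    qed
    also have "\<dots> = 0" using c0 by (simp add: M_def)
    finally show "coeff (star (g - 1) (al (c s))) k = coeff (- al (c s)) k" by (simp add: add_eq_0_iff2)
  qed
  have form: "curve_form k (c s) (c s) = curve_form k (c 0) (c 0)" if s: "s \<in> {0..1}" for k s
  proof (rule constant_on_unit_interval[OF _ s])
    fix s :: real assume s: "s \<in> {0..1}"
    let ?x = "c s" let ?y = "Q (c s) (c s) v"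
    interpret B: bounded_bilinear "curve_form k" by (rule bounded_bilinear_curve_form)
    have "2 * [:0, 1:] * al ?x * al ?y + be ?y * ga ?x + be ?x * ga ?y = 0"
      using V_curve[of "al ?x" "rv v" "be ?x" "ga ?x"] unfolding al_Q be_Q ga_Q[OF real[OF s]] by simp
    then have "([:0, 1:] * (al ?x * al ?y) + be ?x * ga ?y) + ([:0, 1:] * (al ?y * al ?x) + be ?y * ga ?x) = 0"
      by algebra
    then have "curve_form k ?x ?y + curve_form k ?y ?x = 0"
      unfolding curve_form_def by (metis coeff_0 coeff_add)
    then have "curve_form k ?x (\<kappa> s *\<^sub>R ?y) + curve_form k (\<kappa> s *\<^sub>R ?y) ?x = 0"
      by (simp only: B.scaleR_left B.scaleR_right scaleR_right_distrib[symmetric] scaleR_zero_right)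
    then show "((\<lambda>s. curve_form k (c s) (c s)) has_vector_derivative 0) (at s within {0..1})"
      using B.has_vector_derivative[OF c'[OF s] c'[OF s]] by simp
  qed
  have curve: "[:0, 1:] * (al (c s))\<^sup>2 + be (c s) * ga (c s) = a" if s: "s \<in> {0..1}" for s
  proof (rule poly_eqI)
    fix k
    show "coeff ([:0, 1:] * (al (c s))\<^sup>2 + be (c s) * ga (c s)) k = coeff a k"
      using form[OF s, of k] curve_form_M[OF c0, of k] by (simp add: curve_form_def power2_eq_square)
  qed
  obtain t0 where t0: "t0 > 0" "snd (c 0) 0 = \<i> * of_real t0" using c0 by (auto simp: M_def)
  have cont: "continuous_on {0..1} c"
    using c' by (meson has_vector_derivative_continuous continuous_on_eq_continuous_within)
  have \<sigma>l: "bounded_linear (\<lambda>x. \<sigma> (rv v) (al x))"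
    unfolding \<sigma>_def by (intro bounded_linear_sum bounded_linear_compose[OF bounded_linear_mult_right]
        bounded_linear_poly[OF coeff_linear_al deg_lt_al])
  have "compact ((\<lambda>s. \<sigma> (rv v) (al (c s))) ` {0..1})"
    by (intro compact_continuous_image bounded_linear.continuous_on[OF \<sigma>l] cont) auto
  then have "bounded ((\<lambda>s. \<sigma> (rv v) (al (c s))) ` {0..1})" by (rule compact_imp_bounded)
  then obtain L where "\<forall>y\<in>(\<lambda>s. \<sigma> (rv v) (al (c s))) ` {0..1}. norm y \<le> L" unfolding bounded_iff by blast
  then have L: "norm (\<sigma> (rv v) (al (c s))) \<le> L" if "s \<in> {0..1}" for s using that by blast
  have L0: "L \<ge> 0" by (rule order_trans[OF norm_ge_zero L[of 0]]) simp
  have re: "Re (snd (c s) 0) = 0" if s: "s \<in> {0..1}" for s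
  proof -
    have "norm (Re (snd (c s) 0)) \<le> 0 * exp L"
    proof (rule gronwall[where u = "\<lambda>s. Re (snd (c s) 0)" and u' = "\<lambda>s. Re (snd (\<kappa> s *\<^sub>R Q (c s) (c s) v) 0)"])
      fix s :: real assume s: "s \<in> {0..1}"
      have rl: "bounded_linear (\<lambda>x :: state. Re (apply_bcontfun (snd x) 0))"
        by (intro bounded_linear_compose[OF bounded_linear_Re sn])
      show "((\<lambda>s. Re (snd (c s) 0)) has_vector_derivative Re (snd (\<kappa> s *\<^sub>R Q (c s) (c s) v) 0)) (at s within {0..1})"
        by (rule bounded_linear.has_vector_derivative[OF rl c'[OF s]])
      have "snd (Q (c s) (c s) v) 0 = \<sigma> (rv v) (al (c s)) * snd (c s) 0"
        using coeff_0_VB[of "rv v" "al (c s)" "be (c s)"] by (simp only: be_Q[symmetric] coeff_be[OF supported_Q] coeff_be[OF sup[OF s]])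
      moreover have "Im (\<sigma> (rv v) (al (c s))) = 0"
        using \<sigma>_real[OF deg_lt_al real[OF s], of "apply_bcontfun v"] by (simp add: complex_is_Real_iff)
      ultimately have "Re (snd (\<kappa> s *\<^sub>R Q (c s) (c s) v) 0) = \<kappa> s * (Re (\<sigma> (rv v) (al (c s))) * Re (snd (c s) 0))"
        by simp
      also have "norm \<dots> \<le> 1 * (L * norm (Re (snd (c s) 0)))"
        unfolding norm_mult using \<kappa>[of s] abs_Re_le_cmod[of "\<sigma> (rv v) (al (c s))"] L[OF s] L0
        by (intro mult_mono) auto
      finally show "norm (Re (snd (\<kappa> s *\<^sub>R Q (c s) (c s) v) 0)) \<le> L * norm (Re (snd (c s) 0)) + 0" by simp
    qed (use t0 L0 s in auto)
    then show ?thesis by simp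
  qed
  have im: "Im (snd (c s) 0) > 0"
  proof (rule ccontr)
    assume "\<not> Im (snd (c s) 0) > 0"
    moreover have "Im (snd (c 0) 0) > 0" using t0 by simp
    moreover have "continuous_on {0..s} (\<lambda>s. Im (apply_bcontfun (snd (c s)) 0))"
      using s by (intro bounded_linear.continuous_on[OF bounded_linear_compose[OF bounded_linear_Im sn]] continuous_on_subset[OF cont]) auto
    ultimately obtain u where u: "u \<in> {0..s}" "Im (snd (c u) 0) = 0"
      using IVT2'[of "\<lambda>s. Im (apply_bcontfun (snd (c s)) 0)" s 0 0] s by auto
    then have u1: "u \<in> {0..1}" using s by auto
    then have "coeff (be (c u)) 0 = 0" using re[OF u1] u(2) coeff_be[OF sup[OF u1]] by (simp add: complex_eq_iff)
    then have "poly (be (c u)) 0 = 0" by (simp add: poly_0_coeff_0)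
    then show False using a0 by (simp add: curve[OF u1, symmetric])
  qed
  show ?thesis
    unfolding M_def using sup[OF s] real[OF s] curve[OF s] re[OF s] im
    by (auto intro!: exI[of _ "Im (snd (c s) 0)"] simp: complex_eq_iff)
qed

lemma M_bounded: "\<exists>R\<ge>0. \<forall>x\<in>M a. norm x \<le> R"
proof (intro exI[of _ "2 * sqrt (norm (coeff a g))"] conjI ballI)
  fix x assume x: "x \<in> M a"
  then have s: "supported x" and r: "star (g - 1) (al x) = - al x" by (auto simp: M_def)
  \<comment> \<open>Coefficient g of \<open>\<lambda> \<alpha>\<^sup>2\<close> is coefficient g - 1
    of \<open>\<alpha>\<^sup>2\<close>, where the reality condition pairs each coefficient of
    \<alpha> with minus its conjugate.\<close>
  have "coeff ([:0, 1:] * (al x)\<^sup>2) g = - (\<Sum>i<g. of_real ((norm (fst x i))\<^sup>2))"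
  proof (cases g)
    case (Suc n)
    have "coeff ([:0, 1:] * (al x)\<^sup>2) g = coeff (al x * al x) n" by (simp add: Suc power2_eq_square)
    also have "\<dots> = (\<Sum>i\<le>n. fst x i * fst x (n - i))" by (simp add: coeff_mult coeff_al[OF s])
    also have "\<dots> = (\<Sum>i\<le>n. - of_real ((norm (fst x i))\<^sup>2))"
    proof (intro sum.cong refl)
      have r': "star n (al x) = - al x" using r Suc by (metis diff_Suc_1)
      fix i assume "i \<in> {..n}"
      then have "fst x (n - i) = - cnj (fst x i)"
        using arg_cong[OF r', of "\<lambda>p. coeff p (n - i)"] by (simp add: coeff_star coeff_al[OF s] minus_equation_iff)
      then show "fst x i * fst x (n - i) = - of_real ((norm (fst x i))\<^sup>2)" by (simp only: complex_norm_square) simp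
    qed
    finally show ?thesis by (simp add: Suc lessThan_Suc_atMost sum_negf)
  qed simp
  moreover have "coeff (be x * ga x) g = - (\<Sum>i\<le>g. of_real ((norm (snd x i))\<^sup>2))"
  proof -
    have "coeff (be x * ga x) g = (\<Sum>i\<le>g. snd x i * - cnj (snd x i))"
      unfolding coeff_mult by (intro sum.cong) (auto simp: ga_def coeff_star coeff_be[OF s])
    also have "\<dots> = (\<Sum>i\<le>g. - of_real ((norm (snd x i))\<^sup>2))" by (intro sum.cong) (simp_all only: complex_norm_square, simp_all)
    finally show ?thesis by (simp add: sum_negf)
  qed
  ultimately have "coeff a g = - of_real ((\<Sum>i<g. (norm (fst x i))\<^sup>2) + (\<Sum>i\<le>g. (norm (snd x i))\<^sup>2))"
    using x by (auto simp: M_def)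
  then have "norm (coeff a g) = \<bar>(\<Sum>i<g. (norm (fst x i))\<^sup>2) + (\<Sum>i\<le>g. (norm (snd x i))\<^sup>2)\<bar>"
    by (metis norm_minus_cancel norm_of_real)
  also have "\<dots> = (\<Sum>i<g. (norm (fst x i))\<^sup>2) + (\<Sum>i\<le>g. (norm (snd x i))\<^sup>2)"
    by (intro abs_of_nonneg add_nonneg_nonneg sum_nonneg) auto
  finally have n: "norm (coeff a g) = (\<Sum>i<g. (norm (fst x i))\<^sup>2) + (\<Sum>i\<le>g. (norm (snd x i))\<^sup>2)" .
  have "norm (fst x) \<le> sqrt (norm (coeff a g))"
  proof (rule norm_bound)
    fix k
    show "norm (fst x k) \<le> sqrt (norm (coeff a g))"
    proof (cases "k < g")
      case True
      have "(norm (fst x k))\<^sup>2 \<le> (\<Sum>i<g. (norm (fst x i))\<^sup>2)" using True by (intro member_le_sum) auto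
      also have "\<dots> \<le> norm (coeff a g)" unfolding n by (simp add: sum_nonneg)
      finally show ?thesis by (rule real_le_rsqrt)
    qed (use s in \<open>simp add: supported_def\<close>)
  qed
  moreover have "norm (snd x) \<le> sqrt (norm (coeff a g))"
  proof (rule norm_bound)
    fix k
    show "norm (snd x k) \<le> sqrt (norm (coeff a g))"
    proof (cases "k \<le> g")
      case True
      have "(norm (snd x k))\<^sup>2 \<le> (\<Sum>i\<le>g. (norm (snd x i))\<^sup>2)" using True by (intro member_le_sum) auto
      also have "\<dots> \<le> norm (coeff a g)" unfolding n by (simp add: sum_nonneg)
      finally show ?thesis by (rule real_le_rsqrt)
    qed (use s in \<open>simp add: supported_def\<close>)
  qed
  moreover have "norm x \<le> norm (fst x) + norm (snd x)" by (metis norm_Pair_le prod.collapse)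
  ultimately show "norm x \<le> 2 * sqrt (norm (coeff a g))" by simp
qed simp

text \<open>The open condition Im b(0) > 0 may be replaced by \<ge> 0 because a(0) \<noteq> 0
  excludes b(0) = 0; all other conditions are equations between continuous functions.\<close>

lemma M_closed:
  assumes a0: "poly a 0 \<noteq> 0"
  shows "closed (M a)"
proof -
  have f: "continuous_on UNIV (\<lambda>x :: state. apply_bcontfun (fst x) k)" and sn: "continuous_on UNIV (\<lambda>x :: state. apply_bcontfun (snd x) k)" for k
    by (intro linear_continuous_on bounded_linear_compose[OF bounded_linear_coordinate] bounded_linear_snd bounded_linear_fst bounded_linear_ident)+
  have "M a = {x. \<forall>k\<ge>g. apply_bcontfun (fst x) k = 0} \<inter> {x. \<forall>k>g. apply_bcontfun (snd x) k = 0} \<inter>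
    {x. \<forall>k. coeff (star (g - 1) (al x)) k = - coeff (al x) k} \<inter> {x. \<forall>k. curve_form k x x = coeff a k} \<inter>
    {x. Re (apply_bcontfun (snd x) 0) = 0} \<inter> {x. 0 \<le> Im (apply_bcontfun (snd x) 0)}" (is "_ = ?R")
  proof (intro equalityI subsetI)
    fix x assume x: "x \<in> M a"
    show "x \<in> ?R" using x curve_form_M[OF x] by (auto simp: M_def supported_def)
  next
    fix x assume x: "x \<in> ?R"
    then have s: "supported x" by (simp add: supported_def)
    have c: "[:0, 1:] * (al x)\<^sup>2 + be x * ga x = a"
      using x by (intro poly_eqI) (simp add: curve_form_def power2_eq_square)
    have "snd x 0 \<noteq> 0"
    proof
      assume "snd x 0 = 0"
      then have "poly (be x) 0 = 0" by (simp add: poly_0_coeff_0 coeff_be[OF s])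
      then show False using a0 by (simp add: c[symmetric])
    qed
    then have "Im (snd x 0) > 0" using x by (auto simp: complex_eq_iff)
    moreover have "star (g - 1) (al x) = - al x" using x by (intro poly_eqI) simp
    ultimately show "x \<in> M a" using x s c unfolding M_def
      by (auto simp: complex_eq_iff intro!: exI[of _ "Im (snd x 0)"])
  qed
  moreover have "closed ?R"
  proof -
    have "closed {x :: state. \<forall>k. P k \<longrightarrow> F k x = (G k x :: complex)}"
      if "\<And>k. continuous_on UNIV (F k)" "\<And>k. continuous_on UNIV (G k)" for P and F G :: "nat \<Rightarrow> state \<Rightarrow> complex"
      using that by (intro closed_Collect_all closed_Collect_imp closed_Collect_eq) auto
    moreover have "continuous_on UNIV (\<lambda>x. coeff (star (g - 1) (al x)) k)" "continuous_on UNIV (\<lambda>x. - coeff (al x) k)"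
      "continuous_on UNIV (\<lambda>x. curve_form k x x)" for k
      using coeff_linear_star[OF coeff_linear_al] coeff_linear_al
        bounded_bilinear.continuous_on[OF bounded_bilinear_curve_form continuous_on_id continuous_on_id]
      by (auto simp: coeff_linear_def intro!: linear_continuous_on continuous_on_minus)
    ultimately show ?thesis
      using f sn by (intro closed_Int closed_Collect_all closed_Collect_imp closed_Collect_eq closed_Collect_le
          continuous_on_Re continuous_on_Im continuous_on_const) auto
  qed
  ultimately show ?thesis by simp
qed

text \<open>A closed subset of a product of closed balls, whose radii come from the bound on
  \<open>M a\<close> and the bounds of the coordinate maps.\<close>

lemma isospectral_compact:
  assumes a0: "poly a 0 \<noteq> 0"
  shows "compact (isospectral_set g a)"
proof -
  obtain R where R: "R \<ge> 0" "\<And>x. x \<in> M a \<Longrightarrow> norm x \<le> R" using M_bounded by blast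
  have ce: "continuous_on UNIV (potential_of_state g)"
    by (rule continuous_on_coordinatewise_then_product) (rule linear_continuous_on[OF bounded_linear_potential_of_state])
  have "closed {\<xi>. potential_of_state g (state_of_potential g \<xi>) = \<xi>}"
    by (intro closed_Collect_eq continuous_on_compose2[OF ce continuous_on_state_of_potential] continuous_on_id) auto
  moreover have "closed {\<xi>. state_of_potential g \<xi> \<in> M a}"
    using closed_vimage[OF M_closed[OF a0] continuous_on_state_of_potential] by (simp add: vimage_def)
  ultimately have cl: "closed (isospectral_set g a)"
    unfolding isospectral_eq[OF a0] by (rule closed_Collect_conj)
  obtain K where K: "\<And>d x. norm (potential_of_state g x d) \<le> norm x * K d"
    using bounded_linear.bounded[OF bounded_linear_potential_of_state[of g]] by metis
  have "isospectral_set g a \<subseteq> {\<xi>. \<forall>d. \<xi> d \<in> cball 0 (R * \<bar>K d\<bar>)}"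
  proof clarify
    fix \<xi> d assume "\<xi> \<in> isospectral_set g a"
    then have \<xi>: "potential_of_state g (state_of_potential g \<xi>) = \<xi>" "state_of_potential g \<xi> \<in> M a" unfolding isospectral_eq[OF a0] by auto
    have "norm (\<xi> d) \<le> norm (state_of_potential g \<xi>) * K d" using K[of "state_of_potential g \<xi>" d] \<xi>(1) by simp
    also have "\<dots> \<le> norm (state_of_potential g \<xi>) * \<bar>K d\<bar>" by (intro mult_left_mono) auto
    also have "\<dots> \<le> R * \<bar>K d\<bar>" using R(2)[OF \<xi>(2)] by (intro mult_right_mono) auto
    finally show "\<xi> d \<in> cball 0 (R * \<bar>K d\<bar>)" by simp
  qed
  moreover have "compact {\<xi> :: int \<Rightarrow> complex^2^2. \<forall>d. \<xi> d \<in> cball 0 (R * \<bar>K d\<bar>)}"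
    by (rule compact_fun) simp
  ultimately have "compact (isospectral_set g a \<inter> {\<xi>. \<forall>d. \<xi> d \<in> cball 0 (R * \<bar>K d\<bar>)})"
    and "isospectral_set g a \<inter> {\<xi>. \<forall>d. \<xi> d \<in> cball 0 (R * \<bar>K d\<bar>)} = isospectral_set g a"
    using cl by (auto intro: closed_Int_compact)
  then show ?thesis by (simp only:)
qed

lemma M_compact:
  assumes a0: "poly a 0 \<noteq> 0"
  shows "compact (M a)"
proof -
  have "M a = state_of_potential g ` isospectral_set g a"
  proof (intro equalityI subsetI)
    fix x assume x: "x \<in> M a"
    then have "state_of_potential g (potential_of_state g x) = x" by (intro state_of_potential_of_state) (simp add: M_def)
    then show "x \<in> state_of_potential g ` isospectral_set g a" using potential_of_state_in_isospectral[OF a0 x] by (metis image_eqI)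
  qed (auto simp: isospectral_eq[OF a0])
  then show ?thesis using compact_continuous_image[OF continuous_on_state_of_potential isospectral_compact[OF a0]] by simp
qed

text \<open>The unit sphere of a finite-dimensional space, obtained as a closed part of the
  continuous image of a product of balls. It supplies limits of secant directions in
  \<open>rigid\<close>.\<close>

lemma supported_sphere_compact: "compact {x. supported x \<and> norm x = 1}"
proof -
  define K where "K = {\<xi> :: int \<Rightarrow> complex^2^2. \<forall>d. norm (\<xi> d) \<le> onorm (\<lambda>x. potential_of_state g x d)}"
  have "K = {\<xi>. \<forall>d. \<xi> d \<in> cball 0 (onorm (\<lambda>x. potential_of_state g x d))}" by (auto simp: K_def)
  then have "compact K" using compact_fun[of "\<lambda>d. cball (0 :: complex^2^2) (onorm (\<lambda>x. potential_of_state g x d))"] by simp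
  then have "compact (state_of_potential g ` K)" by (rule compact_continuous_image[OF continuous_on_state_of_potential])
  moreover have "{x. supported x \<and> norm x = 1} \<subseteq> state_of_potential g ` K"
  proof clarify
    fix x assume x: "supported x" "norm x = 1"
    have "norm (potential_of_state g x d) \<le> onorm (\<lambda>x. potential_of_state g x d)" for d
      using onorm[OF bounded_linear_potential_of_state, of g x d] x by simp
    then show "x \<in> state_of_potential g ` K" using state_of_potential_of_state[OF x(1)] by (intro image_eqI[of _ _ "potential_of_state g x"]) (auto simp: K_def)
  qed
  moreover have "closed {x. supported x \<and> norm x = 1}"
  proof -
    have f: "continuous_on UNIV (\<lambda>x :: state. apply_bcontfun (fst x) k)" "continuous_on UNIV (\<lambda>x :: state. apply_bcontfun (snd x) k)" for k
      by (intro linear_continuous_on bounded_linear_compose[OF bounded_linear_coordinate] bounded_linear_snd bounded_linear_fst bounded_linear_ident)+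
    show ?thesis unfolding supported_def
      using f by (intro closed_Collect_conj closed_Collect_all closed_Collect_imp closed_Collect_eq continuous_on_norm continuous_on_id continuous_on_const) auto
  qed
  ultimately have "compact ({x. supported x \<and> norm x = 1} \<inter> state_of_potential g ` K)" and "{x. supported x \<and> norm x = 1} \<inter> state_of_potential g ` K = {x. supported x \<and> norm x = 1}"
    by (auto intro: closed_Int_compact)
  then show ?thesis by simp
qed

end

section \<open>The parameter space and the local structure of the isospectral set\<close>

instance bcontfun :: (topological_space, complete_space) complete_space
proof
  fix X :: "nat \<Rightarrow> 'a \<Rightarrow>\<^sub>C 'b"
  assume X: "Cauchy X"
  then have "uniformly_Cauchy_on UNIV (\<lambda>n. apply_bcontfun (X n))"
    unfolding uniformly_Cauchy_on_def Cauchy_def by (metis dist_fun_lt_imp_dist_val_lt)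
  then obtain l where "uniform_limit UNIV (\<lambda>n. apply_bcontfun (X n)) l sequentially"
    using Cauchy_uniformly_convergent uniformly_convergent_on_def by metis
  then show "convergent X"
    by (metis uniform_limit_bcontfunE sequentially_bot convergentI)
qed

instance bcontfun :: (topological_space, banach) banach ..

lemma span_unit_seq: "span ((\<lambda>j. unit_seq j (1::real)) ` {..<g}) = {v. \<forall>k\<ge>g. apply_bcontfun v k = 0}" (is "span ?E = ?W")
proof (intro equalityI subsetI)
  fix v assume "v \<in> ?W"
  then have "v = (\<Sum>j<g. apply_bcontfun v j *\<^sub>R unit_seq j 1)"
    by (intro bcontfun_eqI) (auto simp: apply_bcontfun_sum apply_unit_seq if_distrib[of "\<lambda>r. _ * r"] cong: if_cong)
  also have "\<dots> \<in> span ?E" by (intro span_sum span_scale span_base) auto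
  finally show "v \<in> span ?E" .
next
  fix v assume "v \<in> span ?E"
  then show "v \<in> ?W"
    by (induction rule: span_induct_alt) (auto simp: apply_unit_seq)
qed

lemma lin_indep_unit_seq: "lin_indep g (\<lambda>j. unit_seq j (1::real))"
  unfolding lin_indep_def
proof (intro allI impI)
  fix t :: "nat \<Rightarrow> real" and j assume 0: "(\<Sum>j<g. t j *\<^sub>R unit_seq j (1::real)) = 0" and j: "j < g"
  have "apply_bcontfun (\<Sum>j<g. t j *\<^sub>R unit_seq j (1::real)) j = t j"
    using j by (simp add: apply_bcontfun_sum apply_unit_seq if_distrib[of "\<lambda>r. _ * r"] cong: if_cong)
  then show "t j = 0" using 0 by simp
qed

text \<open>With degree at most 2g, the 2g distinct roots are all simple and none is lost at
  infinity; none lies at 0 either.\<close>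

locale smooth_curve = nodes +
  fixes a :: "complex poly"
  assumes a0: "poly a 0 \<noteq> 0" and deg: "degree a \<le> 2 * g" and card: "card {l. poly a l = 0} = 2 * g"
begin

definition \<pi> :: "(nat \<Rightarrow>\<^sub>C real) \<Rightarrow>\<^sub>L (nat \<Rightarrow>\<^sub>C real)" where
  "\<pi> = Blinfun (\<lambda>v. seq_of g (apply_bcontfun v))"

lemma \<pi>_apply: "\<pi> v = seq_of g (apply_bcontfun v)"
  unfolding \<pi>_def by (intro fun_cong[OF bounded_linear_Blinfun_apply] bounded_linear_seq_of bounded_linear_coordinate)

lemma M_D:
  assumes "x \<in> M a"
  shows "supported x" "star (g - 1) (al x) = - al x" "[:0, 1:] * (al x)\<^sup>2 + be x * ga x = a"
    "poly (be x) 0 \<noteq> 0" "coeff (be x) g \<noteq> 0" "no_common_root (be x) (ga x) ([:0, 1:] * al x)"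
    "Re (snd x 0) = 0" "Im (snd x 0) > 0"
proof -
  show s: "supported x" and "star (g - 1) (al x) = - al x" and c: "[:0, 1:] * (al x)\<^sup>2 + be x * ga x = a"
    and "Re (snd x 0) = 0" "Im (snd x 0) > 0" using assms by (auto simp: M_def)
  have "poly (be x) 0 * poly (ga x) 0 \<noteq> 0" using a0 by (simp add: c[symmetric])
  then show b0: "poly (be x) 0 \<noteq> 0" and "coeff (be x) g \<noteq> 0"
    by (auto simp: ga_def poly_0_coeff_0 coeff_star)
  show "no_common_root (be x) (ga x) ([:0, 1:] * al x)"
    by (rule no_common_root_spectral[OF c[symmetric] deg card b0 deg_lt_be])
qed

sublocale commuting_fields Q "M a"
proof (rule commuting_fields.intro)
  show "bounded_bilinear Q" by (rule bounded_bilinear_Q)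
  show "bounded (M a)" by (rule compact_imp_bounded[OF M_compact[OF a0]])
qed (rule M_invariant[OF a0] M_commute; assumption)+

lemma Q_kernel:
  assumes p: "p \<in> M a" and 0: "Q p p v = 0" and v: "\<forall>k\<ge>g. apply_bcontfun v k = 0"
  shows "v = 0"
proof (rule bcontfun_eqI)
  fix j
  note m = M_D[OF p]
  have "al 0 = 0" "be 0 = 0" by (rule poly_eqI, simp add: al_def be_def coeff_poly_of)+
  then have "VA (rv v) (be p) (ga p) = 0" "VB (rv v) (al p) (be p) + smult 0 (be p) = 0"
    using 0 al_Q[of p p v] be_Q[of p p v] by simp_all
  then have "rv v j = 0" if "j < g" by (rule kernel[OF deg_lt_be m(5,6) _ _ that])
  then show "apply_bcontfun v j = apply_bcontfun 0 j" using v \<rho>_nz[of j] by (cases "j < g") auto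
qed

lemma tangent_vector:
  assumes p: "p \<in> M a" and d: "supported d" "star (g - 1) (al d) = - al d" "Re (snd d 0) = 0"
    and tan: "\<And>k. curve_form k p d + curve_form k d p = 0"
  shows "\<exists>v. (\<forall>k\<ge>g. apply_bcontfun v k = 0) \<and> d = Q p p v"
proof -
  note m = M_D[OF p]
  have eq: "2 * [:0, 1:] * al p * al d + be d * ga p - be p * star g (be d) = 0"
  proof (rule poly_eqI)
    fix k
    have "coeff ([:0, 1:] * (al p * al d) + be p * ga d + ([:0, 1:] * (al d * al p) + be d * ga p)) k = 0"
      using tan[of k] by (simp only: curve_form_def coeff_add)
    also have "[:0, 1:] * (al p * al d) + be p * ga d + ([:0, 1:] * (al d * al p) + be d * ga p)
        = 2 * [:0, 1:] * al p * al d + be d * ga p - be p * star g (be d)"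
      unfolding ga_def[of d] by algebra
    finally show "coeff (2 * [:0, 1:] * al p * al d + be d * ga p - be p * star g (be d)) k = coeff 0 k" by simp
  qed
  show ?thesis
  proof (cases "g = 0")
    \<comment> \<open>For g = 0 only b(0) remains: it is imaginary and its modulus is fixed to first
      order, so its variation vanishes.\<close>
    case True
    have al0: "al x = 0" for x using deg_lt_al[of x] True by (simp add: deg_lt_iff)
    have c: "coeff (be d * ga p) 0 = coeff (be p * star g (be d)) 0" using eq by (simp add: al0)
    have "snd d 0 * - cnj (snd p g) = snd p 0 * cnj (snd d g)"
      using c by (simp add: coeff_mult_0 ga_def coeff_star coeff_be[OF m(1)] coeff_be[OF d(1)])
    then have "snd d 0 * - cnj (snd p 0) = snd p 0 * cnj (snd d 0)" by (simp only: True)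
    then have "snd d 0 = 0" using m(7,8) d(3) by (auto simp: complex_eq_iff)
    moreover have "\<forall>k\<ge>g. fst d k = 0" "\<forall>k>g. snd d k = 0" using d(1) by (auto simp: supported_def)
    ultimately have "fst d k = 0" "snd d k = 0" for k using True by (cases k; auto)+
    then have "d = 0" by (intro prod_eqI bcontfun_eqI) auto
    then show ?thesis by (intro exI[of _ 0]) (simp add: blinfun.zero_right)
  next
    case False
    have b0: "coeff (be p) 0 = \<i> * of_real (Im (snd p 0))" using m(7) by (simp add: coeff_be[OF m(1)] complex_eq_iff)
    have "\<exists>v :: nat \<Rightarrow> real. al d = VA (\<lambda>j. of_real (v j) * \<rho> j) (be p) (ga p) \<and> be d = VB (\<lambda>j. of_real (v j) * \<rho> j) (al p) (be p)"
      using m(8) d(3) False by (intro tangent_space[OF deg_lt_al m(2) deg_lt_be m(5) ga_def b0 _ m(6) deg_lt_al d(2) deg_lt_be _ eq])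
        (auto simp: coeff_be[OF d(1)])
    then obtain v :: "nat \<Rightarrow> real" where v: "al d = VA (\<lambda>j. of_real (v j) * \<rho> j) (be p) (ga p)"
      "be d = VB (\<lambda>j. of_real (v j) * \<rho> j) (al p) (be p)" by blast
    have "VA (rv (seq_of g v)) b c = VA (\<lambda>j. of_real (v j) * \<rho> j) b c" "VB (rv (seq_of g v)) b c = VB (\<lambda>j. of_real (v j) * \<rho> j) b c" for b c
      unfolding VA_def VB_def by (intro sum.cong; simp add: apply_seq_of)+
    then have "d = Q p p (seq_of g v)"
      by (intro state_eqI d(1) supported_Q) (simp_all only: al_Q be_Q v)
    then show ?thesis by (intro exI[of _ "seq_of g v"]) (simp add: apply_seq_of)
  qed
qed

text \<open>Injectivity on the span gives an algebraic left inverse. Truncation to the g + (g + 1)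
  relevant coordinates makes it bounded, since it then factors through a finite-dimensional
  space.\<close>

lemma left_inverse:
  assumes p: "p \<in> M a"
  shows "\<exists>L :: state \<Rightarrow>\<^sub>L (nat \<Rightarrow>\<^sub>C real). (\<forall>v. L (Q p p v) = \<pi> v) \<and> (\<forall>x. \<pi> (L x) = L x)"
proof -
  let ?E = "(\<lambda>j. unit_seq j (1::real)) ` {..<g}"
  have lin: "linear (Q p p)" using blinfun.bounded_linear_right bounded_linear.linear by blast
  have "inj_on (Q p p) (span ?E)"
  proof (rule inj_onI)
    fix v w assume vw: "v \<in> span ?E" "w \<in> span ?E" "Q p p v = Q p p w"
    then have "v - w = 0" by (intro Q_kernel[OF p]) (auto simp: span_unit_seq blinfun.diff_right)
    then show "v = w" by simp
  qed
  from linear_inj_on_left_inverse[OF lin this] obtain L0 where L0: "range L0 \<subseteq> span ?E" "linear L0"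
    "\<And>v. v \<in> span ?E \<Longrightarrow> L0 (Q p p v) = v" by blast
  define L where "L x = L0 (seq_of g (apply_bcontfun (fst x)), seq_of (Suc g) (apply_bcontfun (snd x)))" for x
  have bl: "bounded_linear L"
  proof -
    have eq: "L = (\<lambda>x. (\<Sum>k<g. L0 (unit_seq k (apply_bcontfun (fst x) k), 0)) + (\<Sum>k<Suc g. L0 (0, unit_seq k (apply_bcontfun (snd x) k))))"
    proof (rule ext)
      fix x :: state
      have "(seq_of g (apply_bcontfun (fst x)), seq_of (Suc g) (apply_bcontfun (snd x)))
        = (\<Sum>k<g. (unit_seq k (fst x k), 0)) + (\<Sum>k<Suc g. (0, unit_seq k (snd x k)))"
        by (simp add: seq_of_def prod_eq_iff fst_sum snd_sum del: sum.lessThan_Suc)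
      then show "L x = (\<Sum>k<g. L0 (unit_seq k (fst x k), 0)) + (\<Sum>k<Suc g. L0 (0, unit_seq k (snd x k)))"
        unfolding L_def by (simp only: linear_add[OF L0(2)] linear_sum[OF L0(2)])
    qed
    have b1: "bounded_linear (\<lambda>c::complex. L0 (unit_seq k c, 0))" and b2: "bounded_linear (\<lambda>c::complex. L0 (0, unit_seq k c))" for k
    proof -
      interpret u: bounded_linear "unit_seq k :: complex \<Rightarrow> _" by (rule bounded_linear_unit_seq)
      have "linear (\<lambda>c::complex. L0 (unit_seq k c, 0))" "linear (\<lambda>c::complex. L0 (0, unit_seq k c))"
        by (auto intro!: linearI simp: linear_add[OF L0(2), symmetric] linear_scale[OF L0(2), symmetric] u.add u.scaleR)
      then show "bounded_linear (\<lambda>c::complex. L0 (unit_seq k c, 0))" "bounded_linear (\<lambda>c::complex. L0 (0, unit_seq k c))"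
        by (simp_all add: linear_conv_bounded_linear)
    qed
    have f: "bounded_linear (\<lambda>x :: state. apply_bcontfun (fst x) k)" and sn: "bounded_linear (\<lambda>x :: state. apply_bcontfun (snd x) k)" for k
      by (intro bounded_linear_compose[OF bounded_linear_coordinate] bounded_linear_snd bounded_linear_fst bounded_linear_ident)+
    show ?thesis
      unfolding eq by (intro bounded_linear_add bounded_linear_sum bounded_linear_compose[OF b1 f] bounded_linear_compose[OF b2 sn])
  qed
  have W: "\<pi> v \<in> span ?E" for v by (simp add: span_unit_seq \<pi>_apply apply_seq_of)
  have W': "\<pi> v = v" if "v \<in> span ?E" for v
    using that by (intro bcontfun_eqI) (auto simp: span_unit_seq \<pi>_apply apply_seq_of)
  have Q\<pi>: "Q p p (\<pi> v) = Q p p v" for v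
    by (simp add: Q_apply \<pi>_apply apply_seq_of)
  have "L (Q p p v) = \<pi> v" for v
  proof -
    have "(seq_of g (apply_bcontfun (fst (Q p p v))), seq_of (Suc g) (apply_bcontfun (snd (Q p p v)))) = Q p p v"
      using supported_Q[of p p v] by (intro prod_eqI bcontfun_eqI) (auto simp: supported_def apply_seq_of)
    then have "L (Q p p v) = L0 (Q p p (\<pi> v))" by (simp add: L_def Q\<pi>)
    then show ?thesis using L0(3)[OF W] by simp
  qed
  moreover have "\<pi> (L x) = L x" for x using L0(1) by (intro W') (auto simp: L_def)
  ultimately show ?thesis
    by (intro exI[of _ "Blinfun L"]) (simp add: bounded_linear_Blinfun_apply[OF bl])
qed

text \<open>Otherwise pairs x, y with L x = L y tend to p, and their normalised differences
  accumulate at a unit vector d. In the limit d satisfies the linearised equations, so d = Q p p v,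
  and L d = 0 forces v = 0. This yields open orbits without knowing beforehand that
  \<open>M a\<close> is a manifold.\<close>

lemma rigid:
  fixes L :: "state \<Rightarrow>\<^sub>L (nat \<Rightarrow>\<^sub>C real)"
  assumes p: "p \<in> M a" and L: "\<And>v. L (Q p p v) = \<pi> v"
  shows "\<exists>\<epsilon>>0. \<forall>x\<in>M a. \<forall>y\<in>M a. dist x p < \<epsilon> \<longrightarrow> dist y p < \<epsilon> \<longrightarrow> L x = L y \<longrightarrow> x = y"
proof (rule ccontr)
  assume neg: "\<not> ?thesis"
  have "\<exists>x y. x \<in> M a \<and> y \<in> M a \<and> dist x p < 1 / real (Suc n) \<and> dist y p < 1 / real (Suc n) \<and> L x = L y \<and> x \<noteq> y" for n
  proof -
    have "(1::real) / real (Suc n) > 0" by simp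
    then show ?thesis using neg by blast
  qed
  then obtain X Y where XY: "\<And>n. X n \<in> M a" "\<And>n. Y n \<in> M a" "\<And>n. dist (X n) p < 1 / real (Suc n)"
    "\<And>n. dist (Y n) p < 1 / real (Suc n)" "\<And>n. L (X n) = L (Y n)" "\<And>n. X n \<noteq> Y n" by metis
  have lim: "X \<longlonglongrightarrow> p" "Y \<longlonglongrightarrow> p"
  proof -
    have conv: "Z \<longlonglongrightarrow> p" if "\<And>n. dist (Z n) p < 1 / real (Suc n)" for Z
    proof (rule metric_tendsto_imp_tendsto[OF LIMSEQ_inverse_real_of_nat], rule always_eventually, rule allI)
      show "dist (Z n) p \<le> dist (inverse (real (Suc n))) 0" for n
        using that[of n] by (simp add: inverse_eq_divide)
    qed
    show "X \<longlonglongrightarrow> p" "Y \<longlonglongrightarrow> p" by (rule conv, rule XY)+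
  qed
  define D where "D n = (1 / norm (X n - Y n)) *\<^sub>R (X n - Y n)" for n
  have Dn: "norm (D n) = 1" for n using XY(6)[of n] by (simp add: D_def)
  have Ds: "supported (D n)" for n
    using M_D(1)[OF XY(1)[of n]] M_D(1)[OF XY(2)[of n]] by (simp add: supported_def D_def)
  obtain d r where d: "supported d" "norm d = 1" and r: "strict_mono r" "(D \<circ> r) \<longlonglongrightarrow> d"
    using supported_sphere_compact Dn Ds unfolding compact_def by blast
  have pass: "T d = 0" if "bounded_linear T" "\<And>n. T (D n) = 0" for T :: "state \<Rightarrow> 'x::real_normed_vector"
  proof -
    have "(\<lambda>n. T ((D \<circ> r) n)) \<longlonglongrightarrow> T d" by (rule bounded_linear.tendsto[OF that(1) r(2)])
    then show ?thesis using that(2) by (simp add: LIMSEQ_const_iff)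
  qed
  have TD: "T (D n) = 0" if "bounded_linear T" "T (X n) = T (Y n)" for T :: "state \<Rightarrow> 'x::real_normed_vector" and n
    using that by (simp add: D_def linear_scale linear_diff bounded_linear.linear)
  have "L d = 0" by (rule pass[OF blinfun.bounded_linear_right]) (simp add: TD[OF blinfun.bounded_linear_right] XY(5))
  have bl: "bounded_linear (\<lambda>x :: state. Re (apply_bcontfun (snd x) 0))"
    by (intro bounded_linear_compose[OF bounded_linear_Re] bounded_linear_compose[OF bounded_linear_coordinate] bounded_linear_snd bounded_linear_ident)
  have re: "Re (snd d 0) = 0"
    by (rule pass[OF bl], rule TD[OF bl]) (simp add: M_D(7)[OF XY(1)] M_D(7)[OF XY(2)])
  have star: "star (g - 1) (al d) = - al d"
  proof (rule poly_eqI)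
    fix k
    have bl: "bounded_linear (\<lambda>x. coeff (star (g - 1) (al x)) k + coeff (al x) k)"
      using coeff_linear_star[OF coeff_linear_al] coeff_linear_al
      by (intro bounded_linear_add) (auto simp: coeff_linear_def)
    have "coeff (star (g - 1) (al d)) k + coeff (al d) k = 0"
      by (rule pass[OF bl], rule TD[OF bl]) (simp only: M_D(2)[OF XY(1)] M_D(2)[OF XY(2)] coeff_minus left_minus)
    then show "coeff (star (g - 1) (al d)) k = coeff (- al d) k" by (simp add: add_eq_0_iff2)
  qed
  have tan: "curve_form k p d + curve_form k d p = 0" for k
  proof -
    interpret B: bounded_bilinear "curve_form k" by (rule bounded_bilinear_curve_form)
    \<comment> \<open>The difference of two equal values of a quadratic form, divided by |X n - Y
      n|.\<close>
    have z: "curve_form k (X n + Y n) (D n) + curve_form k (D n) (X n + Y n) = 0" for n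
    proof -
      have "curve_form k (X n + Y n) (X n - Y n) + curve_form k (X n - Y n) (X n + Y n) = 0"
        using curve_form_M[OF XY(1)[of n], of k] curve_form_M[OF XY(2)[of n], of k]
        by (simp add: B.add_left B.add_right B.diff_left B.diff_right)
      then show ?thesis unfolding D_def B.scaleR_left B.scaleR_right
        by (simp only: scaleR_right_distrib[symmetric] scaleR_zero_right)
    qed
    have "(\<lambda>n. curve_form k (X (r n) + Y (r n)) (D (r n)) + curve_form k (D (r n)) (X (r n) + Y (r n)))
       \<longlonglongrightarrow> curve_form k (p + p) d + curve_form k d (p + p)"
      using LIMSEQ_subseq_LIMSEQ[OF lim(1) r(1)] LIMSEQ_subseq_LIMSEQ[OF lim(2) r(1)] r(2)
      by (intro tendsto_add B.tendsto) (auto simp: o_def)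
    then have "curve_form k (p + p) d + curve_form k d (p + p) = 0" by (simp add: z LIMSEQ_const_iff)
    then show ?thesis by (simp add: B.add_left B.add_right) (simp add: add_eq_0_iff2 complex_eq_iff)
  qed
  obtain v where v: "\<forall>k\<ge>g. apply_bcontfun v k = 0" "d = Q p p v"
    using tangent_vector[OF p d(1) star re tan] by blast
  have "\<pi> v = v" using v(1) by (intro bcontfun_eqI) (auto simp: \<pi>_apply apply_seq_of)
  then have "v = 0" using \<open>L d = 0\<close> v(2) L[of v] by simp
  then show False using d(2) v(2) by (simp add: blinfun.zero_right)
qed

sublocale torus_flow Q "M a" g "\<lambda>j. unit_seq j (1::real)" \<pi>
proof
  let ?W = "span ((\<lambda>j. unit_seq j (1::real)) ` {..<g})"
  show "compact (M a)" by (rule M_compact[OF a0])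
  show "lin_indep g (\<lambda>j. unit_seq j (1::real))" by (rule lin_indep_unit_seq)
  show "\<pi> v \<in> ?W" for v by (simp add: span_unit_seq \<pi>_apply apply_seq_of)
  show "\<pi> v = v" if "v \<in> ?W" for v
    using that by (intro bcontfun_eqI) (auto simp: span_unit_seq \<pi>_apply apply_seq_of)
  show "V (\<pi> v) x = V v x" for v x by (simp add: V_def Q_apply \<pi>_apply apply_seq_of)
  show "\<exists>C. \<forall>x\<in>?W. \<bar>f x\<bar> \<le> C * norm x" if f: "linear f" for f :: "(nat \<Rightarrow>\<^sub>C real) \<Rightarrow> real"
  proof (intro exI ballI)
    fix v :: "nat \<Rightarrow>\<^sub>C real" assume v: "v \<in> ?W"
    then have "v = (\<Sum>j<g. apply_bcontfun v j *\<^sub>R unit_seq j 1)"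
      by (intro bcontfun_eqI) (auto simp: span_unit_seq apply_bcontfun_sum apply_unit_seq if_distrib[of "\<lambda>r. _ * r"] cong: if_cong)
    then have "f v = f (\<Sum>j<g. apply_bcontfun v j *\<^sub>R unit_seq j 1)" by (rule arg_cong)
    then have "f v = (\<Sum>j<g. apply_bcontfun v j * f (unit_seq j 1))"
      by (simp add: linear_sum[OF f] linear_scale[OF f])
    also have "\<bar>\<dots>\<bar> \<le> (\<Sum>j<g. \<bar>f (unit_seq j 1)\<bar> * norm v)"
    proof (rule order_trans[OF sum_abs sum_mono])
      fix j
      show "\<bar>apply_bcontfun v j * f (unit_seq j 1)\<bar> \<le> \<bar>f (unit_seq j 1)\<bar> * norm v"
        using mult_left_mono[OF norm_bounded[of v j], of "\<bar>f (unit_seq j 1)\<bar>"] by (simp add: abs_mult mult.commute)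
    qed
    finally show "\<bar>f v\<bar> \<le> (\<Sum>j<g. \<bar>f (unit_seq j 1)\<bar>) * norm v" by (simp add: sum_distrib_right)
  qed
  fix p assume p: "p \<in> M a"
  obtain L :: "state \<Rightarrow>\<^sub>L (nat \<Rightarrow>\<^sub>C real)" where L: "\<And>v. L (Q p p v) = \<pi> v" "\<And>x. \<pi> (L x) = L x"
    using left_inverse[OF p] by blast
  then show "\<exists>(L :: state \<Rightarrow>\<^sub>L (nat \<Rightarrow>\<^sub>C real)) \<epsilon>. \<epsilon> > 0 \<and> (\<forall>v. L (V v p) = \<pi> v) \<and> (\<forall>x. \<pi> (L x) = L x) \<and>
       (\<forall>x\<in>M a. \<forall>y\<in>M a. dist x p < \<epsilon> \<longrightarrow> dist y p < \<epsilon> \<longrightarrow> L x = L y \<longrightarrow> x = y)"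
    using rigid[OF p L(1)] by (intro exI[of _ L]) (auto simp: V_def)
qed

end

section \<open>Uniqueness of the orbit\<close>

context smooth_curve
begin

text \<open>On an orbit the function \<open>Im b(0)\<close> has a maximum. It is critical only where \<open>\<alpha> = 0\<close>, and
  its Hessian there is the Bezoutian form, so at the maximum \<open>b\<close> has no root in the unit disc.\<close>

lemma orbit_maximum:
  assumes x: "x \<in> M a"
  shows "\<exists>v. al (flow v x) = 0 \<and> (\<forall>\<beta>. poly (be (flow v x)) \<beta> = 0 \<longrightarrow> norm \<beta> \<ge> 1)"
proof -
  define h where "h y = Im (apply_bcontfun (snd y) 0)" for y :: state
  have blh: "bounded_linear h"
    unfolding h_def[abs_def]
    by (intro bounded_linear_compose[OF bounded_linear_Im] bounded_linear_compose[OF bounded_linear_coordinate] bounded_linear_snd bounded_linear_ident)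
  obtain y where y: "y \<in> range (\<lambda>v. flow v x)" "\<And>y'. y' \<in> range (\<lambda>v. flow v x) \<Longrightarrow> h y' \<le> h y"
    using continuous_attains_sup[OF orbit_compact[OF x] _ linear_continuous_on[OF blh]] by blast
  then obtain v0 where v0: "y = flow v0 x" by blast
  have yM: "y \<in> M a" using flow_in_M[OF x] v0 by simp
  have max: "h (flow w y) \<le> h y" for w using y(2)[of "flow w y"] by (simp add: v0 flow_add[OF x, symmetric])
  define s where "s v y = Re (\<sigma> (rv v) (al y))" for v y
  have bls: "bounded_linear (s v)" for v
    unfolding s_def[abs_def] \<sigma>_def
    by (intro bounded_linear_compose[OF bounded_linear_Re] bounded_linear_sum
        bounded_linear_compose[OF bounded_linear_mult_right] bounded_linear_poly[OF coeff_linear_al deg_lt_al])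
  have hV: "h (V v p) = s v p * h p" if p: "p \<in> M a" for v p
  proof -
    have "snd (V v p) 0 = \<sigma> (rv v) (al p) * snd p 0"
      using coeff_0_VB[of "rv v" "al p" "be p"]
      by (simp only: V_def be_Q[symmetric] coeff_be[OF supported_Q] coeff_be[OF M_D(1)[OF p]])
    moreover have "Im (\<sigma> (rv v) (al p)) = 0"
      using \<sigma>_real[OF deg_lt_al M_D(2)[OF p], of "apply_bcontfun v"] by (simp add: complex_is_Real_iff)
    ultimately show ?thesis by (simp add: h_def s_def)
  qed
  have hpos: "h p > 0" if "p \<in> M a" for p using M_D(8)[OF that] by (simp add: h_def)
  have d: "((\<lambda>t. T (flow (t *\<^sub>R v) y)) has_real_derivative T (V v (flow (t *\<^sub>R v) y))) (at t)"
    if T: "bounded_linear T" for T :: "state \<Rightarrow> real" and v t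
  proof -
    have "((\<lambda>t. t *\<^sub>R v) has_vector_derivative v) (at t)" by (auto intro!: derivative_eq_intros)
    from vector_derivative_diff_chain_within[OF this, of "\<lambda>v. flow v y" "\<lambda>w. V w (flow (t *\<^sub>R v) y)"]
    have "((\<lambda>t. flow (t *\<^sub>R v) y) has_vector_derivative V v (flow (t *\<^sub>R v) y)) (at t)"
      using has_derivative_at_withinI[OF flow_has_derivative[OF yM]] by (simp add: o_def)
    from bounded_linear.has_vector_derivative[OF T this] show ?thesis
      by (simp add: has_real_derivative_iff_has_vector_derivative)
  qed
  \<comment> \<open>Along trajectories h' = s h with h > 0, so the monotonicity of h is read off
    from the sign of s, which is linear in the state.\<close>
  have dh: "((\<lambda>t. h (flow (t *\<^sub>R v) y)) has_real_derivative s v (flow (t *\<^sub>R v) y) * h (flow (t *\<^sub>R v) y)) (at t)" for v t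
    using d[OF blh, of v t] hV[OF flow_in_M[OF yM]] by simp
  have s0: "s v y = 0" for v
  proof -
    have "s v (flow (0 *\<^sub>R v) y) * h (flow (0 *\<^sub>R v) y) = 0"
      by (rule DERIV_local_max[OF dh, of 1]) (use max in \<open>auto simp: flow_0[OF yM]\<close>)
    then show ?thesis using hpos[OF yM] by (simp add: flow_0[OF yM])
  qed
  have al0: "al y = 0"
  proof (rule \<sigma>_zero[OF deg_lt_al])
    fix v :: "nat \<Rightarrow> real"
    have e: "\<sigma> (\<lambda>j. of_real (v j) * \<rho> j) (al y) = \<sigma> (rv (seq_of g v)) (al y)"
      unfolding \<sigma>_def by (intro sum.cong) (auto simp: apply_seq_of)
    have "Im (\<sigma> (\<lambda>j. of_real (v j) * \<rho> j) (al y)) = 0"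
      using \<sigma>_real[OF deg_lt_al M_D(2)[OF yM], of v] by (simp add: complex_is_Real_iff)
    then show "\<sigma> (\<lambda>j. of_real (v j) * \<rho> j) (al y) = 0"
      using s0[of "seq_of g v"] unfolding s_def e[symmetric] by (simp add: complex_eq_iff)
  qed
  have "norm \<beta> \<ge> 1" if \<beta>: "poly (be y) \<beta> = 0" for \<beta>
  proof (rule ccontr)
    assume "\<not> norm \<beta> \<ge> 1"
    then have n: "norm \<beta> < 1" by simp
    have b0: "\<beta> \<noteq> 0" using M_D(4)[OF yM] \<beta> by auto
    have c0: "poly (ga y) \<beta> \<noteq> 0" using M_D(6)[OF yM] \<beta> al0 by (auto simp: no_common_root_def)
    have "g > 0"
    proof (rule ccontr)
      assume "\<not> g > 0"
      then have "degree (be y) = 0" using deg_lt_be[of y] by (auto simp: deg_lt_iff)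
      then show False using \<beta> M_D(4)[OF yM] by (metis degree_eq_zeroE poly_const_conv)
    qed
    then obtain v :: "nat \<Rightarrow> real" where v:
      "(\<Sum>i<g. \<Sum>j<g. v i * v j * Re (\<rho> i * \<rho> j * poly (bezoutian (be y) (ga y) (z i)) (z j))) > 0"
      using bezoutian_positive[OF deg_lt_be ga_def \<beta> c0 n b0] by blast
    define w where "w = seq_of g v"
    have "s w (V w y) = (\<Sum>i<g. \<Sum>j<g. v i * v j * Re (\<rho> i * \<rho> j * poly (bezoutian (be y) (ga y) (z i)) (z j)))"
    proof -
      have "\<sigma> (rv w) (al (V w y)) = (\<Sum>j<g. \<Sum>i<g. of_real (v i * v j) * (\<rho> i * \<rho> j * poly (bezoutian (be y) (ga y) (z i)) (z j)))"
        unfolding \<sigma>_def V_def al_Q VA_def poly_sum sum_distrib_left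
        by (intro sum.cong refl) (simp add: w_def apply_seq_of)
      then have "\<sigma> (rv w) (al (V w y)) = (\<Sum>i<g. \<Sum>j<g. of_real (v i * v j) * (\<rho> i * \<rho> j * poly (bezoutian (be y) (ga y) (z i)) (z j)))"
        by (subst (asm) sum.swap)
      moreover have "Re (of_real r * c) = r * Re c" for r c by simp
      ultimately show ?thesis by (simp only: s_def Re_sum)
    qed
    then have "s w (V w (flow (0 *\<^sub>R w) y)) > 0" using v by (simp add: flow_0[OF yM])
    \<comment> \<open>s vanishes at the maximum and has positive derivative along w; so it is
      positive shortly afterwards and h increases, against maximality.\<close>
    from DERIV_pos_inc_right[OF d[OF bls, of w w 0] this] obtain e where e: "e > 0"
      "\<And>k. 0 < k \<Longrightarrow> k < e \<Longrightarrow> s w (flow (0 *\<^sub>R w) y) < s w (flow (k *\<^sub>R w) y)" by auto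
    have "h (flow (0 *\<^sub>R w) y) < h (flow ((e/2) *\<^sub>R w) y)"
    proof (rule DERIV_pos_imp_increasing_open[of 0 "e/2"])
      fix t assume t: "0 < t" "t < e/2"
      have "s w (flow (t *\<^sub>R w) y) > 0" using e(2)[of t] t s0[of w] by (simp add: flow_0[OF yM])
      then show "\<exists>D. ((\<lambda>t. h (flow (t *\<^sub>R w) y)) has_real_derivative D) (at t) \<and> D > 0"
        using dh hpos[OF flow_in_M[OF yM]] by (blast intro: mult_pos_pos)
      next
      show "continuous_on {0..e/2} (\<lambda>t. h (flow (t *\<^sub>R w) y))"
        using dh by (meson DERIV_isCont continuous_at_imp_continuous_on)
    qed (use e in auto)
    then show False using max[of "(e/2) *\<^sub>R w"] by (simp add: flow_0[OF yM])
  qed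
  then show ?thesis using al0 v0 by blast
qed

text \<open>The roots of c are the mirror images of those of b. A common root of b at x and c at y
  would lie on the circle and be shared by b and c at y, which simple roots exclude. By coprimality
  b at x divides b at y; equal degrees make the ratio constant, the common product b c makes it
  unimodular, and the positive residue makes it 1.\<close>

lemma maximum_unique:
  assumes x: "x \<in> M a" "al x = 0" "\<And>\<beta>. poly (be x) \<beta> = 0 \<Longrightarrow> norm \<beta> \<ge> 1"
    and y: "y \<in> M a" "al y = 0" "\<And>\<beta>. poly (be y) \<beta> = 0 \<Longrightarrow> norm \<beta> \<ge> 1"
  shows "x = y"
proof -
  note mx = M_D[OF x(1)] and my = M_D[OF y(1)]
  have eq: "be x * ga x = be y * ga y" using mx(3) my(3) x(2) y(2) by simp
  have "no_common_root (be x) (ga y) 0"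
    unfolding no_common_root_def
  proof (intro allI notI, elim conjE)
    fix \<beta> assume \<beta>: "poly (be x) \<beta> = 0" "poly (ga y) \<beta> = 0"
    have b0: "\<beta> \<noteq> 0" using mx(4) \<beta>(1) by auto
    have "poly (be y) (inverse (cnj \<beta>)) = 0"
      using \<beta>(2) poly_star[OF deg_lt_be b0, of y] b0 by (simp add: ga_def)
    then have "norm (inverse (cnj \<beta>)) \<ge> 1" by (rule y(3))
    moreover have "norm \<beta> \<ge> 1" by (rule x(3)[OF \<beta>(1)])
    ultimately have "norm \<beta> = 1" using b0 by (simp add: norm_inverse le_imp_inverse_le one_le_inverse_iff)
    then have "poly (be y) \<beta> = 0" using \<open>poly (be y) (inverse (cnj \<beta>)) = 0\<close> by (simp add: inverse_cnj_unit)
    then show False using my(6) \<beta>(2) y(2) by (auto simp: no_common_root_def)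
  qed
  then obtain u w v where "u * be x + w * ga y + v * 0 = 1" using no_common_root_bezout by blast
  then have "be y = be y * (u * be x + w * ga y)" by simp
  also have "\<dots> = be x * (be y * u + w * ga x)" using eq by (simp add: algebra_simps)
  finally have "be y = be x * (be y * u + w * ga x)" .
  then obtain k where k: "be y = be x * k" by blast
  have nz: "be x \<noteq> 0" "be y \<noteq> 0" using mx(4) my(4) by auto
  then have "k \<noteq> 0" using k by auto
  then have "degree k = 0"
    using arg_cong[OF k, of degree] nz degree_eq_g[OF deg_lt_be mx(5)] degree_eq_g[OF deg_lt_be my(5)]
    by (simp add: degree_mult_eq)
  then obtain c where c: "k = [:c:]" by (metis degree_eq_zeroE)
  have yc: "be y = smult c (be x)" using k c by (simp add: mult.commute)
  have gc: "ga y = smult (cnj c) (ga x)" by (simp add: ga_def yc star_smult)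
  have ga: "ga x \<noteq> 0" using mx(5) by (auto simp: ga_def coeff_star poly_eq_iff intro!: exI[of _ 0])
  have "smult (c * cnj c) (be x * ga x) = be x * ga x" using eq by (simp add: yc gc mult.commute)
  then have "smult (c * cnj c - 1) (be x * ga x) = 0" by (simp add: smult_diff_left)
  then have "c * cnj c = 1" using nz ga by simp
  then have "(norm c)\<^sup>2 = 1" by (metis complex_mod_mult_cnj norm_one)
  have "snd y 0 = c * snd x 0"
    using arg_cong[OF yc, of "\<lambda>p. coeff p 0"] by (simp add: coeff_be[OF mx(1)] coeff_be[OF my(1)])
  then have "Im (snd y 0) = Re c * Im (snd x 0)" "0 = Im c * Im (snd x 0)"
    using mx(7) my(7) by (simp_all add: complex_eq_iff)
  then have "Im c = 0" "Re c > 0" using mx(8) my(8) by (auto simp: zero_less_mult_iff)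
  moreover from this have "(Re c)\<^sup>2 = 1" using \<open>(norm c)\<^sup>2 = 1\<close> by (simp add: cmod_power2)
  ultimately have "c = 1" by (auto simp: complex_eq_iff power2_eq_1_iff)
  then show "x = y" using x(2) y(2) yc mx(1) my(1) by (intro state_eqI) auto
qed

text \<open>Both orbits contain the same maximum; the parameter leads from x up to it and back down
  to y.\<close>

lemma single_orbit:
  assumes x: "x \<in> M a" and y: "y \<in> M a"
  shows "\<exists>v. flow v x = y"
proof -
  obtain v where v: "al (flow v x) = 0" "\<And>\<beta>. poly (be (flow v x)) \<beta> = 0 \<Longrightarrow> norm \<beta> \<ge> 1"
    using orbit_maximum[OF x] by blast
  obtain w where w: "al (flow w y) = 0" "\<And>\<beta>. poly (be (flow w y)) \<beta> = 0 \<Longrightarrow> norm \<beta> \<ge> 1"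
    using orbit_maximum[OF y] by blast
  have "flow v x = flow w y"
    by (rule maximum_unique[OF flow_in_M[OF x] v flow_in_M[OF y] w])
  then have "flow (v + - w) x = y"
    using flow_add[OF y, of w "- w"] by (simp only: flow_add[OF x]) (simp add: flow_0[OF y])
  then show ?thesis by blast
qed

lemma isospectral_torus:
  assumes "isospectral_set g a \<noteq> {}"
  shows "connected (isospectral_set g a)" "smooth_manifold g (isospectral_set g a)"
    "diffeomorphic (isospectral_set g a) (torus g)"
proof -
  have I: "state_of_potential g y \<in> M a" "potential_of_state g (state_of_potential g y) = y" if "y \<in> isospectral_set g a" for y
    using that by (auto simp: isospectral_eq[OF a0])
  have J: "potential_of_state g x \<in> isospectral_set g a" "state_of_potential g (potential_of_state g x) = x" if "x \<in> M a" for x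
    using potential_of_state_in_isospectral[OF a0 that] state_of_potential_of_state[OF M_D(1)[OF that]] by auto
  obtain p where p: "p \<in> M a" using I assms by blast
  note orbit = single_orbit[OF p]
  note l = continuous_on_state_of_potential state_of_potential_fun_upd
  show "smooth_manifold g (isospectral_set g a)"
    by (rule orbit_manifold[OF l bounded_linear_potential_of_state I J])
  show "diffeomorphic (isospectral_set g a) (torus g)"
    by (rule orbit_torus[OF p orbit l bounded_linear_potential_of_state I J])
  have "isospectral_set g a = (\<lambda>v. potential_of_state g (flow v p)) ` UNIV"
  proof (intro equalityI subsetI)
    fix y assume y: "y \<in> isospectral_set g a"
    then obtain v where "flow v p = state_of_potential g y" using orbit[OF I(1)] by blast
    then show "y \<in> (\<lambda>v. potential_of_state g (flow v p)) ` UNIV" using I(2)[OF y] by (intro image_eqI[of _ _ v]) auto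
  qed (elim imageE, simp only: J(1)[OF flow_in_M[OF p]])
  moreover have "continuous_on UNIV (\<lambda>v. potential_of_state g (flow v p))"
    by (rule continuous_on_coordinatewise_then_product)
      (rule bounded_linear.continuous_on[OF bounded_linear_potential_of_state continuous_flow[OF p]])
  ultimately show "connected (isospectral_set g a)"
    by (simp only: connected_continuous_image[OF _ connected_UNIV])
qed

end

text \<open>Nodes: the \<open>g\<close>-th roots of unity, with \<open>\<rho>\<close> chosen so that \<open>\<rho> p(z)\<close> is real for
  polynomials \<open>p\<close> satisfying the reality condition of \<open>\<alpha>\<close>.\<close>

lemma ex_nodes: "\<exists>z \<rho>. nodes g z \<rho>"
proof -
  \<comment> \<open>A square root of the node: for z = w^2 the factor \<rho> = i w^(-(g-1))
    satisfies \<rho> z^(g-1) = i w^(g-1) = - cnj \<rho>.\<close>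
  define w where "w j = cis (pi * real j / real g)" for j
  have "nodes g (\<lambda>j. w j ^ 2) (\<lambda>j. \<i> * inverse (w j) ^ (g - 1))"
  proof
    show "inj_on (\<lambda>j. w j ^ 2) {..<g}"
    proof (rule inj_onI)
      fix i j assume ij: "i \<in> {..<g}" "j \<in> {..<g}" "w i ^ 2 = w j ^ 2"
      have "cis (2 * pi * real i / real g) = cis (2 * pi * real j / real g)"
        using ij(3) by (simp add: w_def Complex.DeMoivre mult_ac)
      then show "i = j"
        using inj_onD[OF bij_betw_imp_inj_on[OF Complex.bij_betw_roots_unity[of g]], of i j] ij(1,2) by auto
    qed
    fix j assume "j < g"
    show "norm (w j ^ 2) = 1" by (simp add: w_def norm_power)
    have nz: "w j \<noteq> 0" by (simp add: w_def)
    then show "\<i> * inverse (w j) ^ (g - 1) \<noteq> 0" by simp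
    have "cnj (inverse (w j)) = w j" by (simp add: w_def cis_cnj)
    moreover have "inverse (w j) * (w j * w j) = w j" using nz by simp
    ultimately show "\<i> * inverse (w j) ^ (g - 1) * (w j ^ 2) ^ (g - 1) = - cnj (\<i> * inverse (w j) ^ (g - 1))"
      by (simp only: power_mult_distrib[symmetric] power2_eq_square mult.assoc complex_cnj_mult complex_cnj_power complex_cnj_i) simp
  qed
  then show ?thesis by blast
qed

theorem theorem4p8:
  fixes g :: nat and a :: "complex poly"
  assumes "a \<in> spectral_polys g"
  shows "compact (isospectral_set g a) \<and>
    (card {l. poly a l = 0} = 2 * g \<longrightarrow>
       connected (isospectral_set g a) \<and>
       smooth_manifold g (isospectral_set g a) \<and>
       diffeomorphic (isospectral_set g a) (torus g))"
proof -
  obtain z \<rho> where "nodes g z \<rho>" using ex_nodes by blast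
  then interpret nodes g z \<rho> .
  obtain \<xi> where \<xi>: "\<xi> \<in> potentials g" "spectral_poly g \<xi> a" using assms by (auto simp: spectral_polys_def)
  then have iso: "\<xi> \<in> isospectral_set g a" by (simp add: isospectral_set_def)
  then have "state_of_potential g \<xi> \<in> M a" using isospectral_iff[OF \<xi>(1)] by simp
  then have a: "a = [:0, 1:] * (al (state_of_potential g \<xi>))\<^sup>2 + be (state_of_potential g \<xi>) * ga (state_of_potential g \<xi>)" by (simp add: M_def)
  \<comment> \<open>a(0) = b(0) c(0), which is nonzero by the trace condition on potentials.\<close>
  have a0: "poly a 0 \<noteq> 0" using potentials_state_of_potential(5)[OF \<xi>(1)] by (subst a) simp
  have deg: "degree a \<le> 2 * g"
  proof -
    have "degree (be (state_of_potential g \<xi>) * ga (state_of_potential g \<xi>)) \<le> g + g"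
      using deg_lt_be[of "state_of_potential g \<xi>"] deg_lt_ga[of "state_of_potential g \<xi>"]
      by (intro degree_mult_le[THEN order_trans] add_mono) (auto simp: deg_lt_iff)
    moreover have "degree ([:0, 1:] * (al (state_of_potential g \<xi>))\<^sup>2) \<le> 2 * g"
    proof (cases "al (state_of_potential g \<xi>) = 0")
      case False
      then have "degree (al (state_of_potential g \<xi>)) < g" using deg_lt_al[of "state_of_potential g \<xi>"] by (simp add: deg_lt_iff)
      then show ?thesis using False by (simp add: degree_mult_eq degree_power_eq)
    qed simp
    ultimately show ?thesis by (subst a) (intro degree_add_le, auto)
  qed
  show ?thesis
  proof (intro conjI impI)
    show "compact (isospectral_set g a)" by (rule isospectral_compact[OF a0])
    assume card: "card {l. poly a l = 0} = 2 * g"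
    interpret smooth_curve g z \<rho> a by unfold_locales (fact a0 deg card)+
    show "connected (isospectral_set g a)" "smooth_manifold g (isospectral_set g a)"
      "diffeomorphic (isospectral_set g a) (torus g)"
      using isospectral_torus iso by blast+
  qed
qed


end
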